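(* Let $W$ be a finite irreducible Coxeter group. The map $\mathsf{Snap}\colon W\to\mathbf{B}^+(W)$ is a poset embedding (isomorphism onto its image with the induced order) from the shard intersection order $\mathrm{Shard}(W)$ into the interval $[\mathbbm{1},\Delta^2]$ of the weak order on the positive braid monoid $\mathbf{B}^+(W)$.
   Context: $W$ has simple reflections $S$ and acts on $\mathbb{R}^n$ as a reflection group with reflection arrangement $\mathcal{H}$; fix the fundamental chamber $B$ and identify $w\in W$ with the region $w(B)$ (right weak order on $W$ then equals the poset of regions ordered by inclusion of separating-hyperplane sets from $B$). Braid group $\mathbf{B}(W)$: generators $\mathbf{s}$ ($s\in S$), braid relations $\mathbf{s}\mathbf{s}'\mathbf{s}\cdots=\mathbf{s}'\mathbf{s}\mathbf{s}'\cdots$ (length $m(s,s')$). $\mathbf{B}^+(W)$ is the monoid generated by the $\mathbf{s}$, with weak order $\mathbf{u}\le\mathbf{v}$ iff $\mathbf{v}=\mathbf{u}\mathbf{x}$ for some $\mathbf{x}\in\mathbf{B}^+(W)$. $\mathrm{lift}(w)$ replaces letters of a reduced word by generators. $w_\circ$ is the longest element, $\Delta=\mathrm{lift}(w_\circ)$, $\Delta^2=\mathrm{lift}(w_\circ)^2$. $\mathrm{des}(w)$ is the set of right descents of $w$ and $w_\circ(J)$ is the longest element of the parabolic subgroup generated by $J\subseteq S$. $\mathsf{Snap}(w):=\mathrm{lift}(w)\cdot\mathrm{lift}(w_\circ(\mathrm{des}(w)))$, which equals $\mathrm{lift}(w\,w_\circ(\mathrm{des}(w)))\cdot\mathrm{lift}(w_\circ(\mathrm{des}(w)))^2$.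 Shards: a full rank-2 subarrangement is the set $\mathcal{A}$ of all hyperplanes containing a given codimension-2 subspace (when $|\mathcal A|\ge 2$); $H\in\mathcal A$ is basic if it meets the boundary of the region of $\mathcal A$ containing $B$ in dimension $n-1$; $H$ cuts $H'$ if they lie in such an $\mathcal A$ with $H$ basic and $H'$ not; shards of $H$ are closures of connected components of $H$ minus the hyperplanes cutting $H$. For a cover $u\lessdot us$ in weak order, $\Sigma(u\lessdot us)$ is the shard containing $\overline{u(B)}\cap\overline{us(B)}$; $\mathrm{cov}_\Sigma(w)$ is the set of $\Sigma(u\lessdot w)$ over all $u\lessdot w$. $\mathrm{Shard}(W)=(W,\preceq)$ with $u\preceq w$ iff $\bigcap\mathrm{cov}_\Sigma(u)\supseteq\bigcap\mathrm{cov}_\Sigma(w)$ (empty intersection $=\mathbb{R}^n$). *)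

theory Defs
  imports
    "HOL-Analysis.Analysis"
    "HOL-Algebra.Group_Action"
    "HOL-Algebra.Generated_Groups"
    "HOL-Algebra.Multiplicative_Group"
begin

section \<open>Groups given by generators and relations\<close>

text \<open>
  A letter \<open>(x, True)\<close> stands for the generator \<open>x\<close>, and \<open>(x, False)\<close> for its inverse.
  The relation below is the congruence on words over \<open>X\<close> and its inverses generated by free
  cancellation and the pairs in \<open>R\<close>; it is meant for \<open>R\<close> consisting of words over \<open>X\<close>.
\<close>

type_synonym 'x sword = "('x \<times> bool) list"

abbreviation swords :: "'x set \<Rightarrow> 'x sword set" where
  "swords X \<equiv> lists (X \<times> UNIV)"

definition pos :: "'x list \<Rightarrow> 'x sword" where
  "pos xs = map (\<lambda>x. (x, True)) xs"

inductive_set pres_rel ::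
  "'x set \<Rightarrow> ('x sword \<times> 'x sword) set \<Rightarrow> ('x sword \<times> 'x sword) set"
  for X :: "'x set" and R :: "('x sword \<times> 'x sword) set" where
  refl: "w \<in> swords X \<Longrightarrow> (w, w) \<in> pres_rel X R"
| sym: "(u, v) \<in> pres_rel X R \<Longrightarrow> (v, u) \<in> pres_rel X R"
| trans: "(u, v) \<in> pres_rel X R \<Longrightarrow> (v, w) \<in> pres_rel X R \<Longrightarrow> (u, w) \<in> pres_rel X R"
| cancel: "p \<in> swords X \<Longrightarrow> q \<in> swords X \<Longrightarrow> x \<in> X \<Longrightarrow>
    (p @ [(x, b), (x, \<not> b)] @ q, p @ q) \<in> pres_rel X R"
| relation: "p \<in> swords X \<Longrightarrow> q \<in> swords X \<Longrightarrow> (r, r') \<in> R \<Longrightarrow>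
    (p @ r @ q, p @ r' @ q) \<in> pres_rel X R"

definition presented_group ::
  "'x set \<Rightarrow> ('x sword \<times> 'x sword) set \<Rightarrow> 'x sword set monoid" where
  "presented_group X R =
     \<lparr>carrier = swords X // pres_rel X R,
      mult = (\<lambda>A B. \<Union>u\<in>A. \<Union>v\<in>B. pres_rel X R `` {u @ v}),
      one = pres_rel X R `` {[]}\<rparr>"

lemma pres_rel_in_swords:
  assumes "R \<subseteq> swords X \<times> swords X" and "(u, v) \<in> pres_rel X R"
  shows "u \<in> swords X \<and> v \<in> swords X"
  using assms(2) by induction (use assms(1) in auto)

lemma equiv_pres_rel:
  assumes "R \<subseteq> swords X \<times> swords X"
  shows "equiv (swords X) (pres_rel X R)"
  using pres_rel_in_swords[OF assms]
  by (intro equivI refl_onI symI transI) (auto intro: pres_rel.intros)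

lemma pres_rel_context:
  assumes "(u, v) \<in> pres_rel X R" "p \<in> swords X" "q \<in> swords X"
  shows "(p @ u @ q, p @ v @ q) \<in> pres_rel X R"
  using assms(1)
proof induction
  case (cancel p' q' x b)
  then show ?case using assms(2,3) pres_rel.cancel[of "p @ p'" X "q' @ q" x b R] by auto
next
  case (relation p' q' r r')
  then show ?case using assms(2,3) pres_rel.relation[of "p @ p'" X "q' @ q" r r' R] by auto
next
  case (refl w)
  then show ?case using assms(2,3) by (intro pres_rel.refl) simp
next
  case (sym u v)
  then show ?case by (blast intro: pres_rel.sym)
next
  case (trans u v w)
  then show ?case by (blast intro: pres_rel.trans)
qed

lemma presented_group_mult_class:
  assumes R: "R \<subseteq> swords X \<times> swords X" and u: "u \<in> swords X" and v: "v \<in> swords X"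
  shows "(pres_rel X R `` {u}) \<otimes>\<^bsub>presented_group X R\<^esub> (pres_rel X R `` {v})
           = pres_rel X R `` {u @ v}"
proof -
  have "pres_rel X R `` {u' @ v'} = pres_rel X R `` {u @ v}"
    if "(u, u') \<in> pres_rel X R" "(v, v') \<in> pres_rel X R" for u' v'
  proof -
    have "(u @ v, u' @ v) \<in> pres_rel X R"
      using pres_rel_context[OF that(1), of "[]" v] v by simp
    moreover have "(u' @ v, u' @ v') \<in> pres_rel X R"
      using pres_rel_context[OF that(2), of u' "[]"] pres_rel_in_swords[OF R that(1)] by simp
    ultimately have "(u @ v, u' @ v') \<in> pres_rel X R" by (rule pres_rel.trans)
    then show ?thesis by (rule equiv_class_eq[OF equiv_pres_rel[OF R], symmetric])
  qed
  then have "pres_rel X R `` {u' @ v'} = pres_rel X R `` {u @ v}"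
    if "u' \<in> pres_rel X R `` {u}" "v' \<in> pres_rel X R `` {v}" for u' v'
    using that unfolding Image_singleton_iff by blast
  moreover have "u \<in> pres_rel X R `` {u}" "v \<in> pres_rel X R `` {v}"
    unfolding Image_singleton_iff by (rule pres_rel.refl, fact)+
  ultimately have "(\<Union>u'\<in>pres_rel X R `` {u}. \<Union>v'\<in>pres_rel X R `` {v}. pres_rel X R `` {u' @ v'})
      = pres_rel X R `` {u @ v}"
    by (metis (no_types, lifting) SUP_eq_const empty_iff)
  then show ?thesis unfolding presented_group_def monoid.simps .
qed

lemma pres_rel_inverse:
  assumes "u \<in> swords X"
  shows "(map (\<lambda>(x, b). (x, \<not> b)) (rev u) @ u, []) \<in> pres_rel X R"
  using assms
proof (induction u)
  case Nil
  then show ?case by (auto intro: pres_rel.refl)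
next
  case (Cons a u)
  obtain x b where a: "a = (x, b)" by force
  have "(map (\<lambda>(x, b). (x, \<not> b)) (rev u) @ [(x, \<not> b), (x, \<not> \<not> b)] @ u,
         map (\<lambda>(x, b). (x, \<not> b)) (rev u) @ u) \<in> pres_rel X R"
    using Cons.hyps Cons.prems a
    by (intro pres_rel.cancel) (auto simp: in_lists_conv_set)
  moreover have "(map (\<lambda>(x, b). (x, \<not> b)) (rev u) @ u, []) \<in> pres_rel X R"
    using Cons by simp
  ultimately have "(map (\<lambda>(x, b). (x, \<not> b)) (rev u) @ [(x, \<not> b), (x, \<not> \<not> b)] @ u, [])
      \<in> pres_rel X R"
    by (rule pres_rel.trans)
  then show ?case using a by simp
qed

lemma group_presented_group:
  assumes R: "R \<subseteq> swords X \<times> swords X"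
  shows "group (presented_group X R)"
proof (rule groupI)
  let ?P = "presented_group X R" and ?c = "\<lambda>u. pres_rel X R `` {u}"
  note mult = presented_group_mult_class[OF R]
  have carr: "A \<in> carrier ?P \<longleftrightarrow> (\<exists>u\<in>swords X. A = ?c u)" for A
    by (auto simp: presented_group_def quotient_def)
  have one: "\<one>\<^bsub>?P\<^esub> = ?c []" by (simp add: presented_group_def)
  show "\<one>\<^bsub>?P\<^esub> \<in> carrier ?P" unfolding carr one by blast
  have carrI: "?c u \<in> carrier ?P" if "u \<in> swords X" for u
    using that carr by blast
  have carrE: thesis if "A \<in> carrier ?P" "\<And>u. u \<in> swords X \<Longrightarrow> A = ?c u \<Longrightarrow> thesis" for A thesis
    using that carr by blast
  show "x \<otimes>\<^bsub>?P\<^esub> y \<in> carrier ?P" if "x \<in> carrier ?P" "y \<in> carrier ?P" for x y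
    by (rule carrE[OF that(1)], rule carrE[OF that(2)]) (simp add: mult carrI)
  show "x \<otimes>\<^bsub>?P\<^esub> y \<otimes>\<^bsub>?P\<^esub> z = x \<otimes>\<^bsub>?P\<^esub> (y \<otimes>\<^bsub>?P\<^esub> z)"
    if "x \<in> carrier ?P" "y \<in> carrier ?P" "z \<in> carrier ?P" for x y z
    by (rule carrE[OF that(1)], rule carrE[OF that(2)], rule carrE[OF that(3)]) (simp add: mult)
  show "\<one>\<^bsub>?P\<^esub> \<otimes>\<^bsub>?P\<^esub> x = x" if "x \<in> carrier ?P" for x
    by (rule carrE[OF that]) (simp add: one mult)
  show "\<exists>y\<in>carrier ?P. y \<otimes>\<^bsub>?P\<^esub> x = \<one>\<^bsub>?P\<^esub>" if *: "x \<in> carrier ?P" for x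
  proof -
    obtain u where u: "u \<in> swords X" "x = ?c u" by (rule carrE[OF *])
    let ?v = "map (\<lambda>(x, b). (x, \<not> b)) (rev u)"
    have v: "?v \<in> swords X" using u(1) by (auto simp: in_lists_conv_set)
    have "?c ?v \<otimes>\<^bsub>?P\<^esub> x = ?c (?v @ u)" unfolding u(2) by (rule mult[OF v u(1)])
    also have "\<dots> = ?c []"
      by (rule equiv_class_eq[OF equiv_pres_rel[OF R] pres_rel_inverse[OF u(1)]])
    finally have "?c ?v \<otimes>\<^bsub>?P\<^esub> x = \<one>\<^bsub>?P\<^esub>" unfolding one .
    then show ?thesis using carrI[OF v] by (rule bexI)
  qed
qed


section \<open>Coxeter systems\<close>

definition word_prod :: "('w, 'm) monoid_scheme \<Rightarrow> 'w list \<Rightarrow> 'w" where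
  "word_prod W ws = foldr (\<otimes>\<^bsub>W\<^esub>) ws \<one>\<^bsub>W\<^esub>"

definition sword_prod :: "('w, 'm) monoid_scheme \<Rightarrow> 'w sword \<Rightarrow> 'w" where
  "sword_prod W u = word_prod W (map (\<lambda>(x, b). if b then x else inv\<^bsub>W\<^esub> x) u)"

definition alt :: "nat \<Rightarrow> 's \<Rightarrow> 's \<Rightarrow> 's list" where
  "alt k s t = map (\<lambda>i. if even i then s else t) [0..<k]"

text \<open>
  As \<open>group.ord\<close> is \<open>0\<close> on elements of infinite order, such pairs of generators
  contribute only trivial relations below.
\<close>

definition cox_m :: "('w, 'm) monoid_scheme \<Rightarrow> 'w \<Rightarrow> 'w \<Rightarrow> nat" where
  "cox_m W s t = group.ord W (s \<otimes>\<^bsub>W\<^esub> t)"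

definition coxeter_relations ::
  "('w, 'm) monoid_scheme \<Rightarrow> 'w set \<Rightarrow> ('w sword \<times> 'w sword) set" where
  "coxeter_relations W S = {(pos (alt (2 * cox_m W s t) s t), []) | s t. s \<in> S \<and> t \<in> S}"

text \<open>
  The last clause says that the relations \<open>(s t)\<^sup>m = 1\<close>, \<open>m\<close> being the order of \<open>s t\<close>, present
  \<open>W\<close>. The case \<open>s = t\<close> is included and gives \<open>s\<^sup>2 = 1\<close>, since then \<open>m = 1\<close>.
\<close>

definition coxeter_system :: "('w, 'm) monoid_scheme \<Rightarrow> 'w set \<Rightarrow> bool" where
  "coxeter_system W S \<longleftrightarrow>
     group W \<and> S \<subseteq> carrier W \<and> generate W S = carrier W \<and>
     (\<forall>s\<in>S. group.ord W s = 2) \<and>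
     (\<forall>u\<in>swords S. \<forall>v\<in>swords S.
        sword_prod W u = sword_prod W v \<longleftrightarrow> (u, v) \<in> pres_rel S (coxeter_relations W S))"

definition coxeter_graph :: "('w, 'm) monoid_scheme \<Rightarrow> 'w set \<Rightarrow> ('w \<times> 'w) set" where
  "coxeter_graph W S = {(s, t). s \<in> S \<and> t \<in> S \<and> s \<noteq> t \<and> cox_m W s t \<noteq> 2}"

definition irreducible_coxeter :: "('w, 'm) monoid_scheme \<Rightarrow> 'w set \<Rightarrow> bool" where
  "irreducible_coxeter W S \<longleftrightarrow>
     S \<noteq> {} \<and> (\<forall>s\<in>S. \<forall>t\<in>S. (s, t) \<in> (coxeter_graph W S)\<^sup>*)"

definition len :: "('w, 'm) monoid_scheme \<Rightarrow> 'w set \<Rightarrow> 'w \<Rightarrow> nat" where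
  "len W S w = (LEAST k. \<exists>ss\<in>lists S. length ss = k \<and> word_prod W ss = w)"

definition reduced_word :: "('w, 'm) monoid_scheme \<Rightarrow> 'w set \<Rightarrow> 'w \<Rightarrow> 'w list \<Rightarrow> bool" where
  "reduced_word W S w ss \<longleftrightarrow> ss \<in> lists S \<and> word_prod W ss = w \<and> length ss = len W S w"

definition right_weak_le :: "('w, 'm) monoid_scheme \<Rightarrow> 'w set \<Rightarrow> 'w \<Rightarrow> 'w \<Rightarrow> bool" where
  "right_weak_le W S u v \<longleftrightarrow> len W S v = len W S u + len W S (inv\<^bsub>W\<^esub> u \<otimes>\<^bsub>W\<^esub> v)"

definition right_weak_covers :: "('w, 'm) monoid_scheme \<Rightarrow> 'w set \<Rightarrow> 'w \<Rightarrow> 'w \<Rightarrow> bool" where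
  "right_weak_covers W S u v \<longleftrightarrow>
     u \<in> carrier W \<and> v \<in> carrier W \<and> u \<noteq> v \<and> right_weak_le W S u v \<and>
     \<not> (\<exists>x\<in>carrier W. x \<noteq> u \<and> x \<noteq> v \<and> right_weak_le W S u x \<and> right_weak_le W S x v)"

definition des :: "('w, 'm) monoid_scheme \<Rightarrow> 'w set \<Rightarrow> 'w \<Rightarrow> 'w set" where
  "des W S w = {s \<in> S. len W S (w \<otimes>\<^bsub>W\<^esub> s) < len W S w}"

definition longest :: "('w, 'm) monoid_scheme \<Rightarrow> 'w set \<Rightarrow> 'w set \<Rightarrow> 'w" where
  "longest W S J = (ARG_MAX (len W S) w. w \<in> generate W J)"


section \<open>The braid group, the positive braid monoid and Snap\<close>

definition braid_relations ::
  "('w, 'm) monoid_scheme \<Rightarrow> 'w set \<Rightarrow> ('w sword \<times> 'w sword) set" where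
  "braid_relations W S =
     {(pos (alt (cox_m W s t) s t), pos (alt (cox_m W s t) t s)) | s t. s \<in> S \<and> t \<in> S \<and> s \<noteq> t}"

definition braid_group :: "('w, 'm) monoid_scheme \<Rightarrow> 'w set \<Rightarrow> 'w sword set monoid" where
  "braid_group W S = presented_group S (braid_relations W S)"

definition braid_gen :: "('w, 'm) monoid_scheme \<Rightarrow> 'w set \<Rightarrow> 'w \<Rightarrow> 'w sword set" where
  "braid_gen W S s = pres_rel S (braid_relations W S) `` {pos [s]}"

lemma alt_in_lists: "s \<in> S \<Longrightarrow> t \<in> S \<Longrightarrow> pos (alt k s t) \<in> swords S"
  by (auto simp: pos_def alt_def)

lemma group_braid_group: "group (braid_group W S)"
  unfolding braid_group_def
proof (rule group_presented_group)
  show "braid_relations W S \<subseteq> swords S \<times> swords S"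
  proof
    fix r assume "r \<in> braid_relations W S"
    then obtain s t where "s \<in> S" "t \<in> S"
      and r: "r = (pos (alt (cox_m W s t) s t), pos (alt (cox_m W s t) t s))"
      unfolding braid_relations_def by blast
    then show "r \<in> swords S \<times> swords S"
      unfolding r by (intro SigmaI alt_in_lists)
  qed
qed

inductive_set monoid_generate :: "('g, 'm) monoid_scheme \<Rightarrow> 'g set \<Rightarrow> 'g set"
  for G :: "('g, 'm) monoid_scheme" and X :: "'g set" where
  one: "\<one>\<^bsub>G\<^esub> \<in> monoid_generate G X"
| incl: "x \<in> X \<Longrightarrow> x \<in> monoid_generate G X"
| mult: "x \<in> monoid_generate G X \<Longrightarrow> y \<in> monoid_generate G X \<Longrightarrow>
    x \<otimes>\<^bsub>G\<^esub> y \<in> monoid_generate G X"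

text \<open>
  The positive braid monoid is the submonoid of the braid group generated by the
  generators, so equality of positive braids is equality in the group.
\<close>

definition pos_braids :: "('w, 'm) monoid_scheme \<Rightarrow> 'w set \<Rightarrow> 'w sword set set" where
  "pos_braids W S = monoid_generate (braid_group W S) (braid_gen W S ` S)"

definition braid_le ::
  "('w, 'm) monoid_scheme \<Rightarrow> 'w set \<Rightarrow> 'w sword set \<Rightarrow> 'w sword set \<Rightarrow> bool" where
  "braid_le W S u v \<longleftrightarrow> (\<exists>x\<in>pos_braids W S. v = u \<otimes>\<^bsub>braid_group W S\<^esub> x)"

definition braid_interval ::
  "('w, 'm) monoid_scheme \<Rightarrow> 'w set \<Rightarrow> 'w sword set \<Rightarrow> 'w sword set \<Rightarrow> 'w sword set set" where
  "braid_interval W S a b = {x \<in> pos_braids W S. braid_le W S a x \<and> braid_le W S x b}"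

text \<open>By Matsumoto's theorem the lift does not depend on the choice of reduced word.\<close>

definition lift :: "('w, 'm) monoid_scheme \<Rightarrow> 'w set \<Rightarrow> 'w \<Rightarrow> 'w sword set" where
  "lift W S w =
     word_prod (braid_group W S) (map (braid_gen W S) (SOME ss. reduced_word W S w ss))"

definition Delta :: "('w, 'm) monoid_scheme \<Rightarrow> 'w set \<Rightarrow> 'w sword set" where
  "Delta W S = lift W S (longest W S S)"

definition Snap :: "('w, 'm) monoid_scheme \<Rightarrow> 'w set \<Rightarrow> 'w \<Rightarrow> 'w sword set" where
  "Snap W S w = lift W S w \<otimes>\<^bsub>braid_group W S\<^esub> lift W S (longest W S (des W S w))"


section \<open>Hyperplane arrangements and shards\<close>

text \<open>An arrangement is a set of linear hyperplanes; its regions are open.\<close>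

definition regions :: "'a::euclidean_space set set \<Rightarrow> 'a set set" where
  "regions \<A> = components (- \<Union>\<A>)"

definition is_wall :: "'a::euclidean_space set \<Rightarrow> 'a set \<Rightarrow> bool" where
  "is_wall H C \<longleftrightarrow> aff_dim (H \<inter> frontier C) = int DIM('a) - 1"

definition full_rank2_subarrangement ::
  "'a::euclidean_space set set \<Rightarrow> 'a set set \<Rightarrow> bool" where
  "full_rank2_subarrangement \<H> \<A> \<longleftrightarrow>
     (\<exists>L. subspace L \<and> dim L + 2 = DIM('a) \<and> \<A> = {H \<in> \<H>. L \<subseteq> H}) \<and>
     (\<exists>H\<in>\<A>. \<exists>H'\<in>\<A>. H \<noteq> H')"

definition basic :: "'a::euclidean_space set set \<Rightarrow> 'a set \<Rightarrow> 'a set \<Rightarrow> bool" where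
  "basic \<A> B H \<longleftrightarrow> H \<in> \<A> \<and> (\<exists>C\<in>regions \<A>. B \<subseteq> C \<and> is_wall H C)"

definition cuts :: "'a::euclidean_space set set \<Rightarrow> 'a set \<Rightarrow> 'a set \<Rightarrow> 'a set \<Rightarrow> bool" where
  "cuts \<H> B H H' \<longleftrightarrow>
     (\<exists>\<A>. full_rank2_subarrangement \<H> \<A> \<and> H \<in> \<A> \<and> H' \<in> \<A> \<and> basic \<A> B H \<and> \<not> basic \<A> B H')"

definition shards_of :: "'a::euclidean_space set set \<Rightarrow> 'a set \<Rightarrow> 'a set \<Rightarrow> 'a set set" where
  "shards_of \<H> B H = closure ` components (H - \<Union>{H' \<in> \<H>. cuts \<H> B H' H})"

definition shards :: "'a::euclidean_space set set \<Rightarrow> 'a set \<Rightarrow> 'a set set" where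
  "shards \<H> B = (\<Union>H\<in>\<H>. shards_of \<H> B H)"


section \<open>Reflection groups and the shard intersection order\<close>

definition reflection_in :: "'a::euclidean_space \<Rightarrow> 'a \<Rightarrow> 'a" where
  "reflection_in a x = x - (2 * (a \<bullet> x) / (a \<bullet> a)) *\<^sub>R a"

definition reflection_arrangement ::
  "('w, 'm) monoid_scheme \<Rightarrow> ('w \<Rightarrow> 'a \<Rightarrow> 'a::euclidean_space) \<Rightarrow> 'a set set" where
  "reflection_arrangement W \<rho> =
     {{x. a \<bullet> x = 0} | a. a \<noteq> 0 \<and> (\<exists>t\<in>carrier W. \<rho> t = reflection_in a)}"

text \<open>
  \<open>W\<close> acts faithfully by isometries, \<open>B\<close> is a region of its reflection arrangement, and
  the simple reflections \<open>S\<close> are exactly the reflections in the walls of \<open>B\<close>. The action is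
  not required to be essential.
\<close>

definition reflection_group_action ::
  "('w, 'm) monoid_scheme \<Rightarrow> 'w set \<Rightarrow> ('w \<Rightarrow> 'a \<Rightarrow> 'a::euclidean_space) \<Rightarrow> 'a set \<Rightarrow> bool" where
  "reflection_group_action W S \<rho> B \<longleftrightarrow>
     faithful_action W UNIV \<rho> \<and>
     (\<forall>w\<in>carrier W. orthogonal_transformation (\<rho> w)) \<and>
     B \<in> regions (reflection_arrangement W \<rho>) \<and>
     \<rho> ` S = {reflection_in a | a. a \<noteq> 0 \<and>
       {x. a \<bullet> x = 0} \<in> reflection_arrangement W \<rho> \<and> is_wall {x. a \<bullet> x = 0} B}"

definition cover_shard ::
  "('w, 'm) monoid_scheme \<Rightarrow> ('w \<Rightarrow> 'a \<Rightarrow> 'a::euclidean_space) \<Rightarrow> 'a set \<Rightarrow> 'w \<Rightarrow> 'w \<Rightarrow> 'a set" where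
  "cover_shard W \<rho> B u w =
     (THE \<Sigma>. \<Sigma> \<in> shards (reflection_arrangement W \<rho>) B \<and>
             closure (\<rho> u ` B) \<inter> closure (\<rho> w ` B) \<subseteq> \<Sigma>)"

definition cov_shards ::
  "('w, 'm) monoid_scheme \<Rightarrow> 'w set \<Rightarrow> ('w \<Rightarrow> 'a \<Rightarrow> 'a::euclidean_space) \<Rightarrow> 'a set \<Rightarrow> 'w
    \<Rightarrow> 'a set set" where
  "cov_shards W S \<rho> B w = {cover_shard W \<rho> B u w | u. right_weak_covers W S u w}"

text \<open>The empty intersection is the whole space, by the library's convention for \<open>\<Inter>{}\<close>.\<close>

definition shard_le ::
  "('w, 'm) monoid_scheme \<Rightarrow> 'w set \<Rightarrow> ('w \<Rightarrow> 'a \<Rightarrow> 'a::euclidean_space) \<Rightarrow> 'a set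
    \<Rightarrow> 'w \<Rightarrow> 'w \<Rightarrow> bool" where
  "shard_le W S \<rho> B u w \<longleftrightarrow> \<Inter>(cov_shards W S \<rho> B w) \<subseteq> \<Inter>(cov_shards W S \<rho> B u)"


section \<open>Poset embeddings\<close>

definition poset_embedding ::
  "'p set \<Rightarrow> ('p \<Rightarrow> 'p \<Rightarrow> bool) \<Rightarrow> 'q set \<Rightarrow> ('q \<Rightarrow> 'q \<Rightarrow> bool) \<Rightarrow> ('p \<Rightarrow> 'q) \<Rightarrow> bool" where
  "poset_embedding P leP Q leQ f \<longleftrightarrow>
     f ` P \<subseteq> Q \<and> inj_on f P \<and> (\<forall>x\<in>P. \<forall>y\<in>P. leP x y \<longleftrightarrow> leQ (f x) (f y))"

end

theory Submission
  imports Defs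
begin

text \<open>
  Write \<open>T\<close> for the reflections, \<open>Inv w\<close> for the inversions of \<open>w\<close> and \<open>W\<^sub>J\<close> for parabolic subgroups.
  Both orders are compared with a third one: \<open>u\<close> is below \<open>w\<close> iff \<open>Inv u \<subseteq> Inv w\<close> and the parabolic
  subgroup generated by the cover reflections of \<open>u\<close> is contained in that of \<open>w\<close>.

  For braids, counting how often a positive braid crosses each hyperplane gives a \<open>1\<close>-cocycle on the
  braid group whose value at \<open>Snap w\<close> is the indicator of \<open>Inv w\<close> plus that of the parabolic subgroup;
  it is monotone. Conversely, if \<open>w = u v\<close> and \<open>v = v\<^sub>1 x\<close> with \<open>v\<^sub>1\<close> minimal in \<open>v W\<^sub>J\<close>, then \<open>v\<^sub>1\<close>
  conjugates the longest element of the first parabolic subgroup into \<open>W\<^sub>J\<close> and additivity of lengths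
  turns \<open>lift v \<Delta>\<^sub>J\<close> into a multiple of the lift of that longest element.

  For shards, the intersection of the lower shards of \<open>w\<close> is the cone of all \<open>x\<close> lying on the lower
  walls of \<open>w\<close> and weakly beyond every hyperplane of \<open>Inv w\<close>. The hard inclusion attaches to a lower
  facet the least element below \<open>w\<close> that inverts it; this element is locally constant along a shard,
  and \<open>w\<close> is the join of the elements attached to its lower facets.
\<close>

section \<open>Cells of linear arrangements\<close>

text \<open>All of the combinatorics is carried by the sets \<open>Inv w\<close>, the mirrors
  separating \<open>b\<close> from \<open>\<rho> w b\<close>: length is their number, weak order is
  their inclusion, and multiplication acts by the cocycle rule \<open>Inv_mult\<close>.

  The third order suits braids because the parabolic reflections at \<open>w\<close> are themselves
  inversions of \<open>w\<close>. The crossing numbers of \<open>Snap W S w\<close> are therefore 0,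
  1 or 2; the nonzero ones recover \<open>Inv w\<close>, the value 2 recovers the parabolic part.
  They must be counted with sign, since positive braids are compared inside the group, where words
  with inverse letters may intervene.

  The obstacle on the shard side is that a shard prescribes signs only on the mirrors that cut it,
  while the cone asks for a sign on every inversion. A cut is a positive linear relation between
  three normals, which settles the easy inclusion. For the converse the missing inequalities come
  from order theory: elements whose inversions are forced along a whole shard are produced by local
  confluence, and this reduces to a dichotomy for cosets of rank-two parabolic subgroups.\<close>

lemma connected_component_sign_cell:
  fixes A :: "'a::euclidean_space set"
  assumes X: "convex X" and p: "p \<in> X" "\<And>a. a \<in> A \<Longrightarrow> a \<bullet> p \<noteq> 0"
  shows "connected_component_set (X - (\<Union>a\<in>A. {x. a \<bullet> x = 0})) p
           = {x \<in> X. \<forall>a\<in>A. 0 < (a \<bullet> x) * (a \<bullet> p)}" (is "?C = ?D")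
proof
  have eq: "?D = X \<inter> (\<Inter>a\<in>A. {x. ((a \<bullet> p) *\<^sub>R a) \<bullet> x > 0})"
    by (auto simp: mult.commute)
  have "convex ?D" unfolding eq by (intro convex_Int convex_INT X convex_halfspace_gt)
  moreover have "p \<in> ?D" using p by (simp add: zero_less_mult_iff linorder_neq_iff) blast
  ultimately show "?D \<subseteq> ?C"
    by (intro connected_component_maximal convex_connected) auto
next
  have sub: "?C \<subseteq> X - (\<Union>a\<in>A. {x. a \<bullet> x = 0})" by (rule connected_component_subset)
  have p': "p \<in> ?C" using p by auto
  show "?C \<subseteq> ?D"
  proof
    fix y assume y: "y \<in> ?C"
    have "0 < (a \<bullet> y) * (a \<bullet> p)" if a: "a \<in> A" for a
    proof (rule ccontr)
      assume "\<not> ?thesis"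
      then have "a \<bullet> y \<le> 0 \<and> 0 \<le> a \<bullet> p \<or> a \<bullet> p \<le> 0 \<and> 0 \<le> a \<bullet> y"
        by (auto simp: zero_less_mult_iff not_less)
      \<comment> \<open>A connected set meeting both closed sides of a hyperplane meets the
        hyperplane; the two cases only exchange the roles of \<open>y\<close> and
        \<open>p\<close>.\<close>
      then obtain z where "z \<in> ?C" "a \<bullet> z = 0"
        using connected_ivt_hyperplane[OF connected_connected_component y p', of a 0]
          connected_ivt_hyperplane[OF connected_connected_component p' y, of a 0] by blast
      then show False using sub a by auto
    qed
    then show "y \<in> ?D" using y sub by auto
  qed
qed

lemma component_sign_cell:
  fixes A :: "'a::euclidean_space set"
  assumes "convex X" "C \<in> components (X - (\<Union>a\<in>A. {x. a \<bullet> x = 0}))" "p \<in> C"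
  shows "C = {x \<in> X. \<forall>a\<in>A. 0 < (a \<bullet> x) * (a \<bullet> p)}"
proof -
  have p: "p \<in> X - (\<Union>a\<in>A. {x. a \<bullet> x = 0})" using assms(2,3) in_components_subset by blast
  obtain q where q: "C = connected_component_set (X - (\<Union>a\<in>A. {x. a \<bullet> x = 0})) q"
    using assms(2) unfolding components_def by blast
  have "C = connected_component_set (X - (\<Union>a\<in>A. {x. a \<bullet> x = 0})) p"
    using assms(3) connected_component_eq[of p "X - (\<Union>a\<in>A. {x. a \<bullet> x = 0})" q] unfolding q by simp
  also have "\<dots> = {x \<in> X. \<forall>a\<in>A. 0 < (a \<bullet> x) * (a \<bullet> p)}"
    by (rule connected_component_sign_cell) (use assms p in auto)
  finally show ?thesis .
qed

lemma sign_cell_in_components: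
  fixes A :: "'a::euclidean_space set"
  assumes "convex X" "p \<in> X" "\<And>a. a \<in> A \<Longrightarrow> a \<bullet> p \<noteq> 0"
  shows "{x \<in> X. \<forall>a\<in>A. 0 < (a \<bullet> x) * (a \<bullet> p)} \<in> components (X - (\<Union>a\<in>A. {x. a \<bullet> x = 0}))"
proof -
  have "p \<in> X - (\<Union>a\<in>A. {x. a \<bullet> x = 0})" using assms by auto
  then have "connected_component_set (X - (\<Union>a\<in>A. {x. a \<bullet> x = 0})) p
      \<in> components (X - (\<Union>a\<in>A. {x. a \<bullet> x = 0}))"
    by (rule componentsI)
  then show ?thesis by (simp only: connected_component_sign_cell[OF assms])
qed

text \<open>The segment from a point of the weak cone to the reference point \<open>p\<close> runs
  inside the strict cell except possibly at its starting point, so that point is a limit of the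
  points at parameter \<open>1 / Suc n\<close>.\<close>

lemma closure_sign_cell:
  fixes A :: "'a::euclidean_space set"
  assumes X: "convex X" "closed X" and p: "p \<in> X" "\<And>a. a \<in> A \<Longrightarrow> a \<bullet> p \<noteq> 0"
  shows "closure {x \<in> X. \<forall>a\<in>A. 0 < (a \<bullet> x) * (a \<bullet> p)}
           = {x \<in> X. \<forall>a\<in>A. 0 \<le> (a \<bullet> x) * (a \<bullet> p)}" (is "closure ?C = ?D")
proof
  have eq: "?D = X \<inter> (\<Inter>a\<in>A. {x. ((a \<bullet> p) *\<^sub>R a) \<bullet> x \<ge> 0})"
    by (auto simp: mult.commute)
  have "closed ?D" unfolding eq by (intro closed_Int closed_INT ballI X closed_halfspace_ge)
  then show "closure ?C \<subseteq> ?D" by (intro closure_minimal) (auto simp: less_imp_le)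
next
  show "?D \<subseteq> closure ?C"
  proof
    fix x assume x: "x \<in> ?D"
    let ?f = "\<lambda>n. x + (1 / real (Suc n)) *\<^sub>R (p - x)"
    have "?f n \<in> ?C" for n
    proof -
      let ?e = "1 / real (Suc n)"
      have eq: "?f n = (1 - ?e) *\<^sub>R x + ?e *\<^sub>R p" by (simp add: algebra_simps)
      have "?f n \<in> X" unfolding eq
        by (rule convexD[OF X(1)]) (use x p in auto)
      moreover have "0 < (a \<bullet> ?f n) * (a \<bullet> p)" if a: "a \<in> A" for a
      proof -
        have "(a \<bullet> ?f n) * (a \<bullet> p) = (1 - ?e) * ((a \<bullet> x) * (a \<bullet> p)) + ?e * ((a \<bullet> p) * (a \<bullet> p))"
          unfolding eq by (simp only: inner_add_right inner_scaleR_right) (simp only: ring_distribs mult_ac)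
        moreover have "0 \<le> (1 - ?e) * ((a \<bullet> x) * (a \<bullet> p))"
          by (rule mult_nonneg_nonneg) (use x a in auto)
        moreover have "0 < ?e * ((a \<bullet> p) * (a \<bullet> p))"
          by (rule mult_pos_pos) (use p(2)[OF a] in \<open>auto simp: zero_less_mult_iff\<close>)
        ultimately show ?thesis by linarith
      qed
      ultimately show ?thesis by blast
    qed
    moreover have "?f \<longlonglongrightarrow> x + 0 *\<^sub>R (p - x)"
      by (intro tendsto_intros LIMSEQ_Suc lim_1_over_n)
    ultimately show "x \<in> closure ?C"
      unfolding closure_sequential by (intro exI[of _ ?f]) auto
  qed
qed

lemma inner_reflection_in:
  assumes "norm a = 1"
  shows "reflection_in a x = x - (2 * (a \<bullet> x)) *\<^sub>R a"
  using assms by (simp add: reflection_in_def norm_eq_1)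

lemma reflection_in_scale:
  assumes "c \<noteq> 0"
  shows "reflection_in (c *\<^sub>R a) = reflection_in a"
  using assms by (auto simp: reflection_in_def fun_eq_iff field_simps)

lemma reflection_in_unit_eq:
  assumes a: "norm a = 1" and a': "norm a' = 1" and eq: "reflection_in a = reflection_in a'"
  shows "a' = a \<or> a' = - a"
proof -
  have aa: "a \<bullet> a = 1" using a by (simp add: norm_eq_1)
  have "a - 2 *\<^sub>R a = a - (2 * (a' \<bullet> a)) *\<^sub>R a'"
    using fun_cong[OF eq, of a] aa by (simp add: inner_reflection_in a a')
  then have "2 *\<^sub>R a = 2 *\<^sub>R ((a' \<bullet> a) *\<^sub>R a')" by simp
  then have *: "a = (a' \<bullet> a) *\<^sub>R a'" by (simp only: scaleR_cancel_left) simp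
  then have "\<bar>a' \<bullet> a\<bar> = 1" using a a' by (metis norm_scaleR mult.right_neutral)
  then have "a' \<bullet> a = 1 \<or> a' \<bullet> a = -1" by linarith
  then show ?thesis using * by auto
qed

text \<open>Reflecting \<open>y\<close> brings it closer to \<open>x\<close> exactly when the mirror
  strictly separates them. This is why the point of an orbit nearest to \<open>b\<close> lies in the
  closed chamber of \<open>b\<close>.\<close>

lemma norm_reflection_diff:
  assumes "norm a = 1"
  shows "(norm (reflection_in a y - x))\<^sup>2 = (norm (y - x))\<^sup>2 + 4 * (a \<bullet> y) * (a \<bullet> x)"
proof -
  have "a \<bullet> a = 1" using assms by (simp add: norm_eq_1)
  then show ?thesis
    unfolding inner_reflection_in[OF assms] power2_norm_eq_inner
    by (simp add: inner_diff_left inner_diff_right inner_commute algebra_simps)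
qed

section \<open>Reflections and inversions\<close>

text \<open>The point \<open>b\<close> stands for the chamber \<open>B\<close>: it orients every
  mirror, and the position of \<open>w(B)\<close> is read off from the signs at
  \<open>\<rho> w b\<close>.\<close>

locale coxeter_reflections = group W for W :: "('w, 'm) monoid_scheme" (structure) +
  fixes S :: "'w set" and \<rho> :: "'w \<Rightarrow> 'a \<Rightarrow> 'a::euclidean_space" and B :: "'a set" and b :: 'a
  assumes fin: "finite (carrier W)"
    and S_sub: "S \<subseteq> carrier W"
    and gen: "generate W S = carrier W"
    and act: "reflection_group_action W S \<rho> B"
    and bB: "b \<in> B"
begin

definition T :: "'w set" where
  "T = {t \<in> carrier W. \<exists>a. a \<noteq> 0 \<and> \<rho> t = reflection_in a}"

definition unormal :: "'w \<Rightarrow> 'a" where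
  "unormal t = (SOME a. norm a = 1 \<and> 0 < a \<bullet> b \<and> \<rho> t = reflection_in a)"

definition hyp :: "'w \<Rightarrow> 'a set" where
  "hyp t = {x. unormal t \<bullet> x = 0}"

text \<open>The left inversions of \<open>w\<close>, seen as the mirrors separating \<open>B\<close>
  from \<open>w(B)\<close>.\<close>

definition Inv :: "'w \<Rightarrow> 'w set" where
  "Inv w = {t \<in> T. unormal t \<bullet> \<rho> w b < 0}"

definition cj :: "'w \<Rightarrow> 'w \<Rightarrow> 'w" where
  "cj g t = g \<otimes> t \<otimes> inv g"

section \<open>The action, unit normals and conjugation of reflections\<close>

lemma group_action: "group_action W UNIV \<rho>"
  using act unfolding reflection_group_action_def faithful_action_def by blast

lemma rho_mult: "\<lbrakk>g \<in> carrier W; h \<in> carrier W\<rbrakk> \<Longrightarrow> \<rho> (g \<otimes> h) x = \<rho> g (\<rho> h x)"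
  using group_action.composition_rule[OF group_action] by simp

lemma rho_one [simp]: "\<rho> \<one> x = x"
  using group_action.id_eq_one[OF group_action] by (metis UNIV_I restrict_apply')

lemma rho_inj: "\<lbrakk>\<rho> g = \<rho> h; g \<in> carrier W; h \<in> carrier W\<rbrakk> \<Longrightarrow> g = h"
  using act unfolding reflection_group_action_def faithful_action_def faithful_action_axioms_def
  by (metis inj_onD)

lemma rho_orth: "g \<in> carrier W \<Longrightarrow> orthogonal_transformation (\<rho> g)"
  using act unfolding reflection_group_action_def by blast

lemma rho_inner [simp]: "g \<in> carrier W \<Longrightarrow> \<rho> g x \<bullet> \<rho> g y = x \<bullet> y"
  using rho_orth unfolding orthogonal_transformation_def by blast

lemma rho_linear: "g \<in> carrier W \<Longrightarrow> linear (\<rho> g)"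
  using rho_orth orthogonal_transformation_def by blast

lemma rho_inv [simp]: "g \<in> carrier W \<Longrightarrow> \<rho> (inv g) (\<rho> g x) = x"
  by (metis inv_closed l_inv rho_mult rho_one)

lemma rho_inv' [simp]: "g \<in> carrier W \<Longrightarrow> \<rho> g (\<rho> (inv g) x) = x"
  by (metis inv_closed r_inv rho_mult rho_one)

lemma b_regular:
  assumes "t \<in> carrier W" "\<rho> t = reflection_in a" "a \<noteq> 0"
  shows "a \<bullet> b \<noteq> 0"
proof -
  have "{x. a \<bullet> x = 0} \<in> reflection_arrangement W \<rho>"
    using assms unfolding reflection_arrangement_def by blast
  moreover have "b \<in> - \<Union>(reflection_arrangement W \<rho>)"
    using act bB in_components_subset unfolding reflection_group_action_def regions_def by blast
  ultimately show ?thesis by blast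
qed

lemma T_carrier: "t \<in> T \<Longrightarrow> t \<in> carrier W"
  unfolding T_def by blast

lemma finite_T: "finite T"
  using fin unfolding T_def by simp

lemma unormal:
  assumes "t \<in> T"
  shows "norm (unormal t) = 1" "0 < unormal t \<bullet> b" "\<rho> t = reflection_in (unormal t)"
proof -
  obtain a where a: "a \<noteq> 0" "\<rho> t = reflection_in a" and t: "t \<in> carrier W"
    using assms unfolding T_def by blast
  let ?c = "sgn (a \<bullet> b) / norm a"
  have nz: "a \<bullet> b \<noteq> 0" using b_regular[OF t a(2,1)] .
  have "norm (?c *\<^sub>R a) = 1" using a(1) nz by (simp add: abs_sgn_eq)
  moreover have "0 < (?c *\<^sub>R a) \<bullet> b"
    using a(1) nz by (auto simp: sgn_if divide_neg_pos mult_neg_neg)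
  moreover have "\<rho> t = reflection_in (?c *\<^sub>R a)"
    using a nz reflection_in_scale[of ?c a] by (simp add: sgn_if)
  ultimately have "\<exists>a. norm a = 1 \<and> 0 < a \<bullet> b \<and> \<rho> t = reflection_in a" by blast
  from someI_ex[OF this] show "norm (unormal t) = 1" "0 < unormal t \<bullet> b" "\<rho> t = reflection_in (unormal t)"
    unfolding unormal_def by blast+
qed

lemma unormal_nonzero: "t \<in> T \<Longrightarrow> unormal t \<noteq> 0"
  using unormal(1) by fastforce

lemma unormal_inner_self: "t \<in> T \<Longrightarrow> unormal t \<bullet> unormal t = 1"
  using unormal(1) by (simp add: norm_eq_1)

lemma rho_T: "t \<in> T \<Longrightarrow> \<rho> t x = x - (2 * (unormal t \<bullet> x)) *\<^sub>R unormal t"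
  by (simp add: unormal inner_reflection_in)

lemma unormal_unique:
  assumes "t \<in> T" "norm a = 1" "\<rho> t = reflection_in a"
  shows "a = unormal t \<or> a = - unormal t"
  by (rule reflection_in_unit_eq) (use assms unormal in auto)

lemma unormal_inj: "\<lbrakk>unormal t = unormal t'; t \<in> T; t' \<in> T\<rbrakk> \<Longrightarrow> t = t'"
  by (rule rho_inj) (auto simp: unormal T_carrier)

lemma hyp_eq:
  assumes "t \<in> T" "a \<noteq> 0" "\<rho> t = reflection_in a"
  shows "hyp t = {x. a \<bullet> x = 0}"
proof -
  have "(1 / norm a) *\<^sub>R a = unormal t \<or> (1 / norm a) *\<^sub>R a = - unormal t"
    by (rule unormal_unique) (use assms reflection_in_scale[of "1 / norm a" a] in auto)
  then have "unormal t = (1 / norm a) *\<^sub>R a \<or> unormal t = - ((1 / norm a) *\<^sub>R a)" by auto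
  then show ?thesis unfolding hyp_def using assms(2) by auto
qed

lemma arrangement: "reflection_arrangement W \<rho> = hyp ` T"
proof
  show "hyp ` T \<subseteq> reflection_arrangement W \<rho>"
    unfolding reflection_arrangement_def using unormal(3) unormal_nonzero T_carrier hyp_def by blast
  show "reflection_arrangement W \<rho> \<subseteq> hyp ` T"
  proof
    fix H assume "H \<in> reflection_arrangement W \<rho>"
    then obtain a t where "H = {x. a \<bullet> x = 0}" "a \<noteq> 0" "t \<in> carrier W" "\<rho> t = reflection_in a"
      unfolding reflection_arrangement_def by blast
    moreover from this have "t \<in> T" unfolding T_def by blast
    ultimately show "H \<in> hyp ` T" using hyp_eq by blast
  qed
qed

lemma hyp_inj:
  assumes "hyp t = hyp t'" "t \<in> T" "t' \<in> T"
  shows "t = t'"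
proof -
  \<comment> \<open>The projection of one normal to the common mirror is orthogonal to the other
    normal as well. This forces equality in the Cauchy-Schwarz inequality, and positivity on
    \<open>b\<close> excludes opposite normals.\<close>
  have "unormal t' - (unormal t \<bullet> unormal t') *\<^sub>R unormal t \<in> hyp t"
    unfolding hyp_def using unormal_inner_self[OF assms(2)] by (simp add: inner_diff_right)
  then have "unormal t' - (unormal t \<bullet> unormal t') *\<^sub>R unormal t \<in> hyp t'" using assms by simp
  then have "(unormal t \<bullet> unormal t') * (unormal t \<bullet> unormal t') = 1"
    unfolding hyp_def using unormal_inner_self[OF assms(3)]
    by (simp add: inner_diff_right inner_commute)
  then have "\<bar>unormal t \<bullet> unormal t'\<bar> = norm (unormal t) * norm (unormal t')"
    using unormal(1) assms by (simp add: square_eq_1_iff abs_if) auto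
  then have "unormal t = unormal t' \<or> unormal t = - unormal t'"
    unfolding norm_cauchy_schwarz_abs_eq using unormal(1) assms by auto
  moreover have "unormal t \<noteq> - unormal t'" using unormal(2)[OF assms(2)] unormal(2)[OF assms(3)] by auto
  ultimately show ?thesis using unormal_inj assms by blast
qed

lemma inner_unormal_less_1:
  assumes "t \<in> T" "t' \<in> T" "t \<noteq> t'"
  shows "unormal t \<bullet> unormal t' < 1"
  using assms norm_cauchy_schwarz_eq[of "unormal t" "unormal t'"] norm_cauchy_schwarz[of "unormal t" "unormal t'"]
    unormal(1) unormal_inj by force

lemma refl_invol [simp]: "t \<in> T \<Longrightarrow> t \<otimes> t = \<one>"
proof (rule rho_inj)
  assume t: "t \<in> T"
  show "\<rho> (t \<otimes> t) = \<rho> \<one>"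
    using unormal_inner_self[OF t]
    by (auto simp: fun_eq_iff rho_mult T_carrier[OF t] rho_T[OF t] inner_diff_right)
qed (auto intro: T_carrier)

lemma refl_inv [simp]: "t \<in> T \<Longrightarrow> inv t = t"
  by (metis T_carrier inv_equality refl_invol)

lemma cj_carrier [simp]: "\<lbrakk>g \<in> carrier W; t \<in> carrier W\<rbrakk> \<Longrightarrow> cj g t \<in> carrier W"
  unfolding cj_def by simp

lemma cj_cj [simp]: "\<lbrakk>g \<in> carrier W; h \<in> carrier W; t \<in> carrier W\<rbrakk> \<Longrightarrow> cj g (cj h t) = cj (g \<otimes> h) t"
  unfolding cj_def by (simp add: m_assoc inv_mult_group)

lemma cj_one [simp]: "t \<in> carrier W \<Longrightarrow> cj \<one> t = t"
  unfolding cj_def by simp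

lemma cj_self [simp]: "t \<in> carrier W \<Longrightarrow> cj t t = t"
  unfolding cj_def by (simp add: m_assoc)

lemma cj_mult: "\<lbrakk>g \<in> carrier W; t \<in> carrier W\<rbrakk> \<Longrightarrow> cj g t \<otimes> g = g \<otimes> t"
  unfolding cj_def by (simp add: m_assoc)

lemma norm_rho_unormal: "\<lbrakk>g \<in> carrier W; t \<in> T\<rbrakk> \<Longrightarrow> norm (\<rho> g (unormal t)) = 1"
  using unormal_inner_self by (simp add: norm_eq_1)

lemma rho_cj:
  assumes "g \<in> carrier W" "t \<in> T"
  shows "\<rho> (cj g t) = reflection_in (\<rho> g (unormal t))"
proof
  fix x
  note n = norm_rho_unormal[OF assms]
  have "\<rho> (cj g t) x = \<rho> g (\<rho> t (\<rho> (inv g) x))"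
    unfolding cj_def using assms T_carrier by (simp add: rho_mult)
  also have "\<dots> = x - (2 * (unormal t \<bullet> \<rho> (inv g) x)) *\<^sub>R \<rho> g (unormal t)"
    using assms by (simp add: rho_T linear_diff[OF rho_linear] linear_scale[OF rho_linear])
  also have "unormal t \<bullet> \<rho> (inv g) x = \<rho> g (unormal t) \<bullet> x"
    using assms rho_inner[of g "unormal t" "\<rho> (inv g) x"] by simp
  finally show "\<rho> (cj g t) x = reflection_in (\<rho> g (unormal t)) x"
    by (simp add: inner_reflection_in[OF n])
qed

lemma cj_T [simp]:
  assumes "g \<in> carrier W" "t \<in> T"
  shows "cj g t \<in> T"
proof -
  have "\<rho> g (unormal t) \<noteq> 0" using norm_rho_unormal[OF assms] by auto
  moreover have "cj g t \<in> carrier W" using assms T_carrier by simp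
  ultimately show ?thesis using rho_cj[OF assms] unfolding T_def by blast
qed

lemma unormal_cj:
  assumes "g \<in> carrier W" "t \<in> T"
  shows "\<rho> g (unormal t) = unormal (cj g t) \<or> \<rho> g (unormal t) = - unormal (cj g t)"
  by (rule unormal_unique[OF cj_T[OF assms] norm_rho_unormal[OF assms] rho_cj[OF assms]])

text \<open>The transported normal may be the negative of the positive one. In a product of two
  values the sign drops out, so relative positions of two points are carried along by
  \<open>g\<close> without case distinctions.\<close>

lemma unormal_cj_same:
  assumes "g \<in> carrier W" "t \<in> T"
  shows "(unormal (cj g t) \<bullet> \<rho> g x) * (unormal (cj g t) \<bullet> \<rho> g y) = (unormal t \<bullet> x) * (unormal t \<bullet> y)"
proof -
  have *: "unormal t \<bullet> z = \<rho> g (unormal t) \<bullet> \<rho> g z" for z using rho_inner[OF assms(1)] by simp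
  show ?thesis
    using unormal_cj[OF assms] unfolding *
    by (elim disjE) (simp_all only: inner_minus_left minus_mult_minus)
qed

lemma unormal_cj_zero:
  assumes "g \<in> carrier W" "t \<in> T"
  shows "unormal (cj g t) \<bullet> \<rho> g x = 0 \<longleftrightarrow> unormal t \<bullet> x = 0"
  using unormal_cj_same[OF assms, of x x] mult_eq_0_iff by metis

lemma regular:
  assumes "g \<in> carrier W" "t \<in> T"
  shows "unormal t \<bullet> \<rho> g b \<noteq> 0"
proof -
  have "cj (inv g) t \<in> T" using assms by simp
  from unormal(2)[OF this] show ?thesis
    using unormal_cj_zero[of g "cj (inv g) t" b] assms by (simp add: T_carrier)
qed

lemma Inv_sub_T: "Inv g \<subseteq> T"
  unfolding Inv_def by blast

lemma finite_Inv [simp]: "finite (Inv g)"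
  using finite_subset[OF Inv_sub_T finite_T] .

lemma Inv_one [simp]: "Inv \<one> = {}"
  using unormal(2) unfolding Inv_def by force

text \<open>On the way from \<open>b\<close> over \<open>\<rho> g b\<close> to
  \<open>\<rho> (g \<otimes> h) b\<close> the mirror of \<open>t\<close> separates the ends iff it
  separates exactly one of the two consecutive pairs; moving the second pair back by
  \<open>inv g\<close> conjugates the mirror.\<close>

lemma Inv_mult:
  assumes g: "g \<in> carrier W" and h: "h \<in> carrier W" and t: "t \<in> T"
  shows "t \<in> Inv (g \<otimes> h) \<longleftrightarrow> (t \<in> Inv g) \<noteq> (cj (inv g) t \<in> Inv h)"
proof -
  let ?t = "cj (inv g) t"
  have t': "?t \<in> T" using g t by simp
  have "(unormal t \<bullet> \<rho> g (\<rho> h b)) * (unormal t \<bullet> \<rho> g b) = (unormal ?t \<bullet> \<rho> h b) * (unormal ?t \<bullet> b)"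
    using unormal_cj_same[OF g t', of "\<rho> h b" b] g t by (simp add: T_carrier)
  moreover have "0 < unormal ?t \<bullet> b" by (rule unormal(2)[OF t'])
  moreover have "unormal t \<bullet> \<rho> (g \<otimes> h) b \<noteq> 0" "unormal t \<bullet> \<rho> g b \<noteq> 0" "unormal ?t \<bullet> \<rho> h b \<noteq> 0"
    using regular g h t t' by auto
  ultimately have "unormal t \<bullet> \<rho> (g \<otimes> h) b < 0 \<longleftrightarrow> (unormal t \<bullet> \<rho> g b < 0) \<noteq> (unormal ?t \<bullet> \<rho> h b < 0)"
    unfolding rho_mult[OF g h]
    by (metis linorder_neqE_linordered_idom mult_neg_neg mult_neg_pos mult_pos_neg mult_pos_pos
        not_less_iff_gr_or_eq)
  then show ?thesis unfolding Inv_def using t t' by blast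
qed

section \<open>Chambers, walls and basic hyperplanes\<close>

lemma cell_alt:
  assumes "A \<subseteq> T"
  shows "{x. \<forall>t\<in>A. 0 < unormal t \<bullet> x} = {x \<in> UNIV. \<forall>a\<in>unormal ` A. 0 < (a \<bullet> x) * (a \<bullet> b)}"
    "{x. \<forall>t\<in>A. 0 \<le> unormal t \<bullet> x} = {x \<in> UNIV. \<forall>a\<in>unormal ` A. 0 \<le> (a \<bullet> x) * (a \<bullet> b)}"
proof -
  have "0 < (unormal t \<bullet> x) * (unormal t \<bullet> b) \<longleftrightarrow> 0 < unormal t \<bullet> x"
    "0 \<le> (unormal t \<bullet> x) * (unormal t \<bullet> b) \<longleftrightarrow> 0 \<le> unormal t \<bullet> x" if "t \<in> A" for t x
    using unormal(2)[of t] assms that by (auto simp: zero_less_mult_iff zero_le_mult_iff)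
  then show "{x. \<forall>t\<in>A. 0 < unormal t \<bullet> x} = {x \<in> UNIV. \<forall>a\<in>unormal ` A. 0 < (a \<bullet> x) * (a \<bullet> b)}"
    "{x. \<forall>t\<in>A. 0 \<le> unormal t \<bullet> x} = {x \<in> UNIV. \<forall>a\<in>unormal ` A. 0 \<le> (a \<bullet> x) * (a \<bullet> b)}"
    by simp_all
qed

lemma region_cell:
  assumes "A \<subseteq> T"
  shows "{x. \<forall>t\<in>A. 0 < unormal t \<bullet> x} \<in> regions (hyp ` A)"
    "\<lbrakk>C \<in> regions (hyp ` A); b \<in> C\<rbrakk> \<Longrightarrow> C = {x. \<forall>t\<in>A. 0 < unormal t \<bullet> x}"
    "closure {x. \<forall>t\<in>A. 0 < unormal t \<bullet> x} = {x. \<forall>t\<in>A. 0 \<le> unormal t \<bullet> x}"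
proof -
  have r: "regions (hyp ` A) = components (UNIV - (\<Union>a\<in>unormal ` A. {x. a \<bullet> x = 0}))"
    unfolding regions_def hyp_def by (simp add: Compl_eq_Diff_UNIV image_image)
  have nz: "a \<bullet> b \<noteq> 0" if "a \<in> unormal ` A" for a using that unormal(2) assms by force
  show "{x. \<forall>t\<in>A. 0 < unormal t \<bullet> x} \<in> regions (hyp ` A)"
    unfolding r cell_alt[OF assms] by (rule sign_cell_in_components) (use nz in auto)
  show "C = {x. \<forall>t\<in>A. 0 < unormal t \<bullet> x}" if "C \<in> regions (hyp ` A)" "b \<in> C"
    unfolding cell_alt[OF assms] by (rule component_sign_cell) (use that r in auto)
  show "closure {x. \<forall>t\<in>A. 0 < unormal t \<bullet> x} = {x. \<forall>t\<in>A. 0 \<le> unormal t \<bullet> x}"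
    unfolding cell_alt[OF assms] by (rule closure_sign_cell) (use nz in auto)
qed

lemma B_eq: "B = {x. \<forall>t\<in>T. 0 < unormal t \<bullet> x}"
  using act bB region_cell(2)[of T B] unfolding reflection_group_action_def arrangement by blast

lemma aff_dim_hyp: "t \<in> T \<Longrightarrow> aff_dim (hyp t) = int DIM('a) - 1"
  unfolding hyp_def using aff_dim_hyperplane[OF unormal_nonzero] by simp

text \<open>Turns the dimension condition into a witness. A point strictly inside all other
  half-spaces has a full neighbourhood in the mirror that belongs to the frontier; conversely a
  facet of full dimension is not contained in any other mirror.\<close>

lemma wall_iff:
  assumes A: "A \<subseteq> T" and t: "t \<in> A"
  shows "is_wall (hyp t) {x. \<forall>t\<in>A. 0 < unormal t \<bullet> x} \<longleftrightarrow>
    (\<exists>p. unormal t \<bullet> p = 0 \<and> (\<forall>t'\<in>A - {t}. 0 < unormal t' \<bullet> p))" (is "is_wall _ ?C \<longleftrightarrow> ?R")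
proof
  have tT: "t \<in> T" using A t by blast
  have finA: "finite A" using A finite_T finite_subset by blast
  {
    assume ?R
    then obtain p where p: "unormal t \<bullet> p = 0" "\<forall>t'\<in>A - {t}. 0 < unormal t' \<bullet> p" by blast
    let ?U = "\<Inter>t'\<in>A - {t}. {x. 0 < unormal t' \<bullet> x}"
    have "open ?U" using finA by (intro open_INT ballI open_halfspace_gt) auto
    moreover have "p \<in> hyp t \<inter> ?U" using p by (auto simp: hyp_def)
    moreover have "convex (hyp t)" unfolding hyp_def by (rule convex_hyperplane)
    ultimately have dimU: "aff_dim (hyp t \<inter> ?U) = int DIM('a) - 1"
      using aff_dim_convex_Int_open[of "hyp t" ?U] aff_dim_hyp[OF tT] by auto
    have subU: "hyp t \<inter> ?U \<subseteq> hyp t \<inter> frontier ?C"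
    proof -
      have "x \<in> frontier ?C" if "x \<in> hyp t \<inter> ?U" for x
      proof -
        have "0 \<le> unormal t' \<bullet> x" if "t' \<in> A" for t'
          using \<open>x \<in> hyp t \<inter> ?U\<close> that by (cases "t' = t") (auto simp: hyp_def less_imp_le)
        then have "x \<in> closure ?C" unfolding region_cell(3)[OF A] by blast
        moreover have "x \<notin> interior ?C"
          using that t interior_subset[of ?C] by (force simp: hyp_def)
        ultimately show ?thesis unfolding frontier_def by blast
      qed
      then show ?thesis by blast
    qed
    have "int DIM('a) - 1 \<le> aff_dim (hyp t \<inter> frontier ?C)"
      using aff_dim_subset[OF subU] unfolding dimU .
    moreover have "aff_dim (hyp t \<inter> frontier ?C) \<le> int DIM('a) - 1"
      using aff_dim_subset[of "hyp t \<inter> frontier ?C" "hyp t"] aff_dim_hyp[OF tT] by simp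
    ultimately show "is_wall (hyp t) ?C" unfolding is_wall_def by simp
  }
  assume w: "is_wall (hyp t) ?C"
  have F: "\<forall>t'\<in>A. 0 \<le> unormal t' \<bullet> x" if "x \<in> hyp t \<inter> frontier ?C" for x
    using that region_cell(3)[OF A] unfolding frontier_def by blast
  have "\<exists>x \<in> hyp t \<inter> frontier ?C. 0 < unormal t' \<bullet> x" if t': "t' \<in> A - {t}" for t'
  proof (rule ccontr)
    assume n: "\<not> ?thesis"
    have "hyp t \<inter> frontier ?C \<subseteq> hyp t \<inter> hyp t'"
      using n F t' by (force simp: hyp_def)
    then have "aff_dim (hyp t \<inter> frontier ?C) \<le> aff_dim (hyp t \<inter> hyp t')" by (rule aff_dim_subset)
    also have "\<dots> < aff_dim (hyp t)"
    proof (rule aff_dim_psubset)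
      have h: "affine (hyp u)" for u unfolding hyp_def by (rule affine_hyperplane)
      have "hyp t \<noteq> hyp t \<inter> hyp t'"
      proof
        assume "hyp t = hyp t \<inter> hyp t'"
        then have sub: "hyp t \<subseteq> hyp t'" by blast
        have "hyp t = hyp t'"
        proof (rule ccontr)
          assume "hyp t \<noteq> hyp t'"
          then have "aff_dim (hyp t) < aff_dim (hyp t')"
            using sub h by (intro aff_dim_psubset) (auto simp: affine_hull_eq[THEN iffD2])
          then show False using aff_dim_hyp t' A tT by auto
        qed
        then show False using hyp_inj t' A tT by blast
      qed
      moreover have "affine (hyp t \<inter> hyp t')" by (intro affine_Int h)
      ultimately show "affine hull (hyp t \<inter> hyp t') \<subset> affine hull (hyp t)"
        using h by (auto simp: affine_hull_eq[THEN iffD2])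
    qed
    finally show False using w aff_dim_hyp[OF tT] unfolding is_wall_def by simp
  qed
  then have "\<forall>t'\<in>A - {t}. \<exists>x. x \<in> hyp t \<inter> frontier ?C \<and> 0 < unormal t' \<bullet> x" by blast
  from bchoice[OF this] obtain f
    where f: "\<And>t'. t' \<in> A - {t} \<Longrightarrow> f t' \<in> hyp t \<inter> frontier ?C \<and> 0 < unormal t' \<bullet> f t'" by blast
  \<comment> \<open>Each \<open>f t'\<close> is strictly positive on one mirror and nonnegative on
    the others, so their sum is strictly positive on all mirrors other than
    \<open>t\<close>.\<close>
  have "unormal t \<bullet> (\<Sum>t'\<in>A - {t}. f t') = 0"
    unfolding inner_sum_right by (rule sum.neutral) (use f in \<open>auto simp: hyp_def\<close>)
  moreover have "0 < unormal u \<bullet> (\<Sum>t'\<in>A - {t}. f t')" if u: "u \<in> A - {t}" for u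
    unfolding inner_sum_right
    by (rule sum_pos2[of _ u]) (use u f F finA in auto)
  ultimately show ?R by blast
qed

lemma basic_iff:
  assumes A: "A \<subseteq> T" and t: "t \<in> T"
  shows "basic (hyp ` A) B (hyp t) \<longleftrightarrow>
    t \<in> A \<and> (\<exists>p. unormal t \<bullet> p = 0 \<and> (\<forall>t'\<in>A - {t}. 0 < unormal t' \<bullet> p))"
proof -
  have mem: "hyp t \<in> hyp ` A \<longleftrightarrow> t \<in> A" using hyp_inj A t by blast
  let ?C = "{x. \<forall>t\<in>A. 0 < unormal t \<bullet> x}"
  have "(\<exists>C\<in>regions (hyp ` A). B \<subseteq> C \<and> is_wall (hyp t) C) \<longleftrightarrow> is_wall (hyp t) ?C"
  proof
    assume "\<exists>C\<in>regions (hyp ` A). B \<subseteq> C \<and> is_wall (hyp t) C"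
    then obtain C where C: "C \<in> regions (hyp ` A)" "B \<subseteq> C" "is_wall (hyp t) C" by blast
    then have "b \<in> C" using bB by blast
    then show "is_wall (hyp t) ?C" using region_cell(2)[OF A C(1)] C(3) by simp
  next
    assume "is_wall (hyp t) ?C"
    moreover have "B \<subseteq> ?C" unfolding B_eq using A by blast
    ultimately show "\<exists>C\<in>regions (hyp ` A). B \<subseteq> C \<and> is_wall (hyp t) C"
      using region_cell(1)[OF A] by (intro bexI[of _ ?C] conjI)
  qed
  then have "basic (hyp ` A) B (hyp t) \<longleftrightarrow> t \<in> A \<and> is_wall (hyp t) ?C"
    unfolding basic_def mem by simp
  then show ?thesis using wall_iff[OF A, of t] by (simp cong: conj_cong)
qed

text \<open>The reflection in a wall permutes the other positive normals: it fixes the wall point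
  \<open>p\<close>, so the signs at \<open>p\<close> and at \<open>\<rho> t b\<close> agree. Stated
  for any stable \<open>A\<close>, because it serves both the simple reflections and rank-two
  subarrangements.\<close>

lemma wall_not_separated:
  assumes A: "A \<subseteq> T" and t: "t \<in> A" and stable: "\<And>u. u \<in> A \<Longrightarrow> cj t u \<in> A"
    and p: "unormal t \<bullet> p = 0" "\<forall>u\<in>A - {t}. 0 < unormal u \<bullet> p"
    and t': "t' \<in> A - {t}"
  shows "0 < unormal t' \<bullet> \<rho> t b"
proof -
  have T: "t \<in> T" "t' \<in> T" and c: "t \<in> carrier W" "t' \<in> carrier W" using A t t' T_carrier by auto
  let ?u = "cj t t'"
  have u: "?u \<in> A" using stable t' by blast
  have cj_u: "cj t ?u = t'" using T c by simp
  have "?u \<noteq> t"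
  proof
    assume "?u = t"
    then have "cj t t = t'" using cj_u by simp
    then show False using t' c by simp
  qed
  then have "0 < unormal ?u \<bullet> p" using p u by blast
  moreover have "0 < unormal ?u \<bullet> b" using unormal(2) u A by blast
  moreover have "(unormal t' \<bullet> \<rho> t b) * (unormal t' \<bullet> \<rho> t p) = (unormal ?u \<bullet> b) * (unormal ?u \<bullet> p)"
    using unormal_cj_same[OF c(1), of ?u b p] u A unfolding cj_u by blast
  moreover have "\<rho> t p = p" using p T by (simp add: rho_T)
  moreover have "0 < unormal t' \<bullet> p" using p t' by blast
  ultimately have "0 < (unormal t' \<bullet> \<rho> t b) * (unormal t' \<bullet> p)" "0 < unormal t' \<bullet> p" by simp_all
  then show ?thesis by (rule zero_less_mult_pos2)
qed

lemma S_wall: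
  assumes "s \<in> S"
  shows "s \<in> T" "\<exists>p. unormal s \<bullet> p = 0 \<and> (\<forall>t\<in>T - {s}. 0 < unormal t \<bullet> p)"
proof -
  obtain a where a: "a \<noteq> 0" "\<rho> s = reflection_in a" "is_wall {x. a \<bullet> x = 0} B"
    using act assms unfolding reflection_group_action_def by blast
  show s: "s \<in> T" using a assms S_sub unfolding T_def by blast
  show "\<exists>p. unormal s \<bullet> p = 0 \<and> (\<forall>t\<in>T - {s}. 0 < unormal t \<bullet> p)"
    using wall_iff[of T s] a s B_eq hyp_eq[OF s a(1,2)] by simp
qed

lemma inner_rho_self: "t \<in> T \<Longrightarrow> unormal t \<bullet> \<rho> t x = - (unormal t \<bullet> x)"
  using unormal_inner_self by (simp add: rho_T inner_diff_right)

lemma Inv_simple: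
  assumes s: "s \<in> S"
  shows "Inv s = {s}"
proof -
  note sT = S_wall(1)[OF s]
  obtain p where p: "unormal s \<bullet> p = 0" "\<forall>t\<in>T - {s}. 0 < unormal t \<bullet> p" using S_wall(2)[OF s] by blast
  have "0 < unormal t \<bullet> \<rho> s b" if "t \<in> T - {s}" for t
    by (rule wall_not_separated[of T s p]) (use that sT p T_carrier in auto)
  moreover have "unormal s \<bullet> \<rho> s b < 0" using inner_rho_self[OF sT] unormal(2)[OF sT] by simp
  ultimately show ?thesis unfolding Inv_def using sT by force
qed

end

section \<open>Length, weak order and parabolic subgroups\<close>

lemma word_prod_Nil [simp]: "word_prod G [] = \<one>\<^bsub>G\<^esub>"
  by (simp add: word_prod_def)

lemma word_prod_Cons [simp]: "word_prod G (x # xs) = x \<otimes>\<^bsub>G\<^esub> word_prod G xs"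
  by (simp add: word_prod_def)

lemma (in monoid) word_prod_closed: "xs \<in> lists (carrier G) \<Longrightarrow> word_prod G xs \<in> carrier G"
  by (induction xs) auto

lemma (in monoid) word_prod_append:
  "\<lbrakk>xs \<in> lists (carrier G); ys \<in> lists (carrier G)\<rbrakk>
    \<Longrightarrow> word_prod G (xs @ ys) = word_prod G xs \<otimes> word_prod G ys"
  by (induction xs) (auto simp: word_prod_closed m_assoc)

context coxeter_reflections
begin

lemma refl_cancel [simp]: "\<lbrakk>t \<in> T; x \<in> carrier W\<rbrakk> \<Longrightarrow> t \<otimes> (t \<otimes> x) = x"
  by (simp add: T_carrier flip: m_assoc)

lemma S_carrier: "s \<in> S \<Longrightarrow> s \<in> carrier W"
  using S_sub by blast

lemma lists_S_carrier: "\<lbrakk>ss \<in> lists J; J \<subseteq> S\<rbrakk> \<Longrightarrow> ss \<in> lists (carrier W)"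
  using S_sub lists_mono by blast

lemma word_closed [simp]: "\<lbrakk>ss \<in> lists J; J \<subseteq> S\<rbrakk> \<Longrightarrow> word_prod W ss \<in> carrier W"
  by (rule word_prod_closed[OF lists_S_carrier])

lemma gen_closed: "\<lbrakk>J \<subseteq> S; g \<in> generate W J\<rbrakk> \<Longrightarrow> g \<in> carrier W"
  using generate_in_carrier[of J g] S_sub by blast

lemma gen_subgroup: "J \<subseteq> S \<Longrightarrow> subgroup (generate W J) W"
  by (rule generate_is_subgroup) (use S_sub in blast)

lemma gen_mult: "\<lbrakk>J \<subseteq> S; g \<in> generate W J; h \<in> generate W J\<rbrakk> \<Longrightarrow> g \<otimes> h \<in> generate W J"
  by (rule generate.eng)

lemma gen_inv: "\<lbrakk>J \<subseteq> S; g \<in> generate W J\<rbrakk> \<Longrightarrow> inv g \<in> generate W J"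
  by (rule subgroup.m_inv_closed[OF gen_subgroup])

lemma gen_cj: "\<lbrakk>J \<subseteq> S; g \<in> generate W J; h \<in> generate W J\<rbrakk> \<Longrightarrow> cj g h \<in> generate W J"
  unfolding cj_def by (intro gen_mult gen_inv)

lemma word_in_gen: "\<lbrakk>ss \<in> lists J; J \<subseteq> S\<rbrakk> \<Longrightarrow> word_prod W ss \<in> generate W J"
  by (induction ss) (auto intro: generate.intros)

lemma gen_word:
  assumes J: "J \<subseteq> S" and g: "g \<in> generate W J"
  shows "\<exists>ss\<in>lists J. word_prod W ss = g"
  using g
proof induction
  case one
  then show ?case by (intro bexI[of _ "[]"]) auto
next
  case (incl s)
  then show ?case using J S_carrier by (intro bexI[of _ "[s]"]) auto
next
  case (inv s)
  then have "inv s = s" using J S_wall(1) by (intro refl_inv) blast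
  then show ?case using inv J S_carrier by (intro bexI[of _ "[s]"]) auto
next
  case (eng g h)
  then obtain ss tt where "ss \<in> lists J" "tt \<in> lists J" "word_prod W ss = g" "word_prod W tt = h"
    by blast
  then show ?case
    using word_prod_append[of ss tt] lists_S_carrier[OF _ J] by (intro bexI[of _ "ss @ tt"]) auto
qed

lemma cj_inv_iff: "\<lbrakk>g \<in> carrier W; t \<in> carrier W; u \<in> carrier W\<rbrakk> \<Longrightarrow> cj (inv g) t = u \<longleftrightarrow> t = cj g u"
  by auto

section \<open>Exchange condition and length as number of inversions\<close>

lemma Inv_mult_simple:
  assumes g: "g \<in> carrier W" and s: "s \<in> S"
  shows "cj g s \<in> Inv g \<Longrightarrow> Inv (g \<otimes> s) = Inv g - {cj g s}"
    "cj g s \<notin> Inv g \<Longrightarrow> Inv (g \<otimes> s) = insert (cj g s) (Inv g)"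
proof -
  have sT: "s \<in> T" and sc: "s \<in> carrier W" using S_wall s S_carrier by blast+
  have "t \<in> Inv (g \<otimes> s) \<longleftrightarrow> (t \<in> Inv g) \<noteq> (t = cj g s)" if "t \<in> T" for t
    using Inv_mult[OF g sc that] cj_inv_iff[OF g T_carrier[OF that] sc] Inv_simple[OF s] by simp
  moreover have "cj g s \<in> T" using g sT by simp
  ultimately show "cj g s \<in> Inv g \<Longrightarrow> Inv (g \<otimes> s) = Inv g - {cj g s}"
    "cj g s \<notin> Inv g \<Longrightarrow> Inv (g \<otimes> s) = insert (cj g s) (Inv g)"
    using Inv_sub_T by blast+
qed

text \<open>Strong exchange along a gallery: the mirror of \<open>t\<close> is either the first one
  crossed, and that letter is deleted, or conjugation by the first letter makes it an inversion of
  the tail. Recording that no new letters appear makes the result usable inside parabolic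
  subgroups.\<close>

lemma exchange:
  assumes "ss \<in> lists S" "t \<in> Inv (word_prod W ss)"
  shows "\<exists>ss'\<in>lists (set ss). length ss = Suc (length ss') \<and> t \<otimes> word_prod W ss = word_prod W ss'"
  using assms
proof (induction ss arbitrary: t rule: list.induct)
  case Nil
  then show ?case by simp
next
  case (Cons s r)
  have sS: "s \<in> S" and r: "r \<in> lists S" using Cons.prems(1) by auto
  let ?w = "word_prod W r"
  have w: "?w \<in> carrier W" and sc: "s \<in> carrier W" using r sS S_carrier by auto
  have tT: "t \<in> T" using Cons.prems Inv_sub_T by blast
  have tc: "t \<in> carrier W" and sT: "s \<in> T" using tT T_carrier S_wall(1) sS by auto
  show ?case
  proof (cases "t = s")
    case True
    have "s \<otimes> (s \<otimes> ?w) = ?w" using w sT by simp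
    then show ?thesis using True by (intro bexI[of _ r]) auto
  next
    case False
    then have "cj s t \<in> Inv ?w"
      using Cons.prems(2) Inv_mult[OF sc w tT] Inv_simple[OF sS] sT by simp
    from Cons.IH[OF r this] obtain r' where r': "r' \<in> lists (set r)" "length r = Suc (length r')"
      "cj s t \<otimes> ?w = word_prod W r'" by blast
    have "s \<otimes> (cj s t \<otimes> ?w) = (s \<otimes> s) \<otimes> t \<otimes> s \<otimes> ?w"
      unfolding cj_def using sT sc tc w by (simp add: m_assoc)
    also have "\<dots> = t \<otimes> (s \<otimes> ?w)" using sT sc tc w by (simp add: m_assoc)
    finally have "t \<otimes> (s \<otimes> ?w) = s \<otimes> word_prod W r'" using r'(3) by simp
    moreover have "s # r' \<in> lists (set (s # r))" using r'(1) by auto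
    ultimately show ?thesis using r'(2) by (intro bexI[of _ "s # r'"]) auto
  qed
qed

text \<open>The last letter of a shortest word over \<open>J\<close> is a descent, as otherwise
  exchange would produce a shorter word over \<open>J\<close> for the same element.\<close>

lemma descent_exists:
  assumes J: "J \<subseteq> S" and g: "g \<in> generate W J" "g \<noteq> \<one>"
  shows "\<exists>s\<in>J. cj g s \<in> Inv g"
proof -
  let ?P = "\<lambda>ss. ss \<in> lists J \<and> word_prod W ss = g"
  obtain ss where ss: "?P ss" and least: "\<And>tt. ?P tt \<Longrightarrow> length ss \<le> length tt"
    using ex_has_least_nat[of ?P _ length] gen_word[OF J g(1)] by blast
  have "ss \<noteq> []" using ss g(2) by auto
  then obtain r s where ss_eq: "ss = r @ [s]" by (metis rev_exhaust)
  have r: "r \<in> lists J" and s: "s \<in> J" using ss ss_eq by auto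
  let ?w = "word_prod W r"
  have w: "?w \<in> carrier W" using r J by simp
  have sc: "s \<in> carrier W" and sT: "s \<in> T" using s J S_carrier S_wall(1) by auto
  have g_eq: "g = ?w \<otimes> s"
    using ss ss_eq word_prod_append[of r "[s]"] lists_S_carrier[OF r J] sc by simp
  have c: "cj g s = cj ?w s"
  proof -
    have "cj (?w \<otimes> s) s = cj ?w (cj s s)" by (simp only: cj_cj[OF w sc sc])
    then show ?thesis by (simp only: g_eq cj_self[OF sc])
  qed
  have "cj g s \<in> Inv g"
  proof (rule ccontr)
    assume n: "cj g s \<notin> Inv g"
    have "cj ?w s \<in> Inv ?w"
    proof (rule ccontr)
      assume "cj ?w s \<notin> Inv ?w"
      from Inv_mult_simple(2)[OF w _ this] have "Inv g = insert (cj g s) (Inv ?w)"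
        using s J unfolding c unfolding g_eq by blast
      then show False using n by blast
    qed
    moreover have "r \<in> lists S" using r J lists_mono by blast
    ultimately obtain r' where r': "r' \<in> lists (set r)" "length r = Suc (length r')"
      "cj ?w s \<otimes> ?w = word_prod W r'" using exchange by blast
    have "word_prod W r' = g" using r'(3) cj_mult[OF w sc] g_eq by simp
    moreover have "r' \<in> lists J" using r'(1) r by (auto simp: in_lists_conv_set)
    ultimately show False using least[of r'] r'(2) ss_eq by simp
  qed
  then show ?thesis using s by blast
qed

lemma card_Inv_word: "ss \<in> lists S \<Longrightarrow> card (Inv (word_prod W ss)) \<le> length ss"
proof (induction ss rule: rev_induct)
  case Nil
  then show ?case by simp
next
  case (snoc s r)
  then have r: "r \<in> lists S" and s: "s \<in> S" by auto
  have eq: "word_prod W (r @ [s]) = word_prod W r \<otimes> s"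
    using word_prod_append[of r "[s]"] lists_S_carrier[OF r] s S_carrier by simp
  have w: "word_prod W r \<in> carrier W" using r by simp
  have "Inv (word_prod W r \<otimes> s) \<subseteq> insert (cj (word_prod W r) s) (Inv (word_prod W r))"
    using Inv_mult_simple[OF w s] by blast
  then have "card (Inv (word_prod W r \<otimes> s))
      \<le> card (insert (cj (word_prod W r) s) (Inv (word_prod W r)))"
    using card_mono[OF finite.insertI[OF finite_Inv]] by blast
  also have "\<dots> \<le> Suc (card (Inv (word_prod W r)))" by (simp add: card_insert_if)
  finally show ?case using snoc.IH[OF r] unfolding eq by simp
qed

text \<open>A descent removes exactly one inversion. Since descents are found inside
  \<open>J\<close>, length within the parabolic subgroup agrees with length in the whole
  group.\<close>

lemma reduced_word_exists:
  assumes J: "J \<subseteq> S" and g: "g \<in> generate W J"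
  shows "\<exists>ss\<in>lists J. word_prod W ss = g \<and> length ss = card (Inv g)"
  using g
proof (induction "card (Inv g)" arbitrary: g rule: less_induct)
  case less
  show ?case
  proof (cases "g = \<one>")
    case True
    then show ?thesis by (intro bexI[of _ "[]"]) auto
  next
    case False
    then obtain s where s: "s \<in> J" "cj g s \<in> Inv g" using descent_exists[OF J less.prems] by blast
    have gc: "g \<in> carrier W" and sS: "s \<in> S" and sc: "s \<in> carrier W" and sT: "s \<in> T"
      using gen_closed[OF J less.prems] s J S_carrier S_wall by auto
    have I: "Inv (g \<otimes> s) = Inv g - {cj g s}" by (rule Inv_mult_simple(1)[OF gc sS s(2)])
    then have c: "Suc (card (Inv (g \<otimes> s))) = card (Inv g)"
      using s(2) card_Suc_Diff1[OF finite_Inv] by metis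
    have "g \<otimes> s \<in> generate W J" using less.prems s by (intro generate.eng) (auto intro: generate.incl)
    then obtain ss where ss: "ss \<in> lists J" "word_prod W ss = g \<otimes> s" "length ss = card (Inv (g \<otimes> s))"
      using less.hyps[of "g \<otimes> s"] c by auto
    have "word_prod W (ss @ [s]) = g \<otimes> s \<otimes> s"
      using word_prod_append[of ss "[s]"] lists_S_carrier[OF ss(1) J] ss sc by simp
    also have "\<dots> = g" using gc sc sT by (simp add: m_assoc)
    finally show ?thesis using ss s c by (intro bexI[of _ "ss @ [s]"]) auto
  qed
qed

lemma len_eq: "g \<in> carrier W \<Longrightarrow> len W S g = card (Inv g)"
  unfolding len_def
  by (rule Least_equality) (use reduced_word_exists[of S g] gen card_Inv_word in auto)

lemma Inv_empty: "\<lbrakk>g \<in> carrier W; Inv g = {}\<rbrakk> \<Longrightarrow> g = \<one>"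
  using descent_exists[of S g] gen by auto

lemma Inv_inv_iff:
  assumes "g \<in> carrier W" "t \<in> T"
  shows "t \<in> Inv (inv g) \<longleftrightarrow> cj g t \<in> Inv g"
  using Inv_mult[of "inv g" g t] assms by simp

lemma Inv_inv: "g \<in> carrier W \<Longrightarrow> Inv (inv g) = cj (inv g) ` Inv g"
proof (intro Set.set_eqI iffI)
  fix t assume g: "g \<in> carrier W" and t: "t \<in> Inv (inv g)"
  then have "t \<in> T" using Inv_sub_T by blast
  then have "cj g t \<in> Inv g" "t = cj (inv g) (cj g t)" using Inv_inv_iff g t T_carrier by auto
  then show "t \<in> cj (inv g) ` Inv g" by (rule rev_image_eqI)
next
  fix t assume g: "g \<in> carrier W" and "t \<in> cj (inv g) ` Inv g"
  then obtain u where u: "u \<in> Inv g" "t = cj (inv g) u" by blast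
  then have "u \<in> T" using Inv_sub_T by blast
  then show "t \<in> Inv (inv g)" using Inv_inv_iff[OF g, of t] u g T_carrier by simp
qed

lemma inj_cj: "g \<in> carrier W \<Longrightarrow> inj_on (cj g) T"
  by (rule inj_on_inverseI[of _ "cj (inv g)"]) (simp add: T_carrier)

lemma card_Inv_inv: "g \<in> carrier W \<Longrightarrow> card (Inv (inv g)) = card (Inv g)"
  using card_image[OF inj_on_subset[OF inj_cj Inv_sub_T], of "inv g" g] by (simp add: Inv_inv)

lemma Inv_inj:
  assumes "Inv g = Inv h" "g \<in> carrier W" "h \<in> carrier W"
  shows "g = h"
proof -
  have "Inv (inv g \<otimes> h) = Inv (inv g \<otimes> g)"
  proof (intro Set.set_eqI)
    fix t
    have "t \<in> Inv (inv g \<otimes> h) \<longleftrightarrow> t \<in> Inv (inv g \<otimes> g)" if "t \<in> T"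
      using Inv_mult[of "inv g" h t] Inv_mult[of "inv g" g t] assms that by simp
    then show "t \<in> Inv (inv g \<otimes> h) \<longleftrightarrow> t \<in> Inv (inv g \<otimes> g)" using Inv_sub_T by blast
  qed
  then have "inv g \<otimes> h = \<one>" using assms by (intro Inv_empty) auto
  then have "inv (inv g) = h" using assms by (intro inv_equality) (auto simp: inv_comm)
  then show ?thesis using assms by simp
qed

text \<open>By the cocycle rule \<open>Inv (g \<otimes> h)\<close> is the symmetric difference of
  \<open>Inv g\<close> and a conjugate of \<open>Inv h\<close>. Cardinalities add iff these two are
  disjoint, that is, iff nothing of \<open>Inv g\<close> is lost.\<close>

lemma len_add_iff:
  assumes g: "g \<in> carrier W" and h: "h \<in> carrier W"
  shows "card (Inv (g \<otimes> h)) = card (Inv g) + card (Inv h) \<longleftrightarrow> Inv g \<subseteq> Inv (g \<otimes> h)"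
proof -
  let ?C = "cj g ` Inv h"
  have C: "card ?C = card (Inv h)" by (rule card_image) (rule inj_on_subset[OF inj_cj[OF g] Inv_sub_T])
  have "t \<in> Inv (g \<otimes> h) \<longleftrightarrow> (t \<in> Inv g) \<noteq> (t \<in> ?C)" if "t \<in> T" for t
  proof -
    have "cj (inv g) t \<in> Inv h \<longleftrightarrow> t \<in> ?C"
    proof
      assume "cj (inv g) t \<in> Inv h"
      moreover have "t = cj g (cj (inv g) t)" using g that T_carrier by simp
      ultimately show "t \<in> ?C" by blast
    next
      assume "t \<in> ?C"
      then obtain u where u: "u \<in> Inv h" "t = cj g u" by blast
      then have "u \<in> T" using Inv_sub_T by blast
      then show "cj (inv g) t \<in> Inv h" using u g T_carrier by simp
    qed
    then show ?thesis using Inv_mult[OF g h that] by simp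
  qed
  moreover have "?C \<subseteq> T" using cj_T[OF g] Inv_sub_T by blast
  ultimately have eq: "Inv (g \<otimes> h) = (Inv g - ?C) \<union> (?C - Inv g)" using Inv_sub_T by blast
  have fC: "finite ?C" by simp
  have "card (Inv (g \<otimes> h)) = card (Inv g - ?C) + card (?C - Inv g)"
    unfolding eq by (rule card_Un_disjoint) auto
  moreover have "card (Inv g) = card (Inv g - ?C) + card (Inv g \<inter> ?C)"
    using card_Int_Diff[OF finite_Inv, of g ?C] by simp
  moreover have "card ?C = card (?C - Inv g) + card (Inv g \<inter> ?C)"
    using card_Int_Diff[OF fC, of "Inv g"] by (simp add: Int_commute)
  ultimately have "card (Inv (g \<otimes> h)) = card (Inv g) + card (Inv h) \<longleftrightarrow> card (Inv g \<inter> ?C) = 0"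
    using C by linarith
  also have "\<dots> \<longleftrightarrow> Inv g \<inter> ?C = {}" by (simp add: card_eq_0_iff)
  also have "\<dots> \<longleftrightarrow> Inv g \<subseteq> Inv (g \<otimes> h)" using eq by blast
  finally show ?thesis .
qed

section \<open>Weak order, descents and covers\<close>

lemma right_weak_le_iff:
  assumes "u \<in> carrier W" "v \<in> carrier W"
  shows "right_weak_le W S u v \<longleftrightarrow> Inv u \<subseteq> Inv v"
proof -
  have "u \<otimes> (inv u \<otimes> v) = v" using assms by (simp flip: m_assoc)
  then show ?thesis
    unfolding right_weak_le_def using len_add_iff[of u "inv u \<otimes> v"] assms by (simp add: len_eq)
qed

lemma des_iff:
  assumes "w \<in> carrier W"
  shows "s \<in> des W S w \<longleftrightarrow> s \<in> S \<and> cj w s \<in> Inv w"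
proof (cases "s \<in> S")
  case True
  then have sc: "s \<in> carrier W" by (rule S_carrier)
  show ?thesis
  proof (cases "cj w s \<in> Inv w")
    case c: True
    then show ?thesis unfolding des_def
      using True sc assms Inv_mult_simple(1)[OF assms True c] card_Diff1_less[OF finite_Inv c]
      by (simp add: len_eq)
  next
    case c: False
    then show ?thesis unfolding des_def
      using True sc assms Inv_mult_simple(2)[OF assms True c]
      by (simp add: len_eq)
  qed
qed (simp add: des_def)

text \<open>A descent \<open>r\<close> of \<open>inv y \<otimes> u\<close> is the first step of a
  descending path from \<open>u\<close> to \<open>y\<close>: the mirror it crosses lies in exactly
  one of \<open>Inv y\<close> and \<open>Inv u\<close>, hence only in the larger set.\<close>

lemma weak_lower:
  assumes y: "y \<in> carrier W" and u: "u \<in> carrier W" and le: "Inv y \<subseteq> Inv u" and ne: "y \<noteq> u"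
  shows "\<exists>r\<in>S. cj u r \<in> Inv u \<and> Inv y \<subseteq> Inv (u \<otimes> r)"
proof -
  let ?g = "inv y \<otimes> u"
  have g: "?g \<in> carrier W" "y \<otimes> ?g = u" using y u by (auto simp flip: m_assoc)
  then have "?g \<noteq> \<one>" using ne y by auto
  then obtain r where r: "r \<in> S" "cj ?g r \<in> Inv ?g" using descent_exists[of S ?g] gen g by auto
  have rc: "r \<in> carrier W" and rT: "r \<in> T" using r S_carrier S_wall by auto
  have tT: "cj u r \<in> T" using rT u by simp
  have "cj (inv y) (cj u r) = cj ?g r" using y u rc by simp
  then have "cj u r \<in> Inv u \<longleftrightarrow> cj u r \<notin> Inv y"
    using Inv_mult[OF y g(1) tT] r(2) unfolding g(2) by simp
  then have "cj u r \<in> Inv u" "cj u r \<notin> Inv y" using le by blast+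
  then show ?thesis using Inv_mult_simple(1)[OF u r(1)] r(1) le by blast
qed

lemma covers_iff:
  assumes w: "w \<in> carrier W"
  shows "right_weak_covers W S u w \<longleftrightarrow> (\<exists>s\<in>des W S w. u = w \<otimes> s)"
proof
  assume "right_weak_covers W S u w"
  then have u: "u \<in> carrier W" "u \<noteq> w" "Inv u \<subseteq> Inv w"
    and c: "\<And>x. \<lbrakk>x \<in> carrier W; Inv u \<subseteq> Inv x; Inv x \<subseteq> Inv w\<rbrakk> \<Longrightarrow> x = u \<or> x = w"
    unfolding right_weak_covers_def using w right_weak_le_iff by blast+
  obtain r where r: "r \<in> S" "cj w r \<in> Inv w" "Inv u \<subseteq> Inv (w \<otimes> r)" using weak_lower[OF u(1) w u(3,2)] by blast
  have I: "Inv (w \<otimes> r) = Inv w - {cj w r}" by (rule Inv_mult_simple(1)[OF w r(1,2)])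
  have "w \<otimes> r \<in> carrier W" using w r S_carrier by simp
  then have "w \<otimes> r = u \<or> w \<otimes> r = w" using c r(3) I by blast
  moreover have "w \<otimes> r \<noteq> w" using I r(2) by (metis DiffE insertI1)
  ultimately show "\<exists>s\<in>des W S w. u = w \<otimes> s" using des_iff[OF w] r by blast
next
  assume "\<exists>s\<in>des W S w. u = w \<otimes> s"
  then obtain s where s: "s \<in> S" "cj w s \<in> Inv w" and u: "u = w \<otimes> s" using des_iff[OF w] by blast
  have I: "Inv u = Inv w - {cj w s}" unfolding u by (rule Inv_mult_simple(1)[OF w s])
  have uc: "u \<in> carrier W" unfolding u using w s S_carrier by simp
  have "x = u \<or> x = w" if x: "x \<in> carrier W" "Inv u \<subseteq> Inv x" "Inv x \<subseteq> Inv w" for x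
  proof -
    have "Inv x = Inv u \<or> Inv x = Inv w" using x I by blast
    then show ?thesis using Inv_inj x uc w by blast
  qed
  moreover have "u \<noteq> w" using I s(2) by blast
  ultimately show "right_weak_covers W S u w"
    unfolding right_weak_covers_def using right_weak_le_iff uc w I by auto
qed

section \<open>Chambers of parabolic subgroups\<close>

lemma chamber_representative:
  assumes J: "J \<subseteq> S"
  shows "\<exists>g\<in>generate W J. \<forall>d\<in>T \<inter> generate W J. 0 \<le> unormal d \<bullet> \<rho> g x"
proof -
  have sub: "generate W J \<subseteq> carrier W" using gen_closed[OF J] by blast
  then have f: "finite (generate W J)" using fin finite_subset by blast
  have ne: "generate W J \<noteq> {}" using generate.one by blast
  \<comment> \<open>The orbit point nearest to \<open>b\<close> is chosen; a mirror of the subgroup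
    with this point on the wrong side would reflect it to a nearer one.\<close>
  obtain g where g: "g \<in> generate W J"
    and least: "\<And>h. h \<in> generate W J \<Longrightarrow> norm (\<rho> g x - b) \<le> norm (\<rho> h x - b)"
    using ex_min_if_finite[of "(\<lambda>h. norm (\<rho> h x - b)) ` generate W J"] f ne by (force simp: not_less)
  have "0 \<le> unormal d \<bullet> \<rho> g x" if d: "d \<in> T \<inter> generate W J" for d
  proof (rule ccontr)
    assume n: "\<not> ?thesis"
    have dT: "d \<in> T" using d by blast
    have "d \<otimes> g \<in> generate W J" using d g by (intro generate.eng) auto
    from least[OF this] have "norm (\<rho> g x - b) \<le> norm (\<rho> d (\<rho> g x) - b)"
      using rho_mult[OF T_carrier[OF dT] gen_closed[OF J g], of x] by simp
    then have "(norm (\<rho> g x - b))\<^sup>2 \<le> (norm (\<rho> d (\<rho> g x) - b))\<^sup>2" by (simp add: power_mono)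
    moreover have "(norm (\<rho> d (\<rho> g x) - b))\<^sup>2
        = (norm (\<rho> g x - b))\<^sup>2 + 4 * ((unormal d \<bullet> \<rho> g x) * (unormal d \<bullet> b))"
      using norm_reflection_diff[OF unormal(1)[OF dT], of "\<rho> g x" b] unormal(3)[OF dT]
      by (simp only: mult.assoc)
    ultimately have "0 \<le> (unormal d \<bullet> \<rho> g x) * (unormal d \<bullet> b)" by linarith
    then show False using unormal(2)[OF dT] n by (simp add: zero_le_mult_iff)
  qed
  then show ?thesis using g by blast
qed

lemma region_representative:
  assumes x: "\<And>t. t \<in> T \<Longrightarrow> unormal t \<bullet> x \<noteq> 0"
  shows "\<exists>w\<in>carrier W. Inv w = {t \<in> T. unormal t \<bullet> x < 0}"
proof -
  obtain g where g: "g \<in> carrier W" and pos: "\<And>d. d \<in> T \<Longrightarrow> 0 \<le> unormal d \<bullet> \<rho> g x"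
    using chamber_representative[of S x] gen T_carrier by auto
  let ?w = "inv g"
  have "unormal t \<bullet> \<rho> ?w b < 0 \<longleftrightarrow> unormal t \<bullet> x < 0" if t: "t \<in> T" for t
  proof -
    have d: "cj g t \<in> T" using g t by simp
    have "(unormal t \<bullet> x) * (unormal t \<bullet> \<rho> ?w b) = (unormal (cj g t) \<bullet> \<rho> g x) * (unormal (cj g t) \<bullet> b)"
      using unormal_cj_same[OF g t, of x "\<rho> ?w b"] g by simp
    then have "0 \<le> (unormal t \<bullet> x) * (unormal t \<bullet> \<rho> ?w b)" using pos[OF d] unormal(2)[OF d] by simp
    moreover have "unormal t \<bullet> \<rho> ?w b \<noteq> 0" by (rule regular) (use g t in auto)
    ultimately show ?thesis using x[OF t] by (auto simp: zero_le_mult_iff)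
  qed
  then have "Inv ?w = {t \<in> T. unormal t \<bullet> x < 0}" unfolding Inv_def by blast
  then show ?thesis using g by blast
qed

text \<open>The simple inequalities imply all others because the representative \<open>g\<close> is
  trivial: at a descent \<open>s\<close> of \<open>g\<close> the points \<open>\<rho> g x\<close>
  and \<open>\<rho> g b\<close> lie on the same side of the mirror of \<open>cj g s\<close>, but the
  former is nonnegative there and the latter negative.\<close>

lemma parabolic_chamber:
  assumes J: "J \<subseteq> S" and x: "\<And>s. s \<in> J \<Longrightarrow> 0 < unormal s \<bullet> x" and d: "d \<in> T \<inter> generate W J"
  shows "0 \<le> unormal d \<bullet> x"
proof -
  obtain g where g: "g \<in> generate W J" and pos: "\<And>d. d \<in> T \<inter> generate W J \<Longrightarrow> 0 \<le> unormal d \<bullet> \<rho> g x"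
    using chamber_representative[OF J, of x] by blast
  have gc: "g \<in> carrier W" by (rule gen_closed[OF J g])
  have "g = \<one>"
  proof (rule ccontr)
    assume "g \<noteq> \<one>"
    then obtain s where s: "s \<in> J" "cj g s \<in> Inv g" using descent_exists[OF J g] by blast
    have sT: "s \<in> T" using s J S_wall by blast
    let ?c = "cj g s"
    have "?c \<in> T \<inter> generate W J" using gc sT gen_cj[OF J g generate.incl[OF s(1)]] by simp
    then have "0 \<le> unormal ?c \<bullet> \<rho> g x" by (rule pos)
    moreover have "unormal ?c \<bullet> \<rho> g b < 0" using s(2) unfolding Inv_def by blast
    moreover have "0 < (unormal ?c \<bullet> \<rho> g x) * (unormal ?c \<bullet> \<rho> g b)"
      unfolding unormal_cj_same[OF gc sT] using x[OF s(1)] unormal(2)[OF sT] by simp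
    ultimately show False by (simp add: zero_less_mult_iff)
  qed
  then show ?thesis using pos[OF d] by simp
qed

text \<open>\<open>\<rho> g b\<close> or its negative satisfies the simple inequalities of
  \<open>J\<close>, hence those of all reflections in the subgroup.\<close>

lemma parabolic_Inv:
  assumes J: "J \<subseteq> S" and g: "g \<in> carrier W" and d: "d \<in> T \<inter> generate W J"
  shows "J \<subseteq> Inv g \<Longrightarrow> d \<in> Inv g" "J \<inter> Inv g = {} \<Longrightarrow> d \<notin> Inv g"
proof -
  have dT: "d \<in> T" using d by blast
  note reg = regular[OF g]
  {
    assume "J \<subseteq> Inv g"
    then have "0 < unormal s \<bullet> - \<rho> g b" if "s \<in> J" for s using that unfolding Inv_def by auto
    from parabolic_chamber[OF J this d] show "d \<in> Inv g"
      unfolding Inv_def using reg[OF dT] dT by simp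
  next
    assume "J \<inter> Inv g = {}"
    then have "0 < unormal s \<bullet> \<rho> g b" if "s \<in> J" for s
      using that reg[of s] J S_wall(1) unfolding Inv_def by force
    from parabolic_chamber[OF J this d] show "d \<notin> Inv g" unfolding Inv_def by simp
  }
qed

text \<open>Such a \<open>y\<close> is the top of its coset; on the inverse, descents become simple
  inversions and \<open>parabolic_Inv\<close> applies.\<close>

lemma coset_Inv:
  assumes J: "J \<subseteq> S" and y: "y \<in> carrier W" and des: "\<And>s. s \<in> J \<Longrightarrow> cj y s \<in> Inv y"
    and d: "d \<in> T \<inter> generate W J"
  shows "cj y d \<in> Inv y"
proof -
  have "J \<subseteq> Inv (inv y)" using Inv_inv_iff[OF y] des J S_wall(1) by blast
  then have "d \<in> Inv (inv y)" using parabolic_Inv(1)[OF J _ d] y by simp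
  then show ?thesis using Inv_inv_iff[OF y] d by blast
qed

text \<open>Since \<open>y\<close> inverts every conjugate \<open>cj y d\<close>, the element
  \<open>inv y \<otimes> h\<close> inverts \<open>d\<close> iff \<open>h\<close> does not invert
  \<open>cj y d\<close>; thus \<open>parabolic_Inv\<close> applies with its two cases exchanged.
  This is the dichotomy behind every use of local confluence.\<close>

lemma coset_Inv_other:
  assumes J: "J \<subseteq> S" and y: "y \<in> carrier W" and des: "\<And>s. s \<in> J \<Longrightarrow> cj y s \<in> Inv y"
    and h: "h \<in> carrier W" and d: "d \<in> T \<inter> generate W J"
  shows "(\<And>s. s \<in> J \<Longrightarrow> cj y s \<in> Inv h) \<Longrightarrow> cj y d \<in> Inv h"
    "(\<And>s. s \<in> J \<Longrightarrow> cj y s \<notin> Inv h) \<Longrightarrow> cj y d \<notin> Inv h"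
proof -
  let ?g = "inv y \<otimes> h"
  have g: "?g \<in> carrier W" using y h by simp
  have eq: "t \<in> Inv ?g \<longleftrightarrow> cj y t \<notin> Inv h" if "t \<in> T" "cj y t \<in> Inv y" for t
    using Inv_mult[of "inv y" h t] Inv_inv_iff[OF y that(1)] y h that by simp
  have eqJ: "s \<in> Inv ?g \<longleftrightarrow> cj y s \<notin> Inv h" if "s \<in> J" for s
    by (rule eq) (use that J S_wall(1) des in auto)
  have eqd: "d \<in> Inv ?g \<longleftrightarrow> cj y d \<notin> Inv h"
    by (rule eq) (use d coset_Inv[OF J y des d] in auto)
  show "cj y d \<in> Inv h" if "\<And>s. s \<in> J \<Longrightarrow> cj y s \<in> Inv h"
    using parabolic_Inv(2)[OF J g d] eqJ eqd that by blast
  show "cj y d \<notin> Inv h" if "\<And>s. s \<in> J \<Longrightarrow> cj y s \<notin> Inv h"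
    using parabolic_Inv(1)[OF J g d] eqJ eqd that by blast
qed

text \<open>Exchange writes \<open>t \<otimes> g\<close> as a word in the letters of
  \<open>g\<close>, so \<open>t\<close> is a quotient of two elements of the subgroup.\<close>

lemma Inv_gen:
  assumes J: "J \<subseteq> S" and g: "g \<in> generate W J"
  shows "Inv g \<subseteq> generate W J"
proof
  fix t assume t: "t \<in> Inv g"
  obtain ss where ss: "ss \<in> lists J" "word_prod W ss = g" using gen_word[OF J g] by blast
  have "ss \<in> lists S" using ss J lists_mono by blast
  then obtain ss' where ss': "ss' \<in> lists (set ss)" "t \<otimes> g = word_prod W ss'"
    using exchange[of ss t] t ss by blast
  then have "ss' \<in> lists J" using ss(1) by (auto simp: in_lists_conv_set)
  then have "t \<otimes> g \<in> generate W J" using ss' word_in_gen J by simp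
  then have "t \<otimes> g \<otimes> inv g \<in> generate W J" by (rule gen_mult[OF J _ gen_inv[OF J g]])
  moreover have "t \<in> carrier W" "g \<in> carrier W" using t Inv_sub_T T_carrier gen_closed[OF J g] by blast+
  ultimately show "t \<in> generate W J" by (simp add: m_assoc)
qed

section \<open>Longest elements and tops and bottoms of cosets\<close>

lemma longest_props:
  assumes J: "J \<subseteq> S"
  shows "longest W S J \<in> generate W J" "Inv (longest W S J) = T \<inter> generate W J"
proof -
  let ?w = "longest W S J"
  \<comment> \<open>A bound on the lengths is what makes the value of \<open>ARG_MAX\<close> a true
    maximum; no element has more inversions than there are reflections.\<close>
  have "\<forall>y. y \<in> generate W J \<longrightarrow> len W S y < Suc (card T)"
    using len_eq gen_closed[OF J] card_mono[OF finite_T Inv_sub_T] by (simp add: less_Suc_eq_le)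
  from arg_max_nat_lemma[where P = "\<lambda>w. w \<in> generate W J" and f = "len W S", OF generate.one this]
  have w: "?w \<in> generate W J" and max: "\<And>y. y \<in> generate W J \<Longrightarrow> len W S y \<le> len W S ?w"
    unfolding longest_def by blast+
  show "?w \<in> generate W J" by (rule w)
  have wc: "?w \<in> carrier W" by (rule gen_closed[OF J w])
  \<comment> \<open>Maximality under right multiplication controls descents, which are the simple
    inversions of the inverse. Passing back to \<open>?w\<close> only uses that both have equally
    many inversions.\<close>
  have "s \<in> Inv (inv ?w)" if s: "s \<in> J" for s
  proof (rule ccontr)
    assume "s \<notin> Inv (inv ?w)"
    moreover have sS: "s \<in> S" using s J by blast
    ultimately have c: "cj ?w s \<notin> Inv ?w" using Inv_inv_iff[OF wc] S_wall(1) by blast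
    have "?w \<otimes> s \<in> generate W J" using w s by (intro generate.eng) (auto intro: generate.incl)
    from max[OF this] show False
      using Inv_mult_simple(2)[OF wc sS c] c wc S_carrier[OF sS] by (simp add: len_eq)
  qed
  then have "T \<inter> generate W J \<subseteq> Inv (inv ?w)" using parabolic_Inv(1)[OF J] wc by blast
  moreover have sub: "Inv ?w \<subseteq> T \<inter> generate W J" using Inv_gen[OF J w] Inv_sub_T by blast
  ultimately have "card (T \<inter> generate W J) \<le> card (Inv ?w)"
    using card_mono[OF finite_Inv] card_Inv_inv[OF wc] by metis
  then show "Inv ?w = T \<inter> generate W J"
    using sub finite_T by (intro card_subset_eq) (auto intro: antisym card_mono)
qed

lemma longest_closed [simp]: "J \<subseteq> S \<Longrightarrow> longest W S J \<in> carrier W"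
  using longest_props gen_closed by blast

lemma longest_inv: "J \<subseteq> S \<Longrightarrow> inv (longest W S J) = longest W S J"
proof (rule Inv_inj)
  assume J: "J \<subseteq> S"
  let ?w = "longest W S J"
  have "Inv (inv ?w) \<subseteq> T \<inter> generate W J"
    using Inv_gen[OF J gen_inv[OF J longest_props(1)[OF J]]] Inv_sub_T by blast
  moreover have "card (Inv (inv ?w)) = card (T \<inter> generate W J)"
    using card_Inv_inv[of ?w] longest_props[OF J] J by simp
  ultimately show "Inv (inv ?w) = Inv ?w"
    unfolding longest_props(2)[OF J] using finite_T by (intro card_subset_eq) auto
qed auto

lemma longest_len:
  assumes J: "J \<subseteq> S" and g: "g \<in> generate W J"
  shows "card (Inv (longest W S J)) = card (Inv g) + card (Inv (inv g \<otimes> longest W S J))"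
    "card (Inv (longest W S J)) = card (Inv (longest W S J \<otimes> inv g)) + card (Inv g)"
proof -
  let ?w = "longest W S J"
  have *: "card (Inv ?w) = card (Inv g) + card (Inv (inv g \<otimes> ?w))" if g: "g \<in> generate W J" for g
  proof -
    have gc: "g \<in> carrier W" by (rule gen_closed[OF J g])
    have "g \<otimes> (inv g \<otimes> ?w) = ?w" using gc J by (simp flip: m_assoc)
    moreover have "Inv g \<subseteq> Inv ?w" unfolding longest_props(2)[OF J] using Inv_gen[OF J g] Inv_sub_T by blast
    ultimately show ?thesis using len_add_iff[of g "inv g \<otimes> ?w"] gc J by simp
  qed
  show "card (Inv ?w) = card (Inv g) + card (Inv (inv g \<otimes> ?w))" by (rule *[OF g])
  have gc: "g \<in> carrier W" by (rule gen_closed[OF J g])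
  have "inv (?w \<otimes> inv g) = g \<otimes> ?w" using gc J longest_inv[OF J] by (simp add: inv_mult_group)
  then have "card (Inv (g \<otimes> ?w)) = card (Inv (?w \<otimes> inv g))"
    using card_Inv_inv[of "?w \<otimes> inv g"] gc J by simp
  then show "card (Inv ?w) = card (Inv (?w \<otimes> inv g)) + card (Inv g)"
    using *[OF gen_inv[OF J g]] card_Inv_inv[OF gc] gc by simp
qed

text \<open>Here \<open>y\<close> is the bottom of its coset. An inversion of \<open>y\<close> could
  only be cancelled by \<open>g\<close> if it came from a reflection of the subgroup, and
  \<open>inv y\<close> inverts none of those.\<close>

lemma len_add_parabolic:
  assumes J: "J \<subseteq> S" and y: "y \<in> carrier W" and nd: "\<And>s. s \<in> J \<Longrightarrow> cj y s \<notin> Inv y"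
    and g: "g \<in> generate W J"
  shows "card (Inv (y \<otimes> g)) = card (Inv y) + card (Inv g)"
proof -
  have gc: "g \<in> carrier W" by (rule gen_closed[OF J g])
  have "J \<inter> Inv (inv y) = {}" using Inv_inv_iff[OF y] nd J S_wall(1) by blast
  then have n: "d \<notin> Inv (inv y)" if "d \<in> T \<inter> generate W J" for d
    using parabolic_Inv(2)[OF J _ that] y by simp
  have "t \<in> Inv (y \<otimes> g)" if t: "t \<in> Inv y" for t
  proof -
    have tT: "t \<in> T" using t Inv_sub_T by blast
    have d: "cj (inv y) t \<in> T" using tT y by simp
    have "cj y (cj (inv y) t) = t" using tT y T_carrier by simp
    then have "cj (inv y) t \<in> Inv (inv y)" using Inv_inv_iff[OF y d] t by simp
    then have "cj (inv y) t \<notin> Inv g" using n d Inv_gen[OF J g] by blast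
    then show ?thesis using Inv_mult[OF y gc tT] t by simp
  qed
  then show ?thesis using len_add_iff[OF y gc] by blast
qed

text \<open>The longest element flips exactly the conjugated reflections of the subgroup, and at the
  top of the coset all of these are inverted.\<close>

lemma coset_bottom_Inv:
  assumes J: "J \<subseteq> S" and y: "y \<in> carrier W" and des: "\<And>s. s \<in> J \<Longrightarrow> cj y s \<in> Inv y"
  shows "Inv (y \<otimes> longest W S J) = Inv y - cj y ` (T \<inter> generate W J)"
proof -
  have mem: "cj (inv y) t \<in> T \<inter> generate W J \<longleftrightarrow> t \<in> cj y ` (T \<inter> generate W J)" if "t \<in> T" for t
  proof
    assume "cj (inv y) t \<in> T \<inter> generate W J"
    moreover have "t = cj y (cj (inv y) t)" using y that T_carrier by simp
    ultimately show "t \<in> cj y ` (T \<inter> generate W J)" by blast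
  next
    assume "t \<in> cj y ` (T \<inter> generate W J)"
    then obtain u where "u \<in> T \<inter> generate W J" "t = cj y u" by blast
    then show "cj (inv y) t \<in> T \<inter> generate W J" using y T_carrier by simp
  qed
  have w: "longest W S J \<in> carrier W" using J by simp
  have "t \<in> Inv (y \<otimes> longest W S J) \<longleftrightarrow> (t \<in> Inv y) \<noteq> (t \<in> cj y ` (T \<inter> generate W J))" if "t \<in> T" for t
    using Inv_mult[OF y w that] mem[OF that] unfolding longest_props(2)[OF J] by blast
  moreover have "cj y ` (T \<inter> generate W J) \<subseteq> Inv y" using coset_Inv[OF J y des] by blast
  ultimately show ?thesis using Inv_sub_T by blast
qed

text \<open>
  Newman's diamond lemma for the weak order: \<open>loc\<close> is local confluence.
\<close>

lemma least_element:
  assumes M: "M \<subseteq> carrier W" and u: "u \<in> M"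
    and up: "\<And>y z. \<lbrakk>y \<in> M; z \<in> carrier W; Inv y \<subseteq> Inv z; Inv z \<subseteq> Inv u\<rbrakk> \<Longrightarrow> z \<in> M"
    and loc: "\<And>y r r'. \<lbrakk>y \<in> M; Inv y \<subseteq> Inv u; r \<in> S; r' \<in> S; r \<noteq> r'; cj y r \<in> Inv y; cj y r' \<in> Inv y;
        y \<otimes> r \<in> M; y \<otimes> r' \<in> M\<rbrakk> \<Longrightarrow> y \<otimes> longest W S {r, r'} \<in> M"
  shows "\<exists>j\<in>M. Inv j \<subseteq> Inv u \<and> (\<forall>y\<in>M. Inv y \<subseteq> Inv u \<longrightarrow> Inv j \<subseteq> Inv y)"
proof -
  \<comment> \<open>The top element has to vary in the induction, which runs over the number of
    inversions of \<open>v\<close>.\<close>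
  have "\<exists>j\<in>M. Inv j \<subseteq> Inv v \<and> (\<forall>y\<in>M. Inv y \<subseteq> Inv v \<longrightarrow> Inv j \<subseteq> Inv y)"
    if "v \<in> M" "Inv v \<subseteq> Inv u" for v
    using that
  proof (induction "card (Inv v)" arbitrary: v rule: less_induct)
    case less
    have v: "v \<in> carrier W" using less.prems M by blast
    have I: "Inv (v \<otimes> r) = Inv v - {cj v r}" if "r \<in> S" "cj v r \<in> Inv v" for r
      by (rule Inv_mult_simple(1)[OF v that])
    have IH: "\<exists>j\<in>M. Inv j \<subseteq> Inv (v \<otimes> r) \<and> (\<forall>y\<in>M. Inv y \<subseteq> Inv (v \<otimes> r) \<longrightarrow> Inv j \<subseteq> Inv y)"
      if "r \<in> S" "cj v r \<in> Inv v" "v \<otimes> r \<in> M" for r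
      by (rule less.hyps) (use that I[OF that(1,2)] card_Diff1_less[OF finite_Inv that(2)] less.prems in auto)
    have down: "\<exists>r\<in>S. cj v r \<in> Inv v \<and> v \<otimes> r \<in> M \<and> Inv y \<subseteq> Inv (v \<otimes> r)"
      if y: "y \<in> M" "Inv y \<subseteq> Inv v" "y \<noteq> v" for y
    proof -
      obtain r where r: "r \<in> S" "cj v r \<in> Inv v" "Inv y \<subseteq> Inv (v \<otimes> r)"
        using weak_lower[of y v] y v M by blast
      then have "v \<otimes> r \<in> M"
        using up[OF y(1), of "v \<otimes> r"] I[OF r(1,2)] v S_carrier less.prems by auto
      then show ?thesis using r by blast
    qed
    show ?case
    proof (cases "\<exists>r\<in>S. cj v r \<in> Inv v \<and> v \<otimes> r \<in> M")
      case False
      then show ?thesis using down less.prems by blast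
    next
      case True
      then obtain r where r: "r \<in> S" "cj v r \<in> Inv v" "v \<otimes> r \<in> M" by blast
      obtain j where j: "j \<in> M" "Inv j \<subseteq> Inv (v \<otimes> r)"
        and least: "\<And>y. \<lbrakk>y \<in> M; Inv y \<subseteq> Inv (v \<otimes> r)\<rbrakk> \<Longrightarrow> Inv j \<subseteq> Inv y"
        using IH[OF r] by blast
      have "Inv j \<subseteq> Inv y" if y: "y \<in> M" "Inv y \<subseteq> Inv v" for y
      proof (cases "y = v")
        case True
        then show ?thesis using j I[OF r(1,2)] by blast
      next
        case False
        obtain r' where r': "r' \<in> S" "cj v r' \<in> Inv v" "v \<otimes> r' \<in> M" "Inv y \<subseteq> Inv (v \<otimes> r')"
          using down[OF y False] by blast
        show ?thesis
        proof (cases "r = r'")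
          case True
          then show ?thesis using least y r' by blast
        next
          case False
          obtain j' where j': "j' \<in> M" "Inv j' \<subseteq> Inv (v \<otimes> r')"
            and least': "\<And>y. \<lbrakk>y \<in> M; Inv y \<subseteq> Inv (v \<otimes> r')\<rbrakk> \<Longrightarrow> Inv j' \<subseteq> Inv y"
            using IH[OF r'(1-3)] by blast
          \<comment> \<open>The bottom of the rank-two coset lies below both lower neighbours of
            \<open>v\<close>. Hence \<open>j'\<close> lies below \<open>v \<otimes> r\<close> too,
            so \<open>j\<close> is below \<open>j'\<close> and thereby below
            \<open>y\<close>.\<close>
          let ?z = "v \<otimes> longest W S {r, r'}"
          have z: "?z \<in> M" using loc[OF less.prems r(1) r'(1) False r(2) r'(2) r(3) r'(3)] .
          have J: "{r, r'} \<subseteq> S" using r r' by blast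
          have Iz: "Inv ?z = Inv v - cj v ` (T \<inter> generate W {r, r'})"
            by (rule coset_bottom_Inv[OF J v]) (use r r' in blast)
          have "r \<in> T \<inter> generate W {r, r'}" "r' \<in> T \<inter> generate W {r, r'}"
            using S_wall(1) r r' generate.incl[of _ "{r, r'}" W] by blast+
          then have "Inv ?z \<subseteq> Inv (v \<otimes> r)" "Inv ?z \<subseteq> Inv (v \<otimes> r')"
            unfolding Iz I[OF r(1,2)] I[OF r'(1,2)] by blast+
          then have "Inv j' \<subseteq> Inv (v \<otimes> r)" using least' z by blast
          then have "Inv j \<subseteq> Inv j'" using least j' by blast
          moreover have "Inv j' \<subseteq> Inv y" using least' y r' by blast
          ultimately show ?thesis by blast
        qed
      qed
      then show ?thesis using j I[OF r(1,2)] by blast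
    qed
  qed
  then show ?thesis using u by blast
qed

end

section \<open>Positive braids\<close>

lemma pos_Nil [simp]: "pos [] = []"
  by (simp add: pos_def)

lemma pos_Cons [simp]: "pos (x # xs) = (x, True) # pos xs"
  by (simp add: pos_def)

lemma pos_append [simp]: "pos (xs @ ys) = pos xs @ pos ys"
  by (simp add: pos_def)

lemma pos_swords [simp]: "ss \<in> lists X \<Longrightarrow> pos ss \<in> swords X"
  by (auto simp: pos_def)

lemma alt_0 [simp]: "alt 0 s t = []"
  by (simp add: alt_def)

lemma alt_Suc: "alt (Suc k) s t = s # alt k t s"
  unfolding alt_def upt_conv_Cons[OF zero_less_Suc] map_Suc_upt[symmetric]
  by (simp add: comp_def)

lemma alt_snoc: "alt (Suc k) s t = alt k s t @ [if even k then s else t]"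
  by (simp add: alt_def)

lemma length_alt [simp]: "length (alt k s t) = k"
  by (simp add: alt_def)

lemma alt_lists: "\<lbrakk>s \<in> X; t \<in> X\<rbrakk> \<Longrightarrow> alt k s t \<in> lists X"
  by (auto simp: alt_def)

section \<open>Braids as classes of signed words\<close>

lemma braid_relations_swords: "braid_relations W S \<subseteq> swords S \<times> swords S"
  unfolding braid_relations_def using alt_in_lists by fast

definition braid_class :: "('w, 'm) monoid_scheme \<Rightarrow> 'w set \<Rightarrow> 'w sword \<Rightarrow> 'w sword set" where
  "braid_class W S u = pres_rel S (braid_relations W S) `` {u}"

lemma braid_class_mult:
  "\<lbrakk>u \<in> swords S; v \<in> swords S\<rbrakk> \<Longrightarrow> braid_class W S u \<otimes>\<^bsub>braid_group W S\<^esub> braid_class W S v = braid_class W S (u @ v)"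
  unfolding braid_class_def braid_group_def by (rule presented_group_mult_class[OF braid_relations_swords])

lemma braid_class_one: "\<one>\<^bsub>braid_group W S\<^esub> = braid_class W S []"
  by (simp add: braid_class_def braid_group_def presented_group_def)

lemma braid_class_eq_iff:
  "\<lbrakk>u \<in> swords S; v \<in> swords S\<rbrakk> \<Longrightarrow> braid_class W S u = braid_class W S v \<longleftrightarrow> (u, v) \<in> pres_rel S (braid_relations W S)"
  unfolding braid_class_def by (rule eq_equiv_class_iff[OF equiv_pres_rel[OF braid_relations_swords]])

lemma braid_class_carrier: "u \<in> swords S \<Longrightarrow> braid_class W S u \<in> carrier (braid_group W S)"
  unfolding braid_class_def braid_group_def presented_group_def partial_object.simps by (rule quotientI)

lemma word_prod_braid:
  "ss \<in> lists S \<Longrightarrow> word_prod (braid_group W S) (map (braid_gen W S) ss) = braid_class W S (pos ss)"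
proof (induction ss rule: list.induct)
  case Nil
  then show ?case by (simp add: braid_class_one)
next
  case (Cons s ss)
  then have "s \<in> S" "ss \<in> lists S" by auto
  moreover from this have "braid_class W S [(s, True)] \<otimes>\<^bsub>braid_group W S\<^esub> braid_class W S (pos ss) = braid_class W S ((s, True) # pos ss)"
    using braid_class_mult[of "[(s, True)]" S "pos ss" W] by simp
  ultimately show ?case using Cons.IH by (simp add: braid_gen_def braid_class_def)
qed

lemma pos_braids_iff: "x \<in> pos_braids W S \<longleftrightarrow> (\<exists>ss\<in>lists S. x = braid_class W S (pos ss))"
proof
  assume "x \<in> pos_braids W S"
  then show "\<exists>ss\<in>lists S. x = braid_class W S (pos ss)"
    unfolding pos_braids_def
  proof induction
    case one
    show ?case by (intro bexI[of _ "[]"]) (auto simp: braid_class_one)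
  next
    case (incl x)
    then obtain s where "s \<in> S" "x = braid_gen W S s" by blast
    then show ?case by (intro bexI[of _ "[s]"]) (auto simp: braid_class_def braid_gen_def)
  next
    case (mult x y)
    then obtain ss tt where "ss \<in> lists S" "tt \<in> lists S" "x = braid_class W S (pos ss)" "y = braid_class W S (pos tt)"
      by blast
    then show ?case by (intro bexI[of _ "ss @ tt"]) (auto simp: braid_class_mult)
  qed
next
  assume "\<exists>ss\<in>lists S. x = braid_class W S (pos ss)"
  then obtain ss where ss: "ss \<in> lists S" and x: "x = braid_class W S (pos ss)" by blast
  have "word_prod (braid_group W S) (map (braid_gen W S) ss) \<in> pos_braids W S"
    using ss unfolding pos_braids_def
    by (induction ss rule: list.induct) (auto intro: monoid_generate.intros)
  then show "x \<in> pos_braids W S" unfolding x word_prod_braid[OF ss] .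
qed

lemma (in group) pow_mult_shift:
  "\<lbrakk>s \<in> carrier G; t \<in> carrier G\<rbrakk> \<Longrightarrow> s \<otimes> (t \<otimes> s) [^] (k::nat) = (s \<otimes> t) [^] k \<otimes> s"
proof (induction k)
  case (Suc k)
  have "s \<otimes> (t \<otimes> s) [^] Suc k = (s \<otimes> (t \<otimes> s) [^] k) \<otimes> (t \<otimes> s)"
    using Suc.prems by (simp add: m_assoc)
  also have "\<dots> = (s \<otimes> t) [^] k \<otimes> s \<otimes> (t \<otimes> s)" using Suc by simp
  finally show ?case using Suc.prems by (simp add: m_assoc)
qed auto

context coxeter_reflections
begin

lemma inv_cancel [simp]:
  assumes "g \<in> carrier W" "x \<in> carrier W"
  shows "inv g \<otimes> (g \<otimes> x) = x" "g \<otimes> (inv g \<otimes> x) = x"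
  using assms by (simp_all flip: m_assoc)

lemma len_triangle:
  assumes "g \<in> carrier W" "h \<in> carrier W"
  shows "card (Inv (g \<otimes> h)) \<le> card (Inv g) + card (Inv h)"
proof -
  obtain ss tt where st: "ss \<in> lists S" "word_prod W ss = g" "length ss = card (Inv g)"
    "tt \<in> lists S" "word_prod W tt = h" "length tt = card (Inv h)"
    using reduced_word_exists[of S g] reduced_word_exists[of S h] assms gen by auto
  have "word_prod W (ss @ tt) = g \<otimes> h"
    using word_prod_append[of ss tt] st lists_S_carrier by auto
  moreover have "ss @ tt \<in> lists S" using st by simp
  ultimately show ?thesis using card_Inv_word[of "ss @ tt"] st by simp
qed

lemma reduced_word_iff:
  "w \<in> carrier W \<Longrightarrow>
    reduced_word W S w ss \<longleftrightarrow> ss \<in> lists S \<and> word_prod W ss = w \<and> length ss = card (Inv w)"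
  by (simp add: reduced_word_def len_eq)

lemma reduced_tail:
  assumes "s # r \<in> lists S" "length (s # r) = card (Inv (word_prod W (s # r)))"
  shows "length r = card (Inv (word_prod W r))" "s \<in> Inv (word_prod W (s # r))"
proof -
  have s: "s \<in> S" and r: "r \<in> lists S" using assms(1) by auto
  have sc: "s \<in> carrier W" and w: "word_prod W r \<in> carrier W" using s S_carrier r by auto
  have c: "card (Inv s) = 1" using Inv_simple[OF s] by simp
  show *: "length r = card (Inv (word_prod W r))"
    using len_triangle[OF sc w] card_Inv_word[OF r] assms(2) c by simp
  then have "Inv s \<subseteq> Inv (s \<otimes> word_prod W r)"
    using len_add_iff[OF sc w] assms(2) c by simp
  then show "s \<in> Inv (word_prod W (s # r))" using Inv_simple[OF s] by simp
qed

section \<open>Alternating words and Matsumoto's theorem\<close>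

lemma cj_mult_distrib:
  "\<lbrakk>g \<in> carrier W; x \<in> carrier W; y \<in> carrier W\<rbrakk> \<Longrightarrow> cj g (x \<otimes> y) = cj g x \<otimes> cj g y"
  unfolding cj_def by (simp add: m_assoc)

text \<open>The mirrors crossed by an alternating gallery are the reflections
  \<open>(s \<otimes> t) [^] k \<otimes> s\<close> of the dihedral subgroup, in rotational
  order.\<close>

lemma cj_alt:
  assumes "s \<in> S" "t \<in> S"
  shows "cj (word_prod W (alt k s t)) (if even k then s else t) = (s \<otimes> t) [^] k \<otimes> s"
  using assms
proof (induction k arbitrary: s t)
  case 0
  then show ?case using S_carrier by simp
next
  case (Suc k)
  have c: "s \<in> carrier W" "t \<in> carrier W" and sT: "s \<in> T" using Suc.prems S_carrier S_wall by auto
  let ?x = "if even k then t else s"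
  have x: "(if even (Suc k) then s else t) = ?x" "?x \<in> carrier W" using c by auto
  have p: "word_prod W (alt k t s) \<in> carrier W"
    using Suc.prems alt_lists[of t S s k] by simp
  have "cj (word_prod W (alt (Suc k) s t)) ?x = cj s (cj (word_prod W (alt k t s)) ?x)"
    unfolding alt_Suc using cj_cj[OF c(1) p x(2)] by simp
  also have "\<dots> = cj s ((t \<otimes> s) [^] k \<otimes> t)" using Suc.IH[OF Suc.prems(2,1)] by simp
  also have "\<dots> = (s \<otimes> (t \<otimes> s) [^] k) \<otimes> (t \<otimes> s)"
    unfolding cj_def using c sT by (simp add: m_assoc)
  also have "\<dots> = (s \<otimes> t) [^] Suc k \<otimes> s"
    using pow_mult_shift[OF c, of k] c by (simp add: m_assoc)
  finally show ?case unfolding x(1) .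
qed

lemma word_prod_alt_snoc:
  assumes "s \<in> S" "t \<in> S"
  shows "word_prod W (alt (Suc k) s t) = word_prod W (alt k s t) \<otimes> (if even k then s else t)"
  using assms word_prod_append[of "alt k s t" "[if even k then s else t]"]
    lists_S_carrier[OF alt_lists, of s S t k] S_carrier by (auto simp: alt_snoc)

text \<open>With \<open>p\<close> the alternating word of length \<open>k - 1\<close> starting in
  \<open>s\<close>, one word is \<open>p\<close> followed by a letter, which equals the last crossed
  mirror times \<open>p\<close>, and the other is \<open>t\<close> times \<open>p\<close>; the
  factor \<open>p\<close> cancels.\<close>

lemma alt_quotient:
  assumes "s \<in> S" "t \<in> S"
  shows "word_prod W (alt k s t) \<otimes> inv (word_prod W (alt k t s)) = (s \<otimes> t) [^] k"
proof (cases k)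
  case 0
  then show ?thesis by simp
next
  case (Suc n)
  have c: "s \<in> carrier W" "t \<in> carrier W" "t \<in> T" using assms S_carrier S_wall by auto
  let ?p = "word_prod W (alt n s t)" and ?x = "if even n then s else t"
  have p: "?p \<in> carrier W" using assms alt_lists[of s S t n] by simp
  have x: "?x \<in> carrier W" using c by simp
  have "word_prod W (alt k s t) = (s \<otimes> t) [^] n \<otimes> s \<otimes> ?p"
    using word_prod_alt_snoc[OF assms, of n] cj_mult[OF p x] cj_alt[OF assms, of n] Suc by simp
  moreover have "word_prod W (alt k t s) = t \<otimes> ?p" using Suc by (simp add: alt_Suc)
  ultimately have "word_prod W (alt k s t) \<otimes> inv (word_prod W (alt k t s))
      = (s \<otimes> t) [^] n \<otimes> s \<otimes> (?p \<otimes> inv ?p) \<otimes> t"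
    using c p by (simp add: inv_mult_group m_assoc)
  also have "\<dots> = (s \<otimes> t) [^] k" using c p Suc by (simp add: m_assoc)
  finally show ?thesis .
qed

lemma alt_braid:
  assumes "s \<in> S" "t \<in> S"
  shows "word_prod W (alt (cox_m W s t) s t) = word_prod W (alt (cox_m W s t) t s)"
proof -
  let ?p = "word_prod W (alt (cox_m W s t) s t)" and ?q = "word_prod W (alt (cox_m W s t) t s)"
  have c: "s \<in> carrier W" "t \<in> carrier W" using assms S_carrier by auto
  have p: "?p \<in> carrier W" "?q \<in> carrier W"
    by (rule word_closed[OF alt_lists subset_refl]; rule assms)+
  have "?p \<otimes> inv ?q = \<one>"
    using alt_quotient[OF assms] c unfolding cox_m_def by simp
  then have "inv (inv ?q) = ?p" using p by (intro inv_equality) auto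
  then show ?thesis using p by simp
qed

text \<open>Each further letter crosses a new mirror: a repetition would make a power of
  \<open>s \<otimes> t\<close> trivial whose exponent is positive and below its order.\<close>

lemma alt_reduced:
  assumes "s \<in> S" "t \<in> S" "k \<le> cox_m W s t"
  shows "card (Inv (word_prod W (alt k s t))) = k"
proof -
  have c: "s \<in> carrier W" "t \<in> carrier W" using assms S_carrier by auto
  have st: "s \<otimes> t \<in> carrier W" using c by simp
  have p: "word_prod W (alt k s t) \<in> carrier W" for k using assms alt_lists[of s S t k] by simp
  let ?x = "\<lambda>k. if even k then s else t"
  have x: "?x k \<in> S" for k :: nat using assms by simp
  have sub: "Inv (word_prod W (alt k s t)) \<subseteq> (\<lambda>i. (s \<otimes> t) [^] i \<otimes> s) ` {..<k}" for k
  proof (induction k)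
    case (Suc k)
    have "Inv (word_prod W (alt (Suc k) s t))
        \<subseteq> insert (cj (word_prod W (alt k s t)) (?x k)) (Inv (word_prod W (alt k s t)))"
      unfolding word_prod_alt_snoc[OF assms(1,2)] using Inv_mult_simple[OF p x] by blast
    then show ?case using Suc unfolding cj_alt[OF assms(1,2)] by (auto simp: lessThan_Suc)
  qed simp
  show ?thesis
    using assms(3)
  proof (induction k)
    case (Suc k)
    have "cj (word_prod W (alt k s t)) (?x k) \<notin> Inv (word_prod W (alt k s t))"
    proof
      assume "cj (word_prod W (alt k s t)) (?x k) \<in> Inv (word_prod W (alt k s t))"
      then obtain i where i: "i < k" "(s \<otimes> t) [^] k \<otimes> s = (s \<otimes> t) [^] i \<otimes> s"
        using sub[of k] unfolding cj_alt[OF assms(1,2)] by blast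
      then have "(s \<otimes> t) [^] k = (s \<otimes> t) [^] i" using c by simp
      moreover have "(s \<otimes> t) [^] i \<otimes> (s \<otimes> t) [^] (k - i) = (s \<otimes> t) [^] k"
        using st i(1) by (simp add: nat_pow_mult)
      ultimately have "(s \<otimes> t) [^] (k - i) = \<one>"
        using st by (metis l_cancel_one nat_pow_closed)
      then have "cox_m W s t dvd k - i" unfolding cox_m_def using st pow_eq_id by blast
      then show False using Suc.prems i(1) by (auto dest: dvd_imp_le)
    qed
    from Inv_mult_simple(2)[OF p x this] this show ?case
      using Suc unfolding word_prod_alt_snoc[OF assms(1,2)] by simp
  qed simp
qed

text \<open>Counterpart of \<open>len_add_parabolic\<close> at the top of a coset: moving down by
  \<open>g\<close> creates no inversion, since every mirror that \<open>g\<close> could contribute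
  is already inverted by \<open>y\<close>.\<close>

lemma len_sub_parabolic:
  assumes J: "J \<subseteq> S" and y: "y \<in> carrier W" and des: "\<And>s. s \<in> J \<Longrightarrow> cj y s \<in> Inv y"
    and g: "g \<in> generate W J"
  shows "card (Inv y) = card (Inv (y \<otimes> g)) + card (Inv g)"
proof -
  have gc: "g \<in> carrier W" by (rule gen_closed[OF J g])
  have "t \<in> Inv y" if t: "t \<in> Inv (y \<otimes> g)" for t
  proof (rule ccontr)
    assume n: "t \<notin> Inv y"
    have tT: "t \<in> T" using t Inv_sub_T by blast
    then have "cj (inv y) t \<in> Inv g" using Inv_mult[OF y gc tT] t n by blast
    then have "cj (inv y) t \<in> T \<inter> generate W J" using Inv_gen[OF J g] Inv_sub_T by blast
    from coset_Inv[OF J y des this] have "cj y (cj (inv y) t) \<in> Inv y" by blast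
    then show False using n y tT T_carrier by simp
  qed
  moreover have "y \<otimes> g \<otimes> inv g = y" using y gc by (simp add: m_assoc)
  ultimately show ?thesis
    using len_add_iff[of "y \<otimes> g" "inv g"] y gc card_Inv_inv[OF gc] by auto
qed

lemma cox_m_pos: "\<lbrakk>s \<in> S; t \<in> S\<rbrakk> \<Longrightarrow> 1 \<le> cox_m W s t"
  unfolding cox_m_def using ord_ge_1[OF fin] S_carrier by simp

text \<open>Induction on length, where words with a common first letter are compared by cancelling
  it. If the first letters differ, both are inversions of the element, so some reduced word begins
  with the full alternating word in these two letters; switching that prefix is a single braid
  relation and leads to a word beginning with the other letter.\<close>

lemma matsumoto:
  assumes "ss \<in> lists S" "tt \<in> lists S" "word_prod W ss = word_prod W tt"
    and "length ss = card (Inv (word_prod W ss))" "length tt = card (Inv (word_prod W ss))"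
  shows "braid_class W S (pos ss) = braid_class W S (pos tt)"
  using assms
proof (induction "length ss" arbitrary: ss tt)
  case 0
  then show ?case by simp
next
  case (Suc n)
  obtain r a where ss: "ss = r # a" using Suc.hyps(2) by (cases ss) auto
  obtain r' a' where tt: "tt = r' # a'" using Suc.hyps(2) Suc.prems(4,5) by (cases tt) auto
  have r: "r \<in> S" "a \<in> lists S" "r' \<in> S" "a' \<in> lists S" using Suc.prems ss tt by auto
  have rc: "r \<in> carrier W" "r' \<in> carrier W" "r \<in> T" "r' \<in> T" using r S_carrier S_wall by auto
  let ?w = "word_prod W ss"
  have w: "?w \<in> carrier W" using Suc.prems(1) by simp
  have t1: "length a = card (Inv (word_prod W a))" "r \<in> Inv ?w"
    using reduced_tail[of r a] Suc.prems ss by auto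
  have t2: "length a' = card (Inv (word_prod W a'))" "r' \<in> Inv ?w"
    using reduced_tail[of r' a'] Suc.prems tt by auto
  have step: "braid_class W S (pos (x # c)) = braid_class W S (pos (x # d))"
    if x: "x # c \<in> lists S" "x # d \<in> lists S" "word_prod W (x # c) = ?w" "word_prod W (x # d) = ?w"
      "length (x # c) = Suc n" "length (x # d) = Suc n" for x c d
  proof -
    have l: "length (x # c) = card (Inv (word_prod W (x # c)))"
      using x(3,5) Suc.hyps(2) Suc.prems(4) by simp
    have xS: "x \<in> S" "c \<in> lists S" "d \<in> lists S" using x by auto
    have eq: "x \<otimes> word_prod W c = x \<otimes> word_prod W d" using x(3,4) by simp
    have "word_prod W c = inv x \<otimes> (x \<otimes> word_prod W c)"
      by (rule inv_cancel(1)[OF S_carrier[OF xS(1)] word_closed[OF xS(2) subset_refl], symmetric])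
    also have "\<dots> = word_prod W d"
      unfolding eq by (rule inv_cancel(1)[OF S_carrier[OF xS(1)] word_closed[OF xS(3) subset_refl]])
    finally have e: "word_prod W c = word_prod W d" .
    have "braid_class W S (pos c) = braid_class W S (pos d)"
      using Suc.hyps(1)[of c d] e xS x(5,6) reduced_tail(1)[OF x(1) l] by simp
    moreover have "pos (x # u) = pos [x] @ pos u" for u by simp
    ultimately show ?thesis
      using braid_class_mult[of "pos [x]" S "pos c" W] braid_class_mult[of "pos [x]" S "pos d" W] xS by simp
  qed
  show ?case
  proof (cases "r = r'")
    case True
    then show ?thesis
      using step[of r a a'] Suc.hyps(2) Suc.prems ss tt by simp
  next
    case False
    let ?m = "cox_m W r r'" and ?J = "{r, r'}"
    let ?d = "word_prod W (alt ?m r r')"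
    have J: "?J \<subseteq> S" using r by simp
    have dJ: "?d \<in> generate W ?J" using alt_lists[of r ?J r' ?m] word_in_gen[OF _ J] by simp
    have d: "?d \<in> carrier W" by (rule gen_closed[OF J dJ])
    \<comment> \<open>First letters are inversions of \<open>?w\<close>, that is, descents of its
      inverse. So the inverse is the top of its coset and \<open>?d\<close> splits off with additive
      lengths.\<close>
    have des: "cj (inv ?w) s \<in> Inv (inv ?w)" if "s \<in> ?J" for s
      using Inv_inv_iff[of "inv ?w" s] that w t1(2) t2(2) rc by auto
    have "card (Inv (inv ?w)) = card (Inv (inv ?w \<otimes> ?d)) + card (Inv ?d)"
      by (rule len_sub_parabolic[OF J inv_closed[OF w] des dJ])
    moreover have "inv (inv ?w \<otimes> ?d) = inv ?d \<otimes> ?w" using w d by (simp add: inv_mult_group)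
    ultimately have card: "card (Inv ?w) = card (Inv (inv ?d \<otimes> ?w)) + ?m"
      using card_Inv_inv[of "inv ?w \<otimes> ?d"] card_Inv_inv[OF w] alt_reduced[OF r(1,3)] w d by simp
    obtain c where c: "c \<in> lists S" "word_prod W c = inv ?d \<otimes> ?w" "length c = card (Inv (inv ?d \<otimes> ?w))"
      using reduced_word_exists[of S "inv ?d \<otimes> ?w"] gen w d by auto
    have alts: "alt ?m r r' \<in> lists S" "alt ?m r' r \<in> lists S" by (rule alt_lists; rule r)+
    have p: "word_prod W (alt ?m r r' @ c) = ?w" "word_prod W (alt ?m r' r @ c) = ?w"
      using word_prod_append[of _ c] lists_S_carrier alts c w d alt_braid[OF r(1,3)]
      by (simp_all flip: m_assoc)
    \<comment> \<open>The order is positive because the group is finite, so both alternating words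
      expose a first letter; that is what \<open>step\<close> needs to link them to the given
      words.\<close>
    obtain k where k: "?m = Suc k" using cox_m_pos[OF r(1,3)] by (cases ?m) auto
    have len: "length (alt ?m r r' @ c) = Suc n" "length (alt ?m r' r @ c) = Suc n"
      using card c(3) Suc.hyps(2) Suc.prems(4) by simp_all
    have "braid_class W S (pos ss) = braid_class W S (pos (alt ?m r r' @ c))"
      using step[of r a "alt k r' r @ c"] ss alts c p len Suc.hyps(2) Suc.prems
      unfolding k alt_Suc by simp
    also have "\<dots> = braid_class W S (pos (alt ?m r' r @ c))"
    proof -
      have "(pos (alt ?m r r'), pos (alt ?m r' r)) \<in> braid_relations W S"
        unfolding braid_relations_def using r False by blast
      from pres_rel.relation[OF _ _ this, of "[]" S "pos c"]
      have "(pos (alt ?m r r' @ c), pos (alt ?m r' r @ c)) \<in> pres_rel S (braid_relations W S)"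
        using c by simp
      then show ?thesis using braid_class_eq_iff[of "pos (alt ?m r r' @ c)" S "pos (alt ?m r' r @ c)" W] alts c
        by simp
    qed
    also have "\<dots> = braid_class W S (pos tt)"
      using step[of r' "alt k r r' @ c" a'] tt alts c p len Suc.hyps(2) Suc.prems
      unfolding k alt_Suc by simp
    finally show ?thesis .
  qed
qed

lemma lift_eq:
  assumes w: "w \<in> carrier W" and ss: "reduced_word W S w ss"
  shows "lift W S w = braid_class W S (pos ss)"
proof -
  let ?r = "SOME ss. reduced_word W S w ss"
  have "reduced_word W S w ?r" using ss by (rule someI)
  then have r: "?r \<in> lists S" "word_prod W ?r = w" "length ?r = card (Inv w)"
    using reduced_word_iff[OF w] by auto
  have s: "ss \<in> lists S" "word_prod W ss = w" "length ss = card (Inv w)"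
    using reduced_word_iff[OF w] ss by auto
  show ?thesis
    unfolding lift_def word_prod_braid[OF r(1)] by (rule matsumoto) (use r s in simp_all)
qed

lemma reduced_word_obtain:
  assumes "w \<in> carrier W"
  obtains ss where "ss \<in> lists S" "lift W S w = braid_class W S (pos ss)"
    "word_prod W ss = w" "length ss = card (Inv w)"
  using reduced_word_exists[of S w] gen assms reduced_word_iff[OF assms] lift_eq[OF assms] by force

lemma lift_pos: "w \<in> carrier W \<Longrightarrow> lift W S w \<in> pos_braids W S"
  by (rule reduced_word_obtain) (auto simp: pos_braids_iff simp del: in_lists_conv_set)

lemma pos_braids_mult:
  "\<lbrakk>x \<in> pos_braids W S; y \<in> pos_braids W S\<rbrakk> \<Longrightarrow> x \<otimes>\<^bsub>braid_group W S\<^esub> y \<in> pos_braids W S"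
  unfolding pos_braids_def by (rule monoid_generate.mult)

lemma pos_braids_carrier: "x \<in> pos_braids W S \<Longrightarrow> x \<in> carrier (braid_group W S)"
  unfolding pos_braids_iff by (elim bexE) (simp only: braid_class_carrier pos_swords)

lemma lift_mult:
  assumes g: "g \<in> carrier W" and h: "h \<in> carrier W"
    and add: "card (Inv (g \<otimes> h)) = card (Inv g) + card (Inv h)"
  shows "lift W S (g \<otimes> h) = lift W S g \<otimes>\<^bsub>braid_group W S\<^esub> lift W S h"
proof -
  obtain ss where ss: "ss \<in> lists S" "lift W S g = braid_class W S (pos ss)" "word_prod W ss = g"
    "length ss = card (Inv g)" by (rule reduced_word_obtain[OF g])
  obtain tt where tt: "tt \<in> lists S" "lift W S h = braid_class W S (pos tt)" "word_prod W tt = h"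
    "length tt = card (Inv h)" by (rule reduced_word_obtain[OF h])
  have gh: "g \<otimes> h \<in> carrier W" using g h by simp
  have "word_prod W (ss @ tt) = g \<otimes> h"
    using word_prod_append[of ss tt] ss tt lists_S_carrier by auto
  then have "reduced_word W S (g \<otimes> h) (ss @ tt)"
    unfolding reduced_word_iff[OF gh] using ss tt add by simp
  from lift_eq[OF gh this] show ?thesis using ss tt by (simp add: braid_class_mult)
qed

text \<open>
  The number of crossings of each reflecting hyperplane, counted with sign, along the gallery
  described by a word; it is an invariant of the braid.
\<close>

primrec crossings :: "'w sword \<Rightarrow> 'w \<Rightarrow> int" where
  "crossings [] t = 0"
| "crossings (x # u) t = (if t = fst x then (if snd x then 1 else - 1) else 0) + crossings u (cj (fst x) t)"

lemma sword_prod_Nil [simp]: "sword_prod W [] = \<one>"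
  by (simp add: sword_prod_def)

lemma sword_prod_Cons: "fst x \<in> S \<Longrightarrow> sword_prod W (x # u) = fst x \<otimes> sword_prod W u"
  using S_wall(1) by (cases x) (auto simp: sword_prod_def)

lemma sword_prod_closed: "u \<in> swords S \<Longrightarrow> sword_prod W u \<in> carrier W"
  by (induction u rule: list.induct) (auto simp: sword_prod_Cons S_carrier)

lemma sword_prod_append:
  "\<lbrakk>u \<in> swords S; v \<in> swords S\<rbrakk> \<Longrightarrow> sword_prod W (u @ v) = sword_prod W u \<otimes> sword_prod W v"
proof (induction u rule: list.induct)
  case Nil
  then show ?case using sword_prod_closed[of v] by simp
next
  case (Cons x u)
  then have x: "fst x \<in> S" and u: "u \<in> swords S" by auto
  then show ?case
    using Cons.IH[OF u Cons.prems(2)] sword_prod_closed[OF u] sword_prod_closed[OF Cons.prems(2)]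
      S_carrier[OF x] by (simp add: sword_prod_Cons m_assoc)
qed

lemma sword_prod_pos: "ss \<in> lists S \<Longrightarrow> sword_prod W (pos ss) = word_prod W ss"
  by (induction ss rule: list.induct) (auto simp: sword_prod_Cons)

text \<open>Cocycle rule: the gallery of \<open>v\<close> starts in the chamber reached by
  \<open>u\<close>, so mirrors have to be carried back to \<open>B\<close> before its crossings are
  counted.\<close>

lemma crossings_append:
  assumes "u \<in> swords S" "v \<in> swords S" "t \<in> carrier W"
  shows "crossings (u @ v) t = crossings u t + crossings v (cj (inv (sword_prod W u)) t)"
  using assms
proof (induction u arbitrary: t rule: list.induct)
  case Nil
  then show ?case by simp
next
  case (Cons x u)
  then have x: "fst x \<in> S" and u: "u \<in> swords S" by auto
  have xc: "fst x \<in> carrier W" and xT: "fst x \<in> T" using x S_carrier S_wall by auto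
  have p: "sword_prod W u \<in> carrier W" by (rule sword_prod_closed[OF u])
  have "cj (inv (sword_prod W u)) (cj (fst x) t) = cj (inv (sword_prod W (x # u))) t"
    using xc xT p Cons.prems(3) by (simp add: sword_prod_Cons[OF x] inv_mult_group)
  then show ?case using Cons.IH[OF u Cons.prems(2), of "cj (fst x) t"] xc Cons.prems(3) by simp
qed

lemma crossings_pos_nonneg: "0 \<le> crossings (pos ss) t"
  by (induction ss arbitrary: t) (auto simp: add_nonneg_nonneg)

lemma crossings_reduced:
  assumes "ss \<in> lists S" "length ss = card (Inv (word_prod W ss))" "t \<in> carrier W"
  shows "crossings (pos ss) t = (if t \<in> Inv (word_prod W ss) then 1 else 0)"
  using assms
proof (induction ss arbitrary: t rule: list.induct)
  case Nil
  then show ?case by simp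
next
  case (Cons s r)
  have s: "s \<in> S" and r: "r \<in> lists S" using Cons.prems(1) by auto
  let ?w = "word_prod W r"
  have sc: "s \<in> carrier W" and sT: "s \<in> T" and w: "?w \<in> carrier W"
    using s r S_carrier S_wall by auto
  note tl = reduced_tail[OF Cons.prems(1,2)]
  have IH: "crossings (pos r) (cj s t) = (if cj s t \<in> Inv ?w then 1 else 0)"
    by (rule Cons.IH[OF r tl(1)]) (use sc Cons.prems in simp)
  have eq: "x \<in> Inv (s \<otimes> ?w) \<longleftrightarrow> (x = s) \<noteq> (cj s x \<in> Inv ?w)" if "x \<in> T" for x
    using Inv_mult[OF sc w that] Inv_simple[OF s] sT by simp
  have sn: "s \<notin> Inv ?w" using eq[OF sT] tl(2) sc by simp
  show ?case
  proof (cases "t \<in> T")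
    case True
    then show ?thesis using eq[OF True] IH sn sc by auto
  next
    \<comment> \<open>Conjugates of a non-reflection are not reflections, so both sides vanish. This
      makes the count meaningful on the whole group, not only on \<open>T\<close>.\<close>
    case False
    then have "t \<noteq> s" using sT by blast
    moreover have "cj s t \<notin> T"
    proof
      assume "cj s t \<in> T"
      from cj_T[OF sc this] have "cj s (cj s t) \<in> T" .
      then show False using False sc sT Cons.prems(3) by simp
    qed
    ultimately show ?thesis using IH False Inv_sub_T by auto
  qed
qed

text \<open>A cancelling pair crosses one mirror in both directions, and the two sides of a braid
  relation are reduced words of one element. The product is carried through the induction because
  the count on the remaining word depends on the chamber where it starts.\<close>

lemma crossings_invariant:
  assumes "(u, v) \<in> pres_rel S (braid_relations W S)"
  shows "sword_prod W u = sword_prod W v \<and> (\<forall>t\<in>carrier W. crossings u t = crossings v t)"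
  using assms
proof induction
  case (cancel p q x c)
  have x: "[(x, c), (x, \<not> c)] \<in> swords S" "x \<in> carrier W" "x \<in> T"
    using cancel S_carrier S_wall by auto
  have m: "sword_prod W [(x, c), (x, \<not> c)] = \<one>"
    using x cancel by (simp add: sword_prod_Cons)
  have n: "crossings [(x, c), (x, \<not> c)] t = 0" if "t \<in> carrier W" for t
  proof -
    have "cj x t = x \<longleftrightarrow> t = x"
      using cj_inv_iff[of x t x] x that by simp
    then show ?thesis by auto
  qed
  have sp: "sword_prod W ([(x, c), (x, \<not> c)] @ q) = sword_prod W q"
    using sword_prod_append[OF x(1) cancel.hyps(2)] m sword_prod_closed[OF cancel.hyps(2)] by simp
  have cn: "crossings ([(x, c), (x, \<not> c)] @ q) t = crossings q t" if "t \<in> carrier W" for t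
    using crossings_append[OF x(1) cancel.hyps(2) that] n[OF that] m that by simp
  have xq: "[(x, c), (x, \<not> c)] @ q \<in> swords S" using x cancel.hyps by simp
  have "sword_prod W (p @ [(x, c), (x, \<not> c)] @ q) = sword_prod W (p @ q)"
    using sword_prod_append[OF cancel.hyps(1) xq] sword_prod_append[OF cancel.hyps(1,2)] sp by simp
  moreover have "crossings (p @ [(x, c), (x, \<not> c)] @ q) t = crossings (p @ q) t" if t: "t \<in> carrier W" for t
    using crossings_append[OF cancel.hyps(1) xq t] crossings_append[OF cancel.hyps(1,2) t] cn
      sword_prod_closed[OF cancel.hyps(1)] t by simp
  ultimately show ?case by blast
next
  case (relation p q a a')
  obtain s t where st: "s \<in> S" "t \<in> S" "s \<noteq> t"
    and a: "a = pos (alt (cox_m W s t) s t)" "a' = pos (alt (cox_m W s t) t s)"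
    using relation.hyps(3) unfolding braid_relations_def by blast
  have unormal: "alt (cox_m W s t) s t \<in> lists S" "alt (cox_m W s t) t s \<in> lists S"
    by (rule alt_lists; rule st)+
  have asw: "a \<in> swords S" "a' \<in> swords S" using a unormal by auto
  have m: "sword_prod W a = sword_prod W a'"
    unfolding a using alt_braid[OF st(1,2)] unormal by (simp add: sword_prod_pos)
  have "card (Inv (word_prod W (alt (cox_m W s t) s t))) = cox_m W s t" using alt_reduced st by simp
  then have n: "crossings a x = crossings a' x" if "x \<in> carrier W" for x
    unfolding a using crossings_reduced[OF unormal(1) _ that] crossings_reduced[OF unormal(2) _ that] alt_braid[OF st(1,2)]
    by simp
  have sp: "sword_prod W (a @ q) = sword_prod W (a' @ q)"
    using sword_prod_append[OF asw(1) relation.hyps(2)] sword_prod_append[OF asw(2) relation.hyps(2)] m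
    by simp
  have cn: "crossings (a @ q) x = crossings (a' @ q) x" if "x \<in> carrier W" for x
    using crossings_append[OF asw(1) relation.hyps(2) that] crossings_append[OF asw(2) relation.hyps(2) that] n[OF that] m
    by simp
  have aq: "a @ q \<in> swords S" "a' @ q \<in> swords S" using asw relation.hyps by simp_all
  have "sword_prod W (p @ a @ q) = sword_prod W (p @ a' @ q)"
    using sword_prod_append[OF relation.hyps(1) aq(1)] sword_prod_append[OF relation.hyps(1) aq(2)] sp
    by simp
  moreover have "crossings (p @ a @ q) x = crossings (p @ a' @ q) x" if x: "x \<in> carrier W" for x
    using crossings_append[OF relation.hyps(1) aq(1) x] crossings_append[OF relation.hyps(1) aq(2) x] cn
      sword_prod_closed[OF relation.hyps(1)] x by simp
  ultimately show ?case by blast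
qed auto

text \<open>
  The elements \<open>cj u s\<close> are the cover reflections of \<open>u\<close>, so the second condition says that the
  parabolic subgroup they generate is contained in the one of \<open>w\<close>.
\<close>

definition refl_le :: "'w \<Rightarrow> 'w \<Rightarrow> bool" where
  "refl_le u w \<longleftrightarrow> Inv u \<subseteq> Inv w \<and>
     (\<forall>s\<in>des W S u. cj (inv w) (cj u s) \<in> generate W (des W S w))"

lemma des_sub: "des W S w \<subseteq> S"
  unfolding des_def by blast

lemma des_Inv: "\<lbrakk>w \<in> carrier W; s \<in> des W S w\<rbrakk> \<Longrightarrow> cj w s \<in> Inv w"
  using des_iff by blast

section \<open>The braid order between snapshots\<close>

lemma Snap_word:
  assumes w: "w \<in> carrier W"
  obtains ss where "ss \<in> lists S" "Snap W S w = braid_class W S (pos ss)"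
    "\<forall>t\<in>carrier W. crossings (pos ss) t = (if t \<in> Inv w then 1 else 0)
        + (if cj (inv w) t \<in> T \<inter> generate W (des W S w) then 1 else 0)"
proof -
  let ?l = "longest W S (des W S w)"
  have l: "?l \<in> carrier W" using des_sub by simp
  obtain a where a: "a \<in> lists S" "lift W S w = braid_class W S (pos a)" "word_prod W a = w"
    "length a = card (Inv w)" by (rule reduced_word_obtain[OF w])
  obtain c where c: "c \<in> lists S" "lift W S ?l = braid_class W S (pos c)" "word_prod W c = ?l"
    "length c = card (Inv ?l)" by (rule reduced_word_obtain[OF l])
  have "crossings (pos (a @ c)) t = (if t \<in> Inv w then 1 else 0)
        + (if cj (inv w) t \<in> T \<inter> generate W (des W S w) then 1 else 0)" if t: "t \<in> carrier W" for t
  proof -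
    have "crossings (pos (a @ c)) t = crossings (pos a) t + crossings (pos c) (cj (inv w) t)"
      using crossings_append[of "pos a" "pos c" t] a c t by (simp add: sword_prod_pos)
    moreover have "crossings (pos a) t = (if t \<in> Inv w then 1 else 0)"
      using crossings_reduced[of a t] a t by simp
    moreover have "crossings (pos c) (cj (inv w) t) = (if cj (inv w) t \<in> Inv ?l then 1 else 0)"
      using crossings_reduced[of c "cj (inv w) t"] c t w by simp
    ultimately show ?thesis unfolding longest_props(2)[OF des_sub] by simp
  qed
  moreover have "Snap W S w = braid_class W S (pos (a @ c))" unfolding Snap_def using a c by (simp add: braid_class_mult)
  moreover have "a @ c \<in> lists S" using a c by simp
  ultimately show ?thesis using that[of "a @ c"] by blast
qed

text \<open>A positive factor on the right can only increase crossing numbers. By \<open>par\<close>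
  the second indicator for \<open>w\<close> is supported on \<open>Inv w\<close>, so positive values
  detect inversions; the cover reflections of \<open>u\<close> have value 2 and must keep
  it.\<close>

lemma braid_le_imp_refl_le:
  assumes u: "u \<in> carrier W" and w: "w \<in> carrier W" and le: "braid_le W S (Snap W S u) (Snap W S w)"
  shows "refl_le u w"
proof -
  obtain a where a: "a \<in> lists S" "Snap W S u = braid_class W S (pos a)"
    and ca: "\<forall>t\<in>carrier W. crossings (pos a) t = (if t \<in> Inv u then 1 else 0)
        + (if cj (inv u) t \<in> T \<inter> generate W (des W S u) then 1 else 0)"
    by (rule Snap_word[OF u])
  obtain c where c: "c \<in> lists S" "Snap W S w = braid_class W S (pos c)"
    and cc: "\<forall>t\<in>carrier W. crossings (pos c) t = (if t \<in> Inv w then 1 else 0)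
        + (if cj (inv w) t \<in> T \<inter> generate W (des W S w) then 1 else 0)"
    by (rule Snap_word[OF w])
  note ca = bspec[OF ca] and cc = bspec[OF cc]
  obtain d where d: "d \<in> lists S" "braid_class W S (pos c) = braid_class W S (pos a) \<otimes>\<^bsub>braid_group W S\<^esub> braid_class W S (pos d)"
  proof -
    obtain x where "x \<in> pos_braids W S" "Snap W S w = Snap W S u \<otimes>\<^bsub>braid_group W S\<^esub> x"
      using le unfolding braid_le_def by blast
    then show ?thesis using that a(2) c(2) unfolding pos_braids_iff by metis
  qed
  have "braid_class W S (pos c) = braid_class W S (pos a @ pos d)" using d a by (simp add: braid_class_mult)
  then have rel: "(pos c, pos a @ pos d) \<in> pres_rel S (braid_relations W S)"
    using braid_class_eq_iff[of "pos c" S "pos a @ pos d" W] a c d by simp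
  have mono: "crossings (pos a) t \<le> crossings (pos c) t" if t: "t \<in> carrier W" for t
    using crossings_invariant[OF rel] crossings_append[of "pos a" "pos d" t] t a d
      crossings_pos_nonneg[of d "cj (inv (sword_prod W (pos a))) t"] by simp
  have par: "t \<in> Inv w" if "t \<in> T" "cj (inv w) t \<in> T \<inter> generate W (des W S w)" for t
    using coset_Inv[OF des_sub w des_Inv[OF w] that(2)] that(1) w T_carrier by simp
  have "Inv u \<subseteq> Inv w"
  proof
    fix t assume t: "t \<in> Inv u"
    then have tT: "t \<in> T" and tc: "t \<in> carrier W" using Inv_sub_T T_carrier by blast+
    have "1 \<le> crossings (pos c) t" using mono[OF tc] ca[OF tc] t by (simp split: if_splits)
    then show "t \<in> Inv w" using cc[OF tc] par[OF tT] by (simp split: if_splits)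
  qed
  moreover have "cj (inv w) (cj u s) \<in> generate W (des W S w)" if s: "s \<in> des W S u" for s
  proof -
    have sT: "s \<in> T" and sc: "s \<in> carrier W" using s des_sub S_wall(1) S_carrier by blast+
    have tc: "cj u s \<in> carrier W" using u sc by simp
    have "crossings (pos a) (cj u s) = 2"
      using ca[OF tc] des_Inv[OF u s] sT u sc generate.incl[OF s] by simp
    then have "2 \<le> crossings (pos c) (cj u s)" using mono[OF tc] by simp
    then show ?thesis using cc[OF tc] by (simp split: if_splits)
  qed
  ultimately show ?thesis unfolding refl_le_def by blast
qed

lemma refl_le_imp_braid_le:
  assumes u: "u \<in> carrier W" and w: "w \<in> carrier W" and le: "refl_le u w"
  shows "braid_le W S (Snap W S u) (Snap W S w)"
proof -
  interpret BG: group "braid_group W S" by (rule group_braid_group)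
  let ?D = "des W S u" and ?E = "des W S w"
  let ?d = "longest W S ?D" and ?e = "longest W S ?E"
  note D = des_sub[of u] and E = des_sub[of w]
  have sub: "Inv u \<subseteq> Inv w" and par: "\<And>s. s \<in> ?D \<Longrightarrow> cj (inv w) (cj u s) \<in> generate W ?E"
    using le unfolding refl_le_def by blast+
  define v where "v = inv u \<otimes> w"
  have v: "v \<in> carrier W" and uv: "u \<otimes> v = w" unfolding v_def using u w by (auto simp flip: m_assoc)
  have luv: "card (Inv (u \<otimes> v)) = card (Inv u) + card (Inv v)"
    using len_add_iff[OF u v] sub unfolding uv by blast
  \<comment> \<open>A shortest element of the coset of \<open>v\<close> gives the factorisation
    \<open>v = v1 \<otimes> x\<close> with no descent of \<open>v1\<close> among those of
    \<open>w\<close>.\<close>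
  obtain x0 where x0: "x0 \<in> generate W ?E"
    and least: "\<And>x. x \<in> generate W ?E \<Longrightarrow> card (Inv (v \<otimes> x0)) \<le> card (Inv (v \<otimes> x))"
    using ex_has_least_nat[of "\<lambda>x. x \<in> generate W ?E" \<one> "\<lambda>x. card (Inv (v \<otimes> x))"] generate.one by blast
  define v1 where "v1 = v \<otimes> x0"
  define x where "x = inv x0"
  have x0c: "x0 \<in> carrier W" by (rule gen_closed[OF E x0])
  have xE: "x \<in> generate W ?E" and xc: "x \<in> carrier W" and v1: "v1 \<in> carrier W"
    unfolding x_def v1_def using gen_inv[OF E x0] x0c v by auto
  have vx: "v = v1 \<otimes> x" unfolding v1_def x_def using v x0c by (simp add: m_assoc)
  have nd: "cj v1 s \<notin> Inv v1" if s: "s \<in> ?E" for s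
  proof
    assume c: "cj v1 s \<in> Inv v1"
    have sS: "s \<in> S" using s E by blast
    have "x0 \<otimes> s \<in> generate W ?E" using x0 s by (intro generate.eng) (auto intro: generate.incl)
    from least[OF this] have "card (Inv v1) \<le> card (Inv (v1 \<otimes> s))"
      unfolding v1_def using v x0c S_carrier[OF sS] by (simp add: m_assoc)
    then show False
      unfolding Inv_mult_simple(1)[OF v1 sS c] using card_Diff1_less[OF finite_Inv c] by simp
  qed
  have lvx: "card (Inv (v1 \<otimes> x)) = card (Inv v1) + card (Inv x)"
    by (rule len_add_parabolic[OF E v1 nd xE])
  \<comment> \<open>\<open>cj u s\<close> is inverted by \<open>u\<close> and still by
    \<open>w\<close>, so \<open>v\<close> does not invert \<open>s\<close>, and neither does its
    prefix \<open>v1\<close>. Thus \<open>v1\<close> is minimal on both sides with respect to the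
    two parabolic subgroups.\<close>
  have nd': "cj (inv v1) s \<notin> Inv (inv v1)" if s: "s \<in> ?D" for s
  proof -
    have sT: "s \<in> T" using s D S_wall(1) by blast
    have "cj u s \<in> Inv (u \<otimes> v)" using des_Inv[OF u s] sub uv by blast
    then have "s \<notin> Inv v"
      using Inv_mult[OF u v, of "cj u s"] des_Inv[OF u s] u sT T_carrier by simp
    then have "s \<notin> Inv v1" using len_add_iff[OF v1 xc] lvx vx by blast
    then show ?thesis using Inv_inv_iff[of "inv v1" s] v1 sT by simp
  qed
  have gens: "cj (inv v1) s \<in> generate W ?E" if s: "s \<in> ?D" for s
  proof -
    have sc: "s \<in> carrier W" using s D S_carrier by blast
    have "inv v1 = x \<otimes> inv v" unfolding v1_def x_def using v x0c by (simp add: inv_mult_group)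
    moreover have "inv v = inv w \<otimes> u" unfolding v_def using u w by (simp add: inv_mult_group)
    ultimately have "cj (inv v1) s = cj x (cj (inv w) (cj u s))" using u w xc sc by simp
    then show ?thesis using gen_cj[OF E xE par[OF s]] by simp
  qed
  have gens': "cj (inv v1) (word_prod W ss) \<in> generate W ?E" if "ss \<in> lists ?D" for ss
    using that
  proof (induction ss rule: list.induct)
    case Nil
    then show ?case using v1 by (simp add: cj_def generate.one)
  next
    case (Cons s ss)
    then have s: "s \<in> ?D" and ss: "ss \<in> lists ?D" by auto
    have "s \<in> carrier W" using s D S_carrier by blast
    then have "cj (inv v1) (word_prod W (s # ss)) = cj (inv v1) s \<otimes> cj (inv v1) (word_prod W ss)"
      using cj_mult_distrib[OF inv_closed[OF v1] _ word_closed[OF ss D]] by simp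
    then show ?case using gen_mult[OF E gens[OF s] Cons.IH[OF ss]] by simp
  qed
  \<comment> \<open>Minimality on both sides makes lengths additive in each factorisation of
    \<open>?d \<otimes> v1 = v1 \<otimes> k\<close>, so the conjugation lifts to an identity of
    positive braids.\<close>
  define k where "k = cj (inv v1) ?d"
  have d: "?d \<in> carrier W" "?d \<in> generate W ?D" and e: "?e \<in> carrier W" "?e \<in> generate W ?E"
    using longest_props(1) D E by auto
  have kE: "k \<in> generate W ?E"
  proof -
    obtain ss where "ss \<in> lists ?D" "word_prod W ss = ?d" using gen_word[OF D d(2)] by blast
    then show ?thesis using gens'[of ss] unfolding k_def by simp
  qed
  have kc: "k \<in> carrier W" by (rule gen_closed[OF E kE])
  have dv: "?d \<otimes> v1 = v1 \<otimes> k" unfolding k_def cj_def using d v1 by (simp flip: m_assoc)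
  have "card (Inv (inv v1 \<otimes> inv ?d)) = card (Inv (inv v1)) + card (Inv (inv ?d))"
    by (rule len_add_parabolic[OF D inv_closed[OF v1] nd' gen_inv[OF D d(2)]])
  moreover have "inv v1 \<otimes> inv ?d = inv (?d \<otimes> v1)" using d v1 by (simp add: inv_mult_group)
  ultimately have "card (Inv (?d \<otimes> v1)) = card (Inv ?d) + card (Inv v1)"
    using card_Inv_inv[of "?d \<otimes> v1"] card_Inv_inv[OF v1] card_Inv_inv[OF d(1)] d v1 by simp
  then have l1: "lift W S (?d \<otimes> v1) = lift W S ?d \<otimes>\<^bsub>braid_group W S\<^esub> lift W S v1"
    by (rule lift_mult[OF d(1) v1])
  have l2: "lift W S (v1 \<otimes> k) = lift W S v1 \<otimes>\<^bsub>braid_group W S\<^esub> lift W S k"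
    by (rule lift_mult[OF v1 kc len_add_parabolic[OF E v1 nd kE]])
  have split: "lift W S ?e = lift W S g \<otimes>\<^bsub>braid_group W S\<^esub> lift W S (inv g \<otimes> ?e)"
    if g: "g \<in> generate W ?E" for g
  proof -
    have gc: "g \<in> carrier W" by (rule gen_closed[OF E g])
    have eq: "g \<otimes> (inv g \<otimes> ?e) = ?e" using gc e by (simp flip: m_assoc)
    have "card (Inv (g \<otimes> (inv g \<otimes> ?e))) = card (Inv g) + card (Inv (inv g \<otimes> ?e))"
      unfolding eq by (rule longest_len(1)[OF E g])
    from lift_mult[OF gc _ this] show ?thesis unfolding eq using gc e by simp
  qed
  \<comment> \<open>Garside's commutation rule: the lift of \<open>?e\<close> equals the product of
    the lifts of \<open>x\<close> and \<open>y\<close> and also of \<open>y\<close> and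
    \<open>x'\<close>. Hence \<open>x\<close> can be moved from the left of it to the right,
    becoming \<open>x'\<close>.\<close>
  define y where "y = inv x \<otimes> ?e"
  define x' where "x' = inv y \<otimes> ?e"
  define z where "z = inv k \<otimes> ?e"
  have yE: "y \<in> generate W ?E" unfolding y_def by (rule gen_mult[OF E gen_inv[OF E xE] e(2)])
  have c: "y \<in> carrier W" "x' \<in> carrier W" "z \<in> carrier W"
    unfolding x'_def z_def using gen_closed[OF E yE] kc e by auto
  note cl = pos_braids_carrier[OF lift_pos]
  let ?L = "lift W S"
  have s1: "?L ?e = ?L x \<otimes>\<^bsub>braid_group W S\<^esub> ?L y" unfolding y_def by (rule split[OF xE])
  have s2: "?L ?e = ?L y \<otimes>\<^bsub>braid_group W S\<^esub> ?L x'" unfolding x'_def by (rule split[OF yE])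
  have s3: "?L ?e = ?L k \<otimes>\<^bsub>braid_group W S\<^esub> ?L z" unfolding z_def by (rule split[OF kE])
  have comm: "?L x \<otimes>\<^bsub>braid_group W S\<^esub> ?L ?e = ?L ?e \<otimes>\<^bsub>braid_group W S\<^esub> ?L x'"
  proof -
    have "?L x \<otimes>\<^bsub>braid_group W S\<^esub> ?L ?e = ?L x \<otimes>\<^bsub>braid_group W S\<^esub> (?L y \<otimes>\<^bsub>braid_group W S\<^esub> ?L x')"
      using s2 by simp
    also have "\<dots> = (?L x \<otimes>\<^bsub>braid_group W S\<^esub> ?L y) \<otimes>\<^bsub>braid_group W S\<^esub> ?L x'"
      using cl xc c by (simp add: BG.m_assoc)
    finally show ?thesis using s1 by simp
  qed
  have "Snap W S w = ?L (u \<otimes> v) \<otimes>\<^bsub>braid_group W S\<^esub> ?L ?e" unfolding Snap_def uv ..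
  also have "\<dots> = ?L u \<otimes>\<^bsub>braid_group W S\<^esub> (?L v1 \<otimes>\<^bsub>braid_group W S\<^esub> ?L x) \<otimes>\<^bsub>braid_group W S\<^esub> ?L ?e"
    using lift_mult[OF u v luv] lift_mult[OF v1 xc lvx] vx by simp
  also have "\<dots> = ?L u \<otimes>\<^bsub>braid_group W S\<^esub> (?L v1 \<otimes>\<^bsub>braid_group W S\<^esub> (?L x \<otimes>\<^bsub>braid_group W S\<^esub> ?L ?e))"
    using cl u v1 xc e by (simp add: BG.m_assoc)
  also have "\<dots> = ?L u \<otimes>\<^bsub>braid_group W S\<^esub> (?L v1 \<otimes>\<^bsub>braid_group W S\<^esub> (?L k \<otimes>\<^bsub>braid_group W S\<^esub> ?L z \<otimes>\<^bsub>braid_group W S\<^esub> ?L x'))"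
    unfolding comm using s3 by simp
  also have "\<dots> = ?L u \<otimes>\<^bsub>braid_group W S\<^esub> ((?L v1 \<otimes>\<^bsub>braid_group W S\<^esub> ?L k) \<otimes>\<^bsub>braid_group W S\<^esub> (?L z \<otimes>\<^bsub>braid_group W S\<^esub> ?L x'))"
    using cl v1 kc c by (simp add: BG.m_assoc)
  also have "?L v1 \<otimes>\<^bsub>braid_group W S\<^esub> ?L k = ?L ?d \<otimes>\<^bsub>braid_group W S\<^esub> ?L v1"
    using l1 l2 dv by simp
  also have "?L u \<otimes>\<^bsub>braid_group W S\<^esub> ((?L ?d \<otimes>\<^bsub>braid_group W S\<^esub> ?L v1) \<otimes>\<^bsub>braid_group W S\<^esub> (?L z \<otimes>\<^bsub>braid_group W S\<^esub> ?L x'))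
      = Snap W S u \<otimes>\<^bsub>braid_group W S\<^esub> (?L v1 \<otimes>\<^bsub>braid_group W S\<^esub> (?L z \<otimes>\<^bsub>braid_group W S\<^esub> ?L x'))"
    unfolding Snap_def using cl u d v1 c by (simp add: BG.m_assoc)
  finally show ?thesis
    unfolding braid_le_def by (rule bexI) (intro pos_braids_mult lift_pos v1 c)
qed

lemma braid_le_iff:
  "\<lbrakk>u \<in> carrier W; w \<in> carrier W\<rbrakk> \<Longrightarrow> braid_le W S (Snap W S u) (Snap W S w) \<longleftrightarrow> refl_le u w"
  using braid_le_imp_refl_le refl_le_imp_braid_le by blast

text \<open>Equal snapshots turn reflexivity of \<open>refl_le\<close> into comparability both ways,
  and \<open>Inv\<close> determines the element.\<close>

lemma Snap_inj: "inj_on (Snap W S) (carrier W)"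
proof (rule inj_onI)
  fix u w assume u: "u \<in> carrier W" and w: "w \<in> carrier W" and eq: "Snap W S u = Snap W S w"
  have "refl_le u u" "refl_le w w"
    unfolding refl_le_def using u w des_sub S_carrier by (auto simp: subset_iff intro: generate.incl)
  then have "braid_le W S (Snap W S u) (Snap W S u)" "braid_le W S (Snap W S w) (Snap W S w)"
    using braid_le_iff u w by auto
  then have "refl_le u w" "refl_le w u"
    using braid_le_iff[OF u w] braid_le_iff[OF w u] unfolding eq by blast+
  then show "u = w" unfolding refl_le_def using Inv_inj u w by blast
qed

text \<open>The longest element has all of \<open>S\<close> as descents, so its snapshot is the
  square of \<open>Delta W S\<close>; being largest for \<open>refl_le\<close>, it yields the upper
  bound through \<open>braid_le_iff\<close>.\<close>

lemma Snap_interval: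
  assumes w: "w \<in> carrier W"
  shows "Snap W S w \<in> braid_interval W S \<one>\<^bsub>braid_group W S\<^esub>
    (Delta W S \<otimes>\<^bsub>braid_group W S\<^esub> Delta W S)"
proof -
  interpret BG: group "braid_group W S" by (rule group_braid_group)
  let ?l = "longest W S S"
  have l: "?l \<in> carrier W" by simp
  have I: "Inv ?l = T" using longest_props(2)[of S] gen T_carrier by auto
  have des: "des W S ?l = S" using des_iff[OF l] I S_wall(1) l by auto
  have top: "Snap W S ?l = Delta W S \<otimes>\<^bsub>braid_group W S\<^esub> Delta W S"
    unfolding Snap_def Delta_def des ..
  have "cj (inv ?l) (cj w s) \<in> carrier W" if "s \<in> des W S w" for s
    using that des_sub S_carrier w l by (intro cj_carrier inv_closed) blast+
  then have "refl_le w ?l"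
    unfolding refl_le_def des gen I using Inv_sub_T by blast
  then have "braid_le W S (Snap W S w) (Delta W S \<otimes>\<^bsub>braid_group W S\<^esub> Delta W S)"
    using braid_le_iff[OF w l] top by simp
  moreover have s: "Snap W S w \<in> pos_braids W S"
    unfolding Snap_def using lift_pos pos_braids_mult w des_sub by simp
  moreover have "braid_le W S \<one>\<^bsub>braid_group W S\<^esub> (Snap W S w)"
    unfolding braid_le_def using s pos_braids_carrier[OF s] by (intro bexI[of _ "Snap W S w"]) auto
  ultimately show ?thesis unfolding braid_interval_def by blast
qed

end

section \<open>Shards\<close>

context coxeter_reflections
begin

section \<open>Rank-two subarrangements and cuts\<close>

lemma not_parallel:
  assumes "t \<in> T" "t' \<in> T" "t \<noteq> t'"
  shows "unormal t' \<noteq> c *\<^sub>R unormal t"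
proof
  assume eq: "unormal t' = c *\<^sub>R unormal t"
  then have "\<bar>c\<bar> = 1" using unormal(1)[OF assms(1)] unormal(1)[OF assms(2)] by simp
  moreover have "0 < c * (unormal t \<bullet> b)" using unormal(2)[OF assms(2)] eq by simp
  then have "0 < c" using unormal(2)[OF assms(1)] by (rule zero_less_mult_pos2)
  ultimately have "unormal t = unormal t'" using eq by simp
  then show False using unormal_inj assms by blast
qed

lemma dim_hyp_Int:
  assumes "t \<in> T" "t' \<in> T" "t \<noteq> t'"
  shows "dim (hyp t \<inter> hyp t') + 2 = DIM('a)"
proof -
  let ?A = "span {unormal t', unormal t}"
  have "dim {unormal t', unormal t} = 2"
  proof -
    have "unormal t' \<notin> span {unormal t}" using not_parallel[OF assms] by (auto simp: span_singleton)
    then show ?thesis using unormal_nonzero[OF assms(1)] by (simp add: dim_insert)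
  qed
  moreover have "{y \<in> UNIV. \<forall>x\<in>?A. orthogonal x y} = hyp t \<inter> hyp t'"
  proof (intro Set.set_eqI iffI)
    fix y assume "y \<in> {y \<in> UNIV. \<forall>x\<in>?A. orthogonal x y}"
    then have "orthogonal (unormal t) y" "orthogonal (unormal t') y" by (auto intro: span_base)
    then show "y \<in> hyp t \<inter> hyp t'" unfolding hyp_def orthogonal_def by blast
  next
    fix y assume "y \<in> hyp t \<inter> hyp t'"
    then have "orthogonal y a" if "a \<in> {unormal t', unormal t}" for a
      using that unfolding hyp_def orthogonal_def by (auto simp: inner_commute)
    then have "orthogonal y x" if "x \<in> ?A" for x using orthogonal_to_span[OF that] by blast
    then show "y \<in> {y \<in> UNIV. \<forall>x\<in>?A. orthogonal x y}" by (auto simp: orthogonal_commute)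
  qed
  ultimately show ?thesis
    using dim_subspace_orthogonal_to_vectors[of ?A UNIV] by simp
qed

lemma unormal_span:
  assumes "hyp t \<inter> hyp t' \<subseteq> hyp u"
  shows "\<exists>c d. unormal u = c *\<^sub>R unormal t' + d *\<^sub>R unormal t"
proof -
  obtain y z where y: "y \<in> span {unormal t', unormal t}" and z: "\<And>w. w \<in> span {unormal t', unormal t} \<Longrightarrow> orthogonal z w"
    and eq: "unormal u = y + z"
    using orthogonal_subspace_decomp_exists[of "{unormal t', unormal t}" "unormal u"] by blast
  have "orthogonal z (unormal t)" "orthogonal z (unormal t')" by (rule z, simp add: span_base)+
  then have "z \<in> hyp t \<inter> hyp t'" unfolding hyp_def orthogonal_def by (simp add: inner_commute)
  then have "unormal u \<bullet> z = 0" using assms unfolding hyp_def by blast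
  moreover have "y \<bullet> z = 0" using z[OF y] unfolding orthogonal_def by (simp add: inner_commute)
  ultimately have "z \<bullet> z = 0" unfolding eq by (simp add: inner_add_left)
  then have "unormal u = y" using eq by simp
  moreover obtain c where "y - c *\<^sub>R unormal t' \<in> span {unormal t}" using y unfolding span_breakdown_eq[of y "unormal t'"] by blast
  then obtain d where "y - c *\<^sub>R unormal t' = d *\<^sub>R unormal t" unfolding span_singleton by blast
  ultimately show ?thesis by (metis diff_add_cancel add.commute)
qed

lemma subspace_hyp: "subspace (hyp t)"
  unfolding hyp_def by (rule subspace_hyperplane)

text \<open>In rank two a non-basic normal lies strictly between others. Failure of the wall
  criterion for \<open>t\<close> yields a mirror \<open>u\<close> on the far side from
  \<open>t'\<close>, and the linear relation between the three normals is solved for that of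
  \<open>t\<close>.\<close>

lemma cut_decomposition:
  assumes t: "t \<in> T" and t': "t' \<in> T" and cut: "cuts (hyp ` T) B (hyp t') (hyp t)"
  shows "t' \<noteq> t"
    "\<exists>u\<in>T. \<exists>c d. 0 < c \<and> 0 < d \<and> unormal t = c *\<^sub>R unormal t' + d *\<^sub>R unormal u"
proof -
  obtain \<A> where full: "full_rank2_subarrangement (hyp ` T) \<A>" and mem: "hyp t' \<in> \<A>" "hyp t \<in> \<A>"
    and basic: "basic \<A> B (hyp t')" "\<not> basic \<A> B (hyp t)"
    using cut unfolding cuts_def by blast
  show ne: "t' \<noteq> t" using basic by blast
  obtain L where L: "subspace L" "dim L + 2 = DIM('a)" and A_L: "\<A> = {H \<in> hyp ` T. L \<subseteq> H}"
    using full unfolding full_rank2_subarrangement_def by blast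
  let ?A = "{u \<in> T. L \<subseteq> hyp u}"
  have A: "\<A> = hyp ` ?A" unfolding A_L by blast
  have tA: "t \<in> ?A" "t' \<in> ?A" using mem t t' unfolding A_L by blast+
  have "L = hyp t \<inter> hyp t'"
    by (rule subspace_dim_equal[OF L(1) subspace_inter[OF subspace_hyp subspace_hyp]])
      (use tA L(2) dim_hyp_Int[OF t t'] ne in auto)
  \<comment> \<open>The projection of the normal of \<open>t'\<close> to the mirror of
    \<open>t\<close>. If every other mirror of the subarrangement were positive at \<open>p\<close>,
    then \<open>p\<close> would show \<open>t\<close> to be basic.\<close>
  define p where "p = unormal t' - (unormal t \<bullet> unormal t') *\<^sub>R unormal t"
  have tp: "unormal t \<bullet> p = 0" unfolding p_def using unormal_inner_self[OF t] by (simp add: inner_diff_right)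
  have "p \<noteq> 0" unfolding p_def using not_parallel[OF t t'] ne by auto
  moreover have "unormal t' \<bullet> p = p \<bullet> p"
  proof -
    have "unormal t' = p + (unormal t \<bullet> unormal t') *\<^sub>R unormal t" unfolding p_def by simp
    then have "unormal t' \<bullet> p = p \<bullet> p + (unormal t \<bullet> unormal t') * (unormal t \<bullet> p)"
      by (metis inner_add_left inner_scaleR_left)
    then show ?thesis using tp by simp
  qed
  ultimately have t'p: "0 < unormal t' \<bullet> p" by simp
  have "\<not> (\<forall>u\<in>?A - {t}. 0 < unormal u \<bullet> p)"
    using basic(2) basic_iff[of ?A t] t tA(1) tp unfolding A by blast
  then obtain u where u: "u \<in> T" "L \<subseteq> hyp u" "u \<noteq> t" "unormal u \<bullet> p \<le> 0" by (auto simp: not_less)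
  obtain c d where cd: "unormal u = c *\<^sub>R unormal t' + d *\<^sub>R unormal t"
    using unormal_span[of t t' u] u(2) \<open>L = hyp t \<inter> hyp t'\<close> by blast
  have "c * (unormal t' \<bullet> p) \<le> 0" using u(4) tp unfolding cd by (simp add: inner_add_left)
  then have "c \<le> 0" using t'p by (simp add: mult_le_0_iff)
  moreover have "c \<noteq> 0" using cd not_parallel[of t u d] t u(1,3) by auto
  ultimately have c: "c < 0" by simp
  have "0 < c * (unormal t' \<bullet> b) + d * (unormal t \<bullet> b)"
    using unormal(2)[OF u(1)] unfolding cd by (simp add: inner_add_left)
  moreover have "c * (unormal t' \<bullet> b) < 0" using c unormal(2)[OF t'] by (rule mult_neg_pos)
  ultimately have "0 < d * (unormal t \<bullet> b)" by linarith
  then have d: "0 < d" using unormal(2)[OF t] by (rule zero_less_mult_pos2)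
  have "d *\<^sub>R unormal t = unormal u - c *\<^sub>R unormal t'" using cd by simp
  then have "(1 / d) *\<^sub>R (d *\<^sub>R unormal t) = (1 / d) *\<^sub>R (unormal u - c *\<^sub>R unormal t')" by simp
  then have "unormal t = (- c / d) *\<^sub>R unormal t' + (1 / d) *\<^sub>R unormal u"
    using d by (simp add: scaleR_diff_right divide_inverse mult.commute)
  moreover have "0 < - c / d" "0 < 1 / d" using c d by (auto simp: divide_less_0_iff)
  ultimately show "\<exists>u\<in>T. \<exists>c d. 0 < c \<and> 0 < d \<and> unormal t = c *\<^sub>R unormal t' + d *\<^sub>R unormal u"
    using u(1) by blast
qed

text \<open>All mirrors of the rank-two subarrangement spanned by \<open>t\<close> and
  \<open>t'\<close> pass through \<open>z\<close>. If \<open>t\<close> were not basic there, a basic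
  one would cut it at \<open>z\<close>; so \<open>t\<close> is basic, and the corresponding
  reflection does not move \<open>b\<close> across \<open>t'\<close>.\<close>

lemma uncut_not_separated:
  assumes t: "t \<in> T" and t': "t' \<in> T" "t' \<noteq> t" and z: "z \<in> hyp t" "z \<in> hyp t'"
    and uncut: "\<And>u. \<lbrakk>u \<in> T; cuts (hyp ` T) B (hyp u) (hyp t)\<rbrakk> \<Longrightarrow> z \<notin> hyp u"
  shows "0 < unormal t' \<bullet> \<rho> t b"
proof -
  let ?L = "hyp t \<inter> hyp t'"
  let ?A = "{u \<in> T. ?L \<subseteq> hyp u}"
  have A: "?A \<subseteq> T" and tA: "t \<in> ?A" "t' \<in> ?A" using t t' by auto
  have "hyp t \<noteq> hyp t'" using hyp_inj t t' by blast
  moreover have "{H \<in> hyp ` T. ?L \<subseteq> H} = hyp ` ?A" by blast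
  ultimately have full: "full_rank2_subarrangement (hyp ` T) (hyp ` ?A)"
    unfolding full_rank2_subarrangement_def
    using dim_hyp_Int[OF t t'(1)] t'(2) subspace_inter[OF subspace_hyp[of t] subspace_hyp[of t']] tA by blast
  \<comment> \<open>\<open>unormal u \<bullet> b\<close> is the distance from \<open>b\<close> to
    the mirror of \<open>u\<close>. The foot of the perpendicular to a nearest mirror is strictly
    positive on all others, as distinct unit normals have inner product below 1; so
    \<open>t1\<close> is basic.\<close>
  obtain t1 where t1: "t1 \<in> ?A" and least: "\<And>u. u \<in> ?A \<Longrightarrow> unormal t1 \<bullet> b \<le> unormal u \<bullet> b"
  proof -
    have fin: "finite ((\<lambda>u. unormal u \<bullet> b) ` ?A)" using finite_T by simp
    have ne: "(\<lambda>u. unormal u \<bullet> b) ` ?A \<noteq> {}" using tA by blast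
    from Min_in[OF fin ne] obtain t1 where "t1 \<in> ?A" "Min ((\<lambda>u. unormal u \<bullet> b) ` ?A) = unormal t1 \<bullet> b" by blast
    moreover from this have "unormal t1 \<bullet> b \<le> unormal u \<bullet> b" if "u \<in> ?A" for u
      using Min_le[OF fin imageI[OF that]] by simp
    ultimately show ?thesis using that by blast
  qed
  have t1T: "t1 \<in> T" using t1 by blast
  let ?p = "b - (unormal t1 \<bullet> b) *\<^sub>R unormal t1"
  have "unormal t1 \<bullet> ?p = 0" using unormal_inner_self[OF t1T] by (simp add: inner_diff_right)
  moreover have "0 < unormal u \<bullet> ?p" if u: "u \<in> ?A - {t1}" for u
  proof -
    have "(unormal t1 \<bullet> b) * (unormal u \<bullet> unormal t1) < (unormal t1 \<bullet> b) * 1"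
      using inner_unormal_less_1[of u t1] unormal(2)[OF t1T] u t1T by (intro mult_strict_left_mono) auto
    then have "(unormal t1 \<bullet> b) * (unormal u \<bullet> unormal t1) < unormal u \<bullet> b" using least[of u] u by auto
    then show ?thesis by (simp add: inner_diff_right)
  qed
  ultimately have b1: "basic (hyp ` ?A) B (hyp t1)" using basic_iff[OF A t1T] t1 by blast
  have "basic (hyp ` ?A) B (hyp t)"
  proof (rule ccontr)
    assume "\<not> ?thesis"
    then have "cuts (hyp ` T) B (hyp t1) (hyp t)"
      unfolding cuts_def using full b1 t1 tA by blast
    then show False using uncut[OF t1T] t1 z by blast
  qed
  then obtain p where p: "unormal t \<bullet> p = 0" "\<forall>u\<in>?A - {t}. 0 < unormal u \<bullet> p"
    using basic_iff[OF A t] by blast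
  have stable: "cj t u \<in> ?A" if u: "u \<in> ?A" for u
  proof -
    have uT: "u \<in> T" and tc: "t \<in> carrier W" using u t T_carrier by auto
    have "x \<in> hyp (cj t u)" if x: "x \<in> ?L" for x
    proof -
      have "\<rho> t x = x" using x t by (simp add: rho_T hyp_def)
      then show ?thesis using unormal_cj_zero[OF tc uT, of x] u x unfolding hyp_def by auto
    qed
    then show ?thesis using tc uT by auto
  qed
  show ?thesis by (rule wall_not_separated[OF A tA(1) stable p]) (use tA t' in auto)
qed

section \<open>Shards as cones of signs\<close>

definition cutters :: "'w \<Rightarrow> 'w set" where
  "cutters t = {u \<in> T. cuts (hyp ` T) B (hyp u) (hyp t)}"

text \<open>The point \<open>p\<close> only supplies signs on the cutting mirrors and may lie off
  the mirror of \<open>t\<close>; lower shards of \<open>w\<close> are taken at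
  \<open>p = \<rho> w b\<close>.\<close>

definition shard_at :: "'w \<Rightarrow> 'a \<Rightarrow> 'a set" where
  "shard_at t p = {x \<in> hyp t. \<forall>u\<in>cutters t. 0 \<le> (unormal u \<bullet> x) * (unormal u \<bullet> p)}"

definition shard_int :: "'w \<Rightarrow> 'a \<Rightarrow> 'a set" where
  "shard_int t p = {x \<in> hyp t. \<forall>u\<in>cutters t. 0 < (unormal u \<bullet> x) * (unormal u \<bullet> p)}"

lemma hyp_convex_closed: "convex (hyp t)" "closed (hyp t)"
  unfolding hyp_def by (auto simp: convex_hyperplane closed_hyperplane)

lemma closure_shard_int:
  assumes "p \<in> hyp t" "\<And>u. u \<in> cutters t \<Longrightarrow> unormal u \<bullet> p \<noteq> 0"
  shows "closure (shard_int t p) = shard_at t p"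
proof -
  have "a \<bullet> p \<noteq> 0" if "a \<in> unormal ` cutters t" for a using that assms(2) by blast
  from closure_sign_cell[OF hyp_convex_closed assms(1), of "unormal ` cutters t", OF this] show ?thesis
    unfolding shard_int_def shard_at_def by simp
qed

lemma shards_of_iff:
  assumes t: "t \<in> T"
  shows "\<Sigma> \<in> shards_of (hyp ` T) B (hyp t) \<longleftrightarrow>
    (\<exists>p\<in>hyp t. (\<forall>u\<in>cutters t. unormal u \<bullet> p \<noteq> 0) \<and> \<Sigma> = shard_at t p)"
proof -
  have eq: "hyp t - \<Union>{H' \<in> hyp ` T. cuts (hyp ` T) B H' (hyp t)}
      = hyp t - (\<Union>a\<in>unormal ` cutters t. {x. a \<bullet> x = 0})"
    unfolding cutters_def hyp_def by auto
  let ?X = "hyp t - (\<Union>a\<in>unormal ` cutters t. {x. a \<bullet> x = 0})"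
  have cell: "{x \<in> hyp t. \<forall>a\<in>unormal ` cutters t. 0 < (a \<bullet> x) * (a \<bullet> p)} = shard_int t p" for p
    unfolding shard_int_def by simp
  have comp: "C \<in> components ?X \<longleftrightarrow>
      (\<exists>p\<in>hyp t. (\<forall>u\<in>cutters t. unormal u \<bullet> p \<noteq> 0) \<and> C = shard_int t p)" for C
  proof
    assume C: "C \<in> components ?X"
    then obtain p where p: "p \<in> C" using in_components_nonempty by blast
    then have "p \<in> ?X" using C in_components_subset by blast
    then have "p \<in> hyp t" "\<forall>u\<in>cutters t. unormal u \<bullet> p \<noteq> 0" by auto
    moreover have "C = shard_int t p"
      using component_sign_cell[OF hyp_convex_closed(1) C p] unfolding cell .
    ultimately show "\<exists>p\<in>hyp t. (\<forall>u\<in>cutters t. unormal u \<bullet> p \<noteq> 0) \<and> C = shard_int t p" by blast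
  next
    assume "\<exists>p\<in>hyp t. (\<forall>u\<in>cutters t. unormal u \<bullet> p \<noteq> 0) \<and> C = shard_int t p"
    then obtain p where p: "p \<in> hyp t" "\<forall>u\<in>cutters t. unormal u \<bullet> p \<noteq> 0" and C: "C = shard_int t p" by blast
    show "C \<in> components ?X"
      using sign_cell_in_components[OF hyp_convex_closed(1) p(1), of "unormal ` cutters t"] p(2)
      unfolding cell C by blast
  qed
  show ?thesis
    unfolding shards_of_def eq
  proof
    assume "\<Sigma> \<in> closure ` components ?X"
    then obtain C where "C \<in> components ?X" "\<Sigma> = closure C" by blast
    then show "\<exists>p\<in>hyp t. (\<forall>u\<in>cutters t. unormal u \<bullet> p \<noteq> 0) \<and> \<Sigma> = shard_at t p"
      using comp closure_shard_int by metis
  next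
    assume "\<exists>p\<in>hyp t. (\<forall>u\<in>cutters t. unormal u \<bullet> p \<noteq> 0) \<and> \<Sigma> = shard_at t p"
    then obtain p where p: "p \<in> hyp t" "\<forall>u\<in>cutters t. unormal u \<bullet> p \<noteq> 0" "\<Sigma> = shard_at t p" by blast
    then have "shard_int t p \<in> components ?X" using comp by blast
    moreover have "\<Sigma> = closure (shard_int t p)" using p closure_shard_int by simp
    ultimately show "\<Sigma> \<in> closure ` components ?X" by blast
  qed
qed

lemma closure_region:
  assumes g: "g \<in> carrier W"
  shows "closure (\<rho> g ` B) = {x. \<forall>t\<in>T. 0 \<le> (unormal t \<bullet> x) * (unormal t \<bullet> \<rho> g b)}"
proof -
  have "\<rho> g ` B = {x \<in> UNIV. \<forall>a\<in>unormal ` T. 0 < (a \<bullet> x) * (a \<bullet> \<rho> g b)}"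
  proof (intro Set.set_eqI iffI)
    fix x assume "x \<in> \<rho> g ` B"
    then obtain y where y: "x = \<rho> g y" "\<And>t. t \<in> T \<Longrightarrow> 0 < unormal t \<bullet> y" unfolding B_eq by blast
    have "0 < (unormal t \<bullet> x) * (unormal t \<bullet> \<rho> g b)" if t: "t \<in> T" for t
    proof -
      let ?d = "cj (inv g) t"
      have d: "?d \<in> T" "cj g ?d = t" using t g T_carrier by auto
      show ?thesis
        using unormal_cj_same[OF g d(1), of y b] y(2)[OF d(1)] unormal(2)[OF d(1)] unfolding d(2) y(1) by simp
    qed
    then show "x \<in> {x \<in> UNIV. \<forall>a\<in>unormal ` T. 0 < (a \<bullet> x) * (a \<bullet> \<rho> g b)}" by blast
  next
    fix x assume x: "x \<in> {x \<in> UNIV. \<forall>a\<in>unormal ` T. 0 < (a \<bullet> x) * (a \<bullet> \<rho> g b)}"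
    have "0 < unormal d \<bullet> \<rho> (inv g) x" if d: "d \<in> T" for d
    proof -
      have "0 < (unormal (cj g d) \<bullet> x) * (unormal (cj g d) \<bullet> \<rho> g b)" using x d g by simp
      also have "\<dots> = (unormal d \<bullet> \<rho> (inv g) x) * (unormal d \<bullet> b)"
        using unormal_cj_same[OF g d, of "\<rho> (inv g) x" b] g by simp
      finally show ?thesis using unormal(2)[OF d] by (rule zero_less_mult_pos2)
    qed
    then have "\<rho> (inv g) x \<in> B" unfolding B_eq by blast
    moreover have "x = \<rho> g (\<rho> (inv g) x)" using g by simp
    ultimately show "x \<in> \<rho> g ` B" by blast
  qed
  moreover have "closure {x \<in> UNIV. \<forall>a\<in>unormal ` T. 0 < (a \<bullet> x) * (a \<bullet> \<rho> g b)}
      = {x \<in> UNIV. \<forall>a\<in>unormal ` T. 0 \<le> (a \<bullet> x) * (a \<bullet> \<rho> g b)}"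
    by (rule closure_sign_cell) (use regular[OF g] in auto)
  ultimately show ?thesis by simp
qed

lemma facet_point:
  assumes w: "w \<in> carrier W" and s: "s \<in> S" "cj w s \<in> Inv w"
  obtains p where "p \<in> hyp (cj w s)"
    "\<forall>t\<in>T - {cj w s}. 0 < (unormal t \<bullet> p) * (unormal t \<bullet> \<rho> w b)"
    "\<forall>t\<in>T - {cj w s}. 0 < (unormal t \<bullet> p) * (unormal t \<bullet> \<rho> (w \<otimes> s) b)"
proof
  let ?t = "cj w s" and ?u = "w \<otimes> s"
  have sc: "s \<in> carrier W" and tT: "?t \<in> T" using s S_carrier Inv_sub_T by auto
  have tc: "?t \<in> carrier W" by (rule T_carrier[OF tT])
  have u: "?u \<in> carrier W" using w sc by simp
  have I: "Inv ?u = Inv w - {?t}" by (rule Inv_mult_simple(1)[OF w s])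
  \<comment> \<open>Twice the midpoint of \<open>\<rho> w b\<close> and its mirror image. It lies on
    the mirror, and on every other mirror the two summands have the same sign.\<close>
  let ?p = "\<rho> w b + \<rho> ?u b"
  have "\<rho> ?u b = \<rho> ?t (\<rho> w b)" using cj_mult[OF w sc] rho_mult[OF tc w] by simp
  then show "?p \<in> hyp ?t" unfolding hyp_def using inner_rho_self[OF tT] by (simp add: inner_add_right)
  have "0 < (unormal t \<bullet> ?p) * (unormal t \<bullet> \<rho> w b) \<and> 0 < (unormal t \<bullet> ?p) * (unormal t \<bullet> \<rho> ?u b)"
    if t: "t \<in> T - {?t}" for t
  proof -
    have tT: "t \<in> T" using t by blast
    have "t \<in> Inv w \<longleftrightarrow> t \<in> Inv ?u" using I t by blast
    then have "unormal t \<bullet> \<rho> w b < 0 \<longleftrightarrow> unormal t \<bullet> \<rho> ?u b < 0" using tT unfolding Inv_def by blast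
    moreover note regular[OF w tT] regular[OF u tT]
    ultimately show ?thesis
      unfolding inner_add_right zero_less_mult_iff by linarith
  qed
  then show "\<forall>t\<in>T - {?t}. 0 < (unormal t \<bullet> ?p) * (unormal t \<bullet> \<rho> w b)"
    "\<forall>t\<in>T - {?t}. 0 < (unormal t \<bullet> ?p) * (unormal t \<bullet> \<rho> ?u b)" by blast+
qed

lemma pos_mult_trans:
  fixes x y z :: real
  shows "\<lbrakk>0 < y * z; 0 \<le> x * y\<rbrakk> \<Longrightarrow> 0 \<le> x * z" "\<lbrakk>0 < y * z; 0 < x * y\<rbrakk> \<Longrightarrow> 0 < x * z"
  by (auto simp: zero_less_mult_iff zero_le_mult_iff)

lemma shard_at_cong:
  assumes "\<And>u. u \<in> cutters t \<Longrightarrow> 0 < (unormal u \<bullet> p) * (unormal u \<bullet> q)"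
  shows "shard_at t p = shard_at t q"
proof -
  have "0 \<le> (unormal u \<bullet> x) * (unormal u \<bullet> p) \<longleftrightarrow> 0 \<le> (unormal u \<bullet> x) * (unormal u \<bullet> q)" if "u \<in> cutters t" for u x
    using pos_mult_trans(1)[of "unormal u \<bullet> p" "unormal u \<bullet> q" "unormal u \<bullet> x"]
      pos_mult_trans(1)[of "unormal u \<bullet> q" "unormal u \<bullet> p" "unormal u \<bullet> x"] assms[OF that] by (auto simp: mult.commute)
  then show ?thesis unfolding shard_at_def by blast
qed

lemma cutters_props:
  assumes "t \<in> T" "u \<in> cutters t"
  shows "u \<in> T" "u \<noteq> t"
  using assms cut_decomposition(1)[of t u] unfolding cutters_def by auto

text \<open>The facet contains a point on no mirror but that of \<open>cj w s\<close>. A shard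
  containing it must therefore belong to this mirror, and its signs on the cutting mirrors are those
  of the point, which makes the description unique.\<close>

lemma cover_shard_eq:
  assumes w: "w \<in> carrier W" and s: "s \<in> S" "cj w s \<in> Inv w"
  shows "cover_shard W \<rho> B (w \<otimes> s) w = shard_at (cj w s) (\<rho> w b)"
proof -
  let ?t = "cj w s" and ?u = "w \<otimes> s"
  have sc: "s \<in> carrier W" and tT: "?t \<in> T" using s S_carrier Inv_sub_T by auto
  have u: "?u \<in> carrier W" using w sc by simp
  have I: "Inv ?u = Inv w - {?t}" by (rule Inv_mult_simple(1)[OF w s])
  obtain p where p: "p \<in> hyp ?t"
    "\<forall>t\<in>T - {?t}. 0 < (unormal t \<bullet> p) * (unormal t \<bullet> \<rho> w b)"
    "\<forall>t\<in>T - {?t}. 0 < (unormal t \<bullet> p) * (unormal t \<bullet> \<rho> ?u b)"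
    by (rule facet_point[OF w s])
  have pc: "0 < (unormal c \<bullet> p) * (unormal c \<bullet> \<rho> w b)" if "c \<in> cutters ?t" for c
    using p(2) cutters_props[OF tT that] by blast
  have p_ne: "unormal c \<bullet> p \<noteq> 0" if "c \<in> cutters ?t" for c
    using pc[OF that] by auto
  have sh: "shard_at ?t p = shard_at ?t (\<rho> w b)" by (rule shard_at_cong) (rule pc)
  let ?F = "closure (\<rho> ?u ` B) \<inter> closure (\<rho> w ` B)"
  have pF: "p \<in> ?F"
  proof -
    have "0 \<le> (unormal t \<bullet> p) * (unormal t \<bullet> \<rho> w b) \<and> 0 \<le> (unormal t \<bullet> p) * (unormal t \<bullet> \<rho> ?u b)" if t: "t \<in> T" for t
    proof (cases "t = ?t")
      case True
      then show ?thesis using p(1) by (simp add: hyp_def)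
    next
      case False
      then show ?thesis using p(2,3) t by (simp add: less_imp_le)
    qed
    then show ?thesis unfolding closure_region[OF w] closure_region[OF u] by blast
  qed
  have F_sub: "?F \<subseteq> shard_at ?t p"
  proof
    fix x assume x: "x \<in> ?F"
    then have x1: "\<And>t. t \<in> T \<Longrightarrow> 0 \<le> (unormal t \<bullet> x) * (unormal t \<bullet> \<rho> ?u b)"
      and x2: "\<And>t. t \<in> T \<Longrightarrow> 0 \<le> (unormal t \<bullet> x) * (unormal t \<bullet> \<rho> w b)"
      unfolding closure_region[OF w] closure_region[OF u] by blast+
    have "unormal ?t \<bullet> \<rho> w b < 0" using s(2) unfolding Inv_def by blast
    moreover have "\<not> unormal ?t \<bullet> \<rho> ?u b < 0" using I tT unfolding Inv_def by blast
    then have "0 < unormal ?t \<bullet> \<rho> ?u b" using regular[OF u tT] by simp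
    ultimately have "unormal ?t \<bullet> x = 0" using x1[OF tT] x2[OF tT] by (auto simp: zero_le_mult_iff)
    moreover have "0 \<le> (unormal c \<bullet> x) * (unormal c \<bullet> \<rho> w b)" if "c \<in> cutters ?t" for c
      using x2 cutters_props[OF tT that] by blast
    ultimately show "x \<in> shard_at ?t p" unfolding sh unfolding shard_at_def hyp_def by blast
  qed
  have mem: "shard_at ?t p \<in> shards (hyp ` T) B"
    unfolding shards_def using shards_of_iff[OF tT] p(1) p_ne tT by blast
  have uniq: "\<Sigma> = shard_at ?t p" if S: "\<Sigma> \<in> shards (hyp ` T) B" "?F \<subseteq> \<Sigma>" for \<Sigma>
  proof -
    obtain t' where t': "t' \<in> T" "\<Sigma> \<in> shards_of (hyp ` T) B (hyp t')"
      using S(1) unfolding shards_def by blast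
    obtain q where q: "q \<in> hyp t'" "\<forall>c\<in>cutters t'. unormal c \<bullet> q \<noteq> 0" "\<Sigma> = shard_at t' q"
      using t'(2) unfolding shards_of_iff[OF t'(1)] by blast
    have pS: "p \<in> shard_at t' q" using pF S(2) q(3) by blast
    then have "unormal t' \<bullet> p = 0" unfolding shard_at_def hyp_def by blast
    then have "\<not> 0 < (unormal t' \<bullet> p) * (unormal t' \<bullet> \<rho> w b)" by simp
    then have "t' = ?t" using p(2) t'(1) by blast
    moreover have "0 < (unormal c \<bullet> q) * (unormal c \<bullet> p)" if c: "c \<in> cutters t'" for c
    proof -
      have "0 \<le> (unormal c \<bullet> p) * (unormal c \<bullet> q)" using pS c unfolding shard_at_def by blast
      moreover have "unormal c \<bullet> q \<noteq> 0" using q(2) c by blast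
      moreover have "unormal c \<bullet> p \<noteq> 0" using p_ne c \<open>t' = ?t\<close> by blast
      ultimately have "0 < (unormal c \<bullet> p) * (unormal c \<bullet> q)" by (simp add: less_le)
      then show ?thesis by (simp add: mult.commute)
    qed
    then have "shard_at t' q = shard_at t' p" by (rule shard_at_cong)
    ultimately show ?thesis using q(3) by simp
  qed
  show ?thesis
    unfolding cover_shard_def arrangement sh[symmetric]
    by (rule the_equality) (use mem F_sub uniq in blast)+
qed

lemma Inter_cov_shards:
  assumes w: "w \<in> carrier W"
  shows "\<Inter>(cov_shards W S \<rho> B w) = {x. \<forall>s\<in>des W S w. x \<in> shard_at (cj w s) (\<rho> w b)}"
proof -
  have "cov_shards W S \<rho> B w = (\<lambda>s. cover_shard W \<rho> B (w \<otimes> s) w) ` des W S w"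
    unfolding cov_shards_def covers_iff[OF w] by blast
  also have "\<dots> = (\<lambda>s. shard_at (cj w s) (\<rho> w b)) ` des W S w"
    by (rule image_cong) (use cover_shard_eq[OF w] des_iff[OF w] in auto)
  finally show ?thesis by auto
qed

section \<open>Intersections of lower shards as cones\<close>

definition shard_cone :: "'w \<Rightarrow> 'a set" where
  "shard_cone w = {x. (\<forall>s\<in>des W S w. unormal (cj w s) \<bullet> x = 0) \<and> (\<forall>t\<in>Inv w. unormal t \<bullet> x \<le> 0)}"

text \<open>Only a cutter \<open>c\<close> outside \<open>Inv w\<close> needs an argument. In the
  relation of \<open>cut_decomposition\<close> the wall is negative and \<open>c\<close> positive at
  \<open>\<rho> w b\<close>, so the third mirror is an inversion; at \<open>x\<close> the wall
  vanishes and the third term is nonpositive, which leaves \<open>c\<close> nonnegative.\<close>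

lemma shard_cone_sub:
  assumes w: "w \<in> carrier W"
  shows "shard_cone w \<subseteq> \<Inter>(cov_shards W S \<rho> B w)"
  unfolding Inter_cov_shards[OF w]
proof (intro subsetI CollectI ballI)
  fix x s assume x: "x \<in> shard_cone w" and s: "s \<in> des W S w"
  let ?t = "cj w s"
  have t: "?t \<in> Inv w" by (rule des_Inv[OF w s])
  have tT: "?t \<in> T" using t Inv_sub_T by blast
  have tx: "unormal ?t \<bullet> x = 0" using x s unfolding shard_cone_def by blast
  have neg: "unormal u \<bullet> x \<le> 0" if "u \<in> Inv w" for u using x that unfolding shard_cone_def by blast
  have "0 \<le> (unormal c \<bullet> x) * (unormal c \<bullet> \<rho> w b)" if c: "c \<in> cutters ?t" for c
  proof (cases "c \<in> Inv w")
    case True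
    then show ?thesis using neg[OF True] unfolding Inv_def by (simp add: mult_nonpos_nonpos)
  next
    case False
    have cT: "c \<in> T" by (rule cutters_props[OF tT c])
    have pos: "0 < unormal c \<bullet> \<rho> w b" using False cT regular[OF w cT] unfolding Inv_def by force
    obtain u e d where u: "u \<in> T" "0 < e" "0 < d" "unormal ?t = e *\<^sub>R unormal c + d *\<^sub>R unormal u"
      using cut_decomposition(2)[OF tT cT] c unfolding cutters_def by blast
    have "e * (unormal c \<bullet> \<rho> w b) + d * (unormal u \<bullet> \<rho> w b) < 0"
    proof -
      have "unormal ?t \<bullet> \<rho> w b < 0" using t unfolding Inv_def by blast
      then show ?thesis unfolding u(4) by (simp add: inner_add_left)
    qed
    moreover have "0 < e * (unormal c \<bullet> \<rho> w b)" using u(2) pos by simp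
    ultimately have "d * (unormal u \<bullet> \<rho> w b) < 0" by linarith
    then have "u \<in> Inv w" unfolding Inv_def using u(1,3) by (simp add: mult_less_0_iff)
    then have "d * (unormal u \<bullet> x) \<le> 0" using neg u(3) by (simp add: mult_le_0_iff)
    moreover have "e * (unormal c \<bullet> x) + d * (unormal u \<bullet> x) = 0"
      using tx unfolding u(4) by (simp add: inner_add_left)
    ultimately have "0 \<le> e * (unormal c \<bullet> x)" by linarith
    then have "0 \<le> unormal c \<bullet> x" using u(2) by (simp add: zero_le_mult_iff)
    then show ?thesis using pos by simp
  qed
  then show "x \<in> shard_at ?t (\<rho> w b)" unfolding shard_at_def hyp_def using tx by blast
qed

lemma perturbation:
  "\<exists>e>0. \<forall>t\<in>T. unormal t \<bullet> x \<noteq> 0 \<longrightarrow> 0 < (unormal t \<bullet> (x + e *\<^sub>R y)) * (unormal t \<bullet> x)"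
proof -
  have "\<forall>\<^sub>F e in at_right (0::real). unormal t \<bullet> x \<noteq> 0 \<longrightarrow> 0 < (unormal t \<bullet> (x + e *\<^sub>R y)) * (unormal t \<bullet> x)" for t
  proof (cases "unormal t \<bullet> x = 0")
    case False
    have "((\<lambda>e. (unormal t \<bullet> (x + e *\<^sub>R y)) * (unormal t \<bullet> x)) \<longlongrightarrow> (unormal t \<bullet> (x + 0 *\<^sub>R y)) * (unormal t \<bullet> x)) (at_right 0)"
      by (intro tendsto_intros)
    moreover have "0 < (unormal t \<bullet> (x + 0 *\<^sub>R y)) * (unormal t \<bullet> x)"
      using False by (auto simp: zero_less_mult_iff)
    ultimately show ?thesis using order_tendstoD(1) by (fastforce elim: eventually_mono)
  qed simp
  then have "\<forall>\<^sub>F e in at_right (0::real). \<forall>t\<in>T. unormal t \<bullet> x \<noteq> 0 \<longrightarrow> 0 < (unormal t \<bullet> (x + e *\<^sub>R y)) * (unormal t \<bullet> x)"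
    by (intro eventually_ball_finite finite_T) blast
  then have "\<forall>\<^sub>F e in at_right (0::real). 0 < e \<and>
      (\<forall>t\<in>T. unormal t \<bullet> x \<noteq> 0 \<longrightarrow> 0 < (unormal t \<bullet> (x + e *\<^sub>R y)) * (unormal t \<bullet> x))"
    using eventually_at_right_less by (rule eventually_conj[rotated])
  then show ?thesis using eventually_happens[of _ "at_right (0::real)"] by force
qed

lemma b_nonzero: "t \<in> T \<Longrightarrow> unormal t \<bullet> b \<noteq> 0"
  using unormal(2) by fastforce

text \<open>The region reached by a small step from \<open>x\<close> in the direction of
  \<open>y\<close>, which decides the mirrors through \<open>x\<close>. The directions
  \<open>b\<close>, \<open>- b\<close> and \<open>\<rho> t b\<close> give the lowest region at
  \<open>x\<close>, the topmost one, and one just beyond a facet.\<close>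

lemma perturbed_region:
  assumes y: "\<And>t. \<lbrakk>t \<in> T; unormal t \<bullet> x = 0\<rbrakk> \<Longrightarrow> unormal t \<bullet> y \<noteq> 0"
  shows "\<exists>w\<in>carrier W. Inv w = {t \<in> T. unormal t \<bullet> x < 0 \<or> unormal t \<bullet> x = 0 \<and> unormal t \<bullet> y < 0}"
proof -
  obtain e :: real where e: "0 < e"
    and sg: "\<And>t. \<lbrakk>t \<in> T; unormal t \<bullet> x \<noteq> 0\<rbrakk> \<Longrightarrow> 0 < (unormal t \<bullet> (x + e *\<^sub>R y)) * (unormal t \<bullet> x)"
    using perturbation[of x y] by blast
  have z: "unormal t \<bullet> (x + e *\<^sub>R y) = e * (unormal t \<bullet> y)" if "unormal t \<bullet> x = 0" for t
    using that by (simp add: inner_add_right)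
  have nz: "unormal t \<bullet> (x + e *\<^sub>R y) \<noteq> 0" if t: "t \<in> T" for t
  proof (cases "unormal t \<bullet> x = 0")
    case True
    then show ?thesis unfolding z[OF True] using y[OF t True] e by simp
  next
    case False
    then show ?thesis using sg[OF t False] by auto
  qed
  have "unormal t \<bullet> (x + e *\<^sub>R y) < 0 \<longleftrightarrow> unormal t \<bullet> x < 0 \<or> unormal t \<bullet> x = 0 \<and> unormal t \<bullet> y < 0" if t: "t \<in> T" for t
  proof (cases "unormal t \<bullet> x = 0")
    case True
    then show ?thesis unfolding z[OF True] using e by (simp add: mult_less_0_iff)
  next
    case False
    then show ?thesis using sg[OF t False] by (auto simp: zero_less_mult_iff)
  qed
  then have "{t \<in> T. unormal t \<bullet> (x + e *\<^sub>R y) < 0}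
      = {t \<in> T. unormal t \<bullet> x < 0 \<or> unormal t \<bullet> x = 0 \<and> unormal t \<bullet> y < 0}" by blast
  then show ?thesis using region_representative[OF nz] by simp
qed

text \<open>
  The element \<open>j\<close> is the join irreducible attached to the lower facet of \<open>u\<close> on the hyperplane
  of \<open>t\<close>; it depends only on the shard containing that facet.
\<close>

lemma facet_least:
  assumes u: "u \<in> carrier W" and t: "t \<in> Inv u" and u': "u' \<in> carrier W" "Inv u' = Inv u - {t}"
  shows "\<exists>j\<in>carrier W. t \<in> Inv j \<and> Inv j \<subseteq> Inv u \<and>
    (\<forall>y\<in>carrier W. t \<in> Inv y \<longrightarrow> Inv y \<subseteq> Inv u \<longrightarrow> Inv j \<subseteq> Inv y)"
proof -
  let ?M = "{y \<in> carrier W. t \<in> Inv y \<and> Inv y \<subseteq> Inv u}"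
  have "\<exists>j\<in>?M. Inv j \<subseteq> Inv u \<and> (\<forall>y\<in>?M. Inv y \<subseteq> Inv u \<longrightarrow> Inv j \<subseteq> Inv y)"
  proof (rule least_element)
    show "?M \<subseteq> carrier W" by blast
    show "u \<in> ?M" using u t by blast
    show "z \<in> ?M" if "y \<in> ?M" "z \<in> carrier W" "Inv y \<subseteq> Inv z" "Inv z \<subseteq> Inv u" for y z
      using that by blast
    show "y \<otimes> longest W S {r, r'} \<in> ?M"
      if y: "y \<in> ?M" and r: "r \<in> S" "r' \<in> S" "cj y r \<in> Inv y" "cj y r' \<in> Inv y"
        and yr: "y \<otimes> r \<in> ?M" "y \<otimes> r' \<in> ?M" for y r r'
    proof -
      let ?J = "{r, r'}"
      have J: "?J \<subseteq> S" and yc: "y \<in> carrier W" using r y by auto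
      have des: "cj y s \<in> Inv y" if "s \<in> ?J" for s using that r by blast
      have I: "Inv (y \<otimes> longest W S ?J) = Inv y - cj y ` (T \<inter> generate W ?J)"
        by (rule coset_bottom_Inv[OF J yc des])
      \<comment> \<open>The region \<open>u'\<close> across the facet misses only \<open>t\<close>
        among the inversions of \<open>u\<close>. As \<open>y \<otimes> s\<close> still inverts
        \<open>t\<close>, the removed mirror is another one and stays in \<open>Inv u'\<close>; the
        coset dichotomy then keeps \<open>t\<close> out of the whole conjugated rank-two
        subgroup.\<close>
      have "cj y s \<in> Inv u'" if s: "s \<in> ?J" for s
      proof -
        have "s \<in> S" "y \<otimes> s \<in> ?M" using s J yr by auto
        then have "t \<noteq> cj y s" using Inv_mult_simple(1)[OF yc _ des[OF s]] by blast
        then show ?thesis using des[OF s] y u'(2) by blast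
      qed
      then have "cj y d \<in> Inv u'" if "d \<in> T \<inter> generate W ?J" for d
        using coset_Inv_other(1)[OF J yc des u'(1) that] by blast
      then have "t \<notin> cj y ` (T \<inter> generate W ?J)" using u'(2) by blast
      then show ?thesis using y yc J unfolding mem_Collect_eq I by auto
    qed
  qed
  then obtain j where j: "j \<in> carrier W" "t \<in> Inv j" "Inv j \<subseteq> Inv u"
    and least: "\<forall>y\<in>?M. Inv y \<subseteq> Inv u \<longrightarrow> Inv j \<subseteq> Inv y" by blast
  show ?thesis
  proof (intro bexI[of _ j] conjI ballI impI j)
    fix y assume "y \<in> carrier W" "t \<in> Inv y" "Inv y \<subseteq> Inv u"
    then show "Inv j \<subseteq> Inv y" using least by simp
  qed
qed

text \<open>At every point of the relatively open shard there is a facet, hence a least element by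
  \<open>facet_least\<close>. This element is locally constant and the shard is connected, so a
  single \<open>j\<close> serves all points, and its inversions are nonpositive on the
  closure.\<close>

lemma shard_least:
  assumes w: "w \<in> carrier W" and s: "s \<in> des W S w"
  shows "\<exists>j\<in>carrier W. cj w s \<in> Inv j \<and> Inv j \<subseteq> Inv w \<and>
    (\<forall>x\<in>shard_at (cj w s) (\<rho> w b). Inv j \<subseteq> {t \<in> T. unormal t \<bullet> x \<le> 0})"
proof -
  let ?t = "cj w s"
  have sS: "s \<in> S" using s des_sub by blast
  have t: "?t \<in> Inv w" by (rule des_Inv[OF w s])
  have tT: "?t \<in> T" using t Inv_sub_T by blast
  have sc: "s \<in> carrier W" by (rule S_carrier[OF sS])
  obtain p where p: "p \<in> hyp ?t" and ps: "\<forall>t\<in>T - {?t}. 0 < (unormal t \<bullet> p) * (unormal t \<bullet> \<rho> w b)"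
    by (rule facet_point[OF w sS t])
  have pc: "0 < (unormal c \<bullet> p) * (unormal c \<bullet> \<rho> w b)" if "c \<in> cutters ?t" for c
    using ps cutters_props[OF tT that] by blast
  have p_ne: "unormal c \<bullet> p \<noteq> 0" if "c \<in> cutters ?t" for c using pc[OF that] by auto
  let ?K = "shard_int ?t p"
  \<comment> \<open>The inversions of the region just above the mirror of \<open>?t\<close> at
    \<open>z\<close>: all mirrors negative at \<open>z\<close>, together with
    \<open>?t\<close>.\<close>
  define N where "N z = insert ?t {u \<in> T. unormal u \<bullet> z < 0}" for z
  have Np: "N p = Inv w"
  proof (intro Set.set_eqI)
    fix u
    have "u \<in> N p \<longleftrightarrow> u \<in> Inv w" if "u \<noteq> ?t" "u \<in> T"
      using bspec[OF ps, of u] that unfolding N_def Inv_def by (auto simp: zero_less_mult_iff)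
    then show "u \<in> N p \<longleftrightarrow> u \<in> Inv w" using t Inv_sub_T unfolding N_def by blast
  qed
  have least: "\<exists>j\<in>carrier W. ?t \<in> Inv j \<and> Inv j \<subseteq> N z \<and>
      (\<forall>y\<in>carrier W. ?t \<in> Inv y \<longrightarrow> Inv y \<subseteq> N z \<longrightarrow> Inv j \<subseteq> Inv y)" if z: "z \<in> ?K" for z
  proof -
    have zt: "z \<in> hyp ?t" and zc: "\<And>c. c \<in> cutters ?t \<Longrightarrow> 0 < (unormal c \<bullet> z) * (unormal c \<bullet> p)"
      using z unfolding shard_int_def by auto
    have uncut: "z \<notin> hyp c" if "c \<in> T" "cuts (hyp ` T) B (hyp c) (hyp ?t)" for c
      using zc[of c] that unfolding cutters_def hyp_def by auto
    have sep: "0 < unormal u \<bullet> \<rho> ?t b" if u: "u \<in> T" "u \<noteq> ?t" "unormal u \<bullet> z = 0" for u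
      by (rule uncut_not_separated[OF tT u(1,2) zt _ uncut]) (use u(3) in \<open>simp add: hyp_def\<close>)
    have tn: "unormal ?t \<bullet> \<rho> ?t b < 0" using inner_rho_self[OF tT] unormal(2)[OF tT] by simp
    have tz: "unormal ?t \<bullet> z = 0" using zt unfolding hyp_def by simp
    have nz: "unormal u \<bullet> \<rho> ?t b \<noteq> 0" if "u \<in> T" for u by (rule regular[OF T_carrier[OF tT] that])
    \<comment> \<open>By \<open>sep\<close>, a small step in the direction of the reflected base
      point ends beyond the mirror of \<open>?t\<close> and beyond no other mirror through
      \<open>z\<close>. The step in the direction of \<open>b\<close> used for \<open>R'\<close>
      ends beyond none, so the two regions share a facet.\<close>
    obtain R where R: "R \<in> carrier W"
      "Inv R = {u \<in> T. unormal u \<bullet> z < 0 \<or> unormal u \<bullet> z = 0 \<and> unormal u \<bullet> \<rho> ?t b < 0}"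
      using perturbed_region[of z "\<rho> ?t b"] nz by blast
    have IR: "Inv R = N z"
    proof (intro Set.set_eqI)
      fix u
      show "u \<in> Inv R \<longleftrightarrow> u \<in> N z"
      proof (cases "u = ?t")
        case True
        then show ?thesis using tT tz tn unfolding R(2) N_def by simp
      next
        case False
        then show ?thesis using sep[of u] unfolding R(2) N_def by force
      qed
    qed
    obtain R' where R': "R' \<in> carrier W"
      "Inv R' = {u \<in> T. unormal u \<bullet> z < 0 \<or> unormal u \<bullet> z = 0 \<and> unormal u \<bullet> b < 0}"
      using perturbed_region[of z b, OF b_nonzero] by blast
    have "Inv R' = Inv R - {?t}"
    proof -
      have "\<not> unormal u \<bullet> b < 0" if "u \<in> T" for u using unormal(2)[OF that] by simp
      then show ?thesis unfolding IR R'(2) N_def using tz by auto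
    qed
    from facet_least[OF R(1) _ R'(1) this] show ?thesis unfolding IR N_def by blast
  qed
  have "0 < (unormal c \<bullet> p) * (unormal c \<bullet> p)" if "c \<in> cutters ?t" for c
    using p_ne[OF that] not_real_square_gt_zero[of "unormal c \<bullet> p"] by blast
  then have pK: "p \<in> ?K" unfolding shard_int_def using p by blast
  obtain j where j: "j \<in> carrier W" "?t \<in> Inv j" "Inv j \<subseteq> N p"
    and jl: "\<And>y. \<lbrakk>y \<in> carrier W; ?t \<in> Inv y; Inv y \<subseteq> N p\<rbrakk> \<Longrightarrow> Inv j \<subseteq> Inv y"
    using least[OF pK] by blast
  define P where "P z \<longleftrightarrow> Inv j \<subseteq> N z \<and>
    (\<forall>y\<in>carrier W. ?t \<in> Inv y \<longrightarrow> Inv y \<subseteq> N z \<longrightarrow> Inv j \<subseteq> Inv y)" for z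
  have "connected ?K"
  proof -
    have "?K = hyp ?t \<inter> (\<Inter>c\<in>cutters ?t. {x. ((unormal c \<bullet> p) *\<^sub>R unormal c) \<bullet> x > 0})"
      unfolding shard_int_def by (auto simp: mult.commute)
    moreover have "convex (hyp ?t \<inter> (\<Inter>c\<in>cutters ?t. {x. ((unormal c \<bullet> p) *\<^sub>R unormal c) \<bullet> x > 0}))"
      by (intro convex_Int convex_INT hyp_convex_closed convex_halfspace_gt)
    ultimately show ?thesis by (simp add: convex_connected)
  qed
  have local_const: "\<exists>U. openin (top_of_set ?K) U \<and> a \<in> U \<and> (\<forall>x\<in>U. \<forall>y\<in>U. P x \<longrightarrow> P y)"
    if a: "a \<in> ?K" for a
  proof -
    \<comment> \<open>Negative signs at \<open>a\<close> persist nearby, which gives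
      \<open>N a \<subseteq> N z\<close> but not equality. Minimality repairs this: the least
      element for \<open>z\<close> lies below that for \<open>a\<close>, hence inside
      \<open>N a\<close>, so the two have the same inversions.\<close>
    let ?O = "\<Inter>u\<in>{u \<in> T. unormal u \<bullet> a < 0}. {x. unormal u \<bullet> x < 0}"
    have "open ?O" using finite_T by (intro open_INT ballI open_halfspace_lt) auto
    then have op: "openin (top_of_set ?K) (?K \<inter> ?O)" by (rule openin_open_Int)
    have aU: "a \<in> ?K \<inter> ?O" using a by blast
    obtain i where i: "i \<in> carrier W" "?t \<in> Inv i" "Inv i \<subseteq> N a"
      and il: "\<And>y. \<lbrakk>y \<in> carrier W; ?t \<in> Inv y; Inv y \<subseteq> N a\<rbrakk> \<Longrightarrow> Inv i \<subseteq> Inv y"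
      using least[OF a] by blast
    have P_iff: "P z \<longleftrightarrow> Inv j = Inv i" if z: "z \<in> ?K \<inter> ?O" for z
    proof -
      have Naz: "N a \<subseteq> N z" using z unfolding N_def by auto
      obtain k where k: "k \<in> carrier W" "?t \<in> Inv k" "Inv k \<subseteq> N z"
        and k_least: "\<forall>y\<in>carrier W. ?t \<in> Inv y \<longrightarrow> Inv y \<subseteq> N z \<longrightarrow> Inv k \<subseteq> Inv y"
        using least[OF IntD1[OF z]] by blast
      note kl = k_least[rule_format]
      have "Inv k \<subseteq> Inv i" using kl[OF i(1,2)] i(3) Naz by blast
      moreover from this have "Inv i \<subseteq> Inv k" using il[OF k(1,2)] i(3) by blast
      ultimately have ki: "Inv k = Inv i" by blast
      show ?thesis
      proof
        assume "P z"
        then have z1: "Inv j \<subseteq> N z"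
          and z2: "\<forall>y\<in>carrier W. ?t \<in> Inv y \<longrightarrow> Inv y \<subseteq> N z \<longrightarrow> Inv j \<subseteq> Inv y"
          unfolding P_def by blast+
        have "Inv j \<subseteq> Inv i" using z2 i(1,2) order_trans[OF i(3) Naz] by simp
        moreover have "Inv k \<subseteq> Inv j" by (rule kl[OF j(1,2) z1])
        ultimately show "Inv j = Inv i" using ki by blast
      next
        assume "Inv j = Inv i"
        then have "Inv j = Inv k" using ki by simp
        then show "P z" using k(3) kl unfolding P_def by simp
      qed
    qed
    show ?thesis
    proof (intro exI[of _ "?K \<inter> ?O"] conjI ballI impI op aU)
      fix x y assume xy: "x \<in> ?K \<inter> ?O" "y \<in> ?K \<inter> ?O" and "P x"
      then show "P y" using P_iff[OF xy(1)] P_iff[OF xy(2)] by simp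
    qed
  qed
  have "P p" unfolding P_def using j jl by blast
  then have PK: "P z" if "z \<in> ?K" for z
    using connected_induction_simple[OF \<open>connected ?K\<close> pK that, of P] local_const by blast
  have "Inv j \<subseteq> {u \<in> T. unormal u \<bullet> x \<le> 0}" if x: "x \<in> shard_at ?t (\<rho> w b)" for x
  proof
    fix u assume u: "u \<in> Inv j"
    have uT: "u \<in> T" using u Inv_sub_T by blast
    have "shard_at ?t (\<rho> w b) = closure ?K"
      using closure_shard_int[OF p p_ne] shard_at_cong[OF pc] by simp
    then have xK: "x \<in> closure ?K" using x by simp
    have "unormal u \<bullet> x \<le> 0"
    proof (cases "u = ?t")
      case True
      then show ?thesis using x unfolding shard_at_def hyp_def by simp
    next
      case False
      show ?thesis
      proof (rule ccontr)
        assume "\<not> ?thesis"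
        then have "x \<in> {z. 0 < unormal u \<bullet> z}" by simp
        \<comment> \<open>A positive sign at \<open>x\<close> would persist at some point of the
          open shard, where the inversion \<open>u\<close> of \<open>j\<close> has to be
          negative.\<close>
        then obtain z where z: "z \<in> ?K" "0 < unormal u \<bullet> z"
          using xK open_halfspace_gt[of 0 "unormal u"] unfolding closure_iff_nhds_not_empty by blast
        then show False using PK[OF z(1)] u False unfolding P_def N_def by auto
      qed
    qed
    then show "u \<in> {u \<in> T. unormal u \<bullet> x \<le> 0}" using uT by blast
  qed
  then show ?thesis using j Np by blast
qed

text \<open>
  The element \<open>w\<close> is the join of the join irreducibles \<open>j s\<close> attached to its lower facets, and each
  \<open>j s\<close> lies below the topmost region \<open>v\<close> whose closure contains \<open>x\<close>.
\<close>

lemma sub_shard_cone: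
  assumes w: "w \<in> carrier W"
  shows "\<Inter>(cov_shards W S \<rho> B w) \<subseteq> shard_cone w"
proof
  fix x assume "x \<in> \<Inter>(cov_shards W S \<rho> B w)"
  then have x: "\<And>s. s \<in> des W S w \<Longrightarrow> x \<in> shard_at (cj w s) (\<rho> w b)"
    unfolding Inter_cov_shards[OF w] by blast
  have ex: "\<forall>s\<in>des W S w. \<exists>j. j \<in> carrier W \<and> cj w s \<in> Inv j \<and> Inv j \<subseteq> Inv w \<and>
      Inv j \<subseteq> {t \<in> T. unormal t \<bullet> x \<le> 0}"
  proof
    fix s assume s: "s \<in> des W S w"
    from shard_least[OF w s] obtain j where j: "j \<in> carrier W" "cj w s \<in> Inv j" "Inv j \<subseteq> Inv w"
      and jx: "\<forall>x\<in>shard_at (cj w s) (\<rho> w b). Inv j \<subseteq> {t \<in> T. unormal t \<bullet> x \<le> 0}"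
      by blast
    show "\<exists>j. j \<in> carrier W \<and> cj w s \<in> Inv j \<and> Inv j \<subseteq> Inv w \<and> Inv j \<subseteq> {t \<in> T. unormal t \<bullet> x \<le> 0}"
      by (intro exI[of _ j] conjI j bspec[OF jx] x s)
  qed
  from bchoice[OF ex] obtain j where j: "\<And>s. s \<in> des W S w \<Longrightarrow> j s \<in> carrier W"
    "\<And>s. s \<in> des W S w \<Longrightarrow> cj w s \<in> Inv (j s)" "\<And>s. s \<in> des W S w \<Longrightarrow> Inv (j s) \<subseteq> Inv w"
    "\<And>s. s \<in> des W S w \<Longrightarrow> Inv (j s) \<subseteq> {t \<in> T. unormal t \<bullet> x \<le> 0}"
    by blast
  \<comment> \<open>A step in the direction of \<open>- b\<close> turns every mirror through
    \<open>x\<close> into an inversion, so \<open>v\<close> inverts exactly the mirrors that are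
    nonpositive at \<open>x\<close>.\<close>
  obtain v where v: "v \<in> carrier W" "Inv v = {t \<in> T. unormal t \<bullet> x < 0 \<or> unormal t \<bullet> x = 0 \<and> unormal t \<bullet> - b < 0}"
    using perturbed_region[of x "- b"] b_nonzero by (simp add: inner_minus_right) blast
  have "unormal t \<bullet> - b < 0" if "t \<in> T" for t using unormal(2)[OF that] by simp
  then have Iv: "Inv v = {t \<in> T. unormal t \<bullet> x \<le> 0}" unfolding v(2) by (auto simp: le_less)
  let ?M = "{y \<in> carrier W. \<forall>s\<in>des W S w. Inv (j s) \<subseteq> Inv y}"
  let ?l = "longest W S S"
  have Il: "Inv ?l = T" using longest_props(2)[of S] gen T_carrier by auto
  have "\<exists>m\<in>?M. Inv m \<subseteq> Inv ?l \<and> (\<forall>y\<in>?M. Inv y \<subseteq> Inv ?l \<longrightarrow> Inv m \<subseteq> Inv y)"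
  proof (rule least_element)
    show "?M \<subseteq> carrier W" by blast
    show "?l \<in> ?M" using Il Inv_sub_T by simp
    show "z \<in> ?M" if "y \<in> ?M" "z \<in> carrier W" "Inv y \<subseteq> Inv z" "Inv z \<subseteq> Inv ?l" for y z
      using that by blast
    show "y \<otimes> longest W S {r, r'} \<in> ?M"
      if y: "y \<in> ?M" and r: "r \<in> S" "r' \<in> S" "cj y r \<in> Inv y" "cj y r' \<in> Inv y"
        and yr: "y \<otimes> r \<in> ?M" "y \<otimes> r' \<in> ?M" for y r r'
    proof -
      let ?J = "{r, r'}"
      have J: "?J \<subseteq> S" and yc: "y \<in> carrier W" using r y by auto
      have des: "cj y s \<in> Inv y" if "s \<in> ?J" for s using that r by blast
      have I: "Inv (y \<otimes> longest W S ?J) = Inv y - cj y ` (T \<inter> generate W ?J)"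
        by (rule coset_bottom_Inv[OF J yc des])
      have "Inv (j s) \<subseteq> Inv (y \<otimes> longest W S ?J)" if s: "s \<in> des W S w" for s
      proof -
        \<comment> \<open>Here the other half of the dichotomy is used: \<open>j s\<close> inverts
          neither conjugated generator, hence no conjugated reflection of the subgroup, and stays
          below the bottom of the coset.\<close>
        have "cj y a \<notin> Inv (j s)" if a: "a \<in> ?J" for a
        proof -
          have "a \<in> S" "y \<otimes> a \<in> ?M" using a J yr by auto
          then have "Inv (j s) \<subseteq> Inv y - {cj y a}" using Inv_mult_simple(1)[OF yc _ des[OF a]] s by blast
          then show ?thesis by blast
        qed
        then have "cj y d \<notin> Inv (j s)" if "d \<in> T \<inter> generate W ?J" for d
          using coset_Inv_other(2)[OF J yc des j(1)[OF s] that] by blast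
        moreover have "Inv (j s) \<subseteq> Inv y" using y s by blast
        ultimately show ?thesis unfolding I by blast
      qed
      then show ?thesis using yc J by auto
    qed
  qed
  then obtain m where mM: "m \<in> ?M" and m_least: "\<forall>y\<in>?M. Inv y \<subseteq> Inv ?l \<longrightarrow> Inv m \<subseteq> Inv y"
    by blast
  have m: "m \<in> carrier W" "\<And>s. s \<in> des W S w \<Longrightarrow> Inv (j s) \<subseteq> Inv m" using mM by blast+
  have least: "Inv m \<subseteq> Inv y" if "y \<in> carrier W" "\<And>s. s \<in> des W S w \<Longrightarrow> Inv (j s) \<subseteq> Inv y" for y
  proof -
    have "y \<in> ?M" using that by simp
    then show ?thesis using bspec[OF m_least] Inv_sub_T[of y] unfolding Il by simp
  qed
  have mw: "Inv m \<subseteq> Inv w" by (rule least[OF w j(3)])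
  have mv: "Inv m \<subseteq> Inv v" by (rule least[OF v(1)]) (use j(4) Iv in blast)
  \<comment> \<open>If \<open>m\<close> were properly below \<open>w\<close>, it would lie below
    some \<open>w \<otimes> r\<close>, which has lost the inversion \<open>cj w r\<close>; but
    \<open>j r\<close> carries it and lies below \<open>m\<close>.\<close>
  have "m = w"
  proof (rule ccontr)
    assume "m \<noteq> w"
    then obtain r where r: "r \<in> S" "cj w r \<in> Inv w" "Inv m \<subseteq> Inv (w \<otimes> r)"
      using weak_lower[OF m(1) w mw] by blast
    then have "r \<in> des W S w" using des_iff[OF w] by blast
    then have "cj w r \<in> Inv m" using j(2) m(2) by blast
    then show False using r(3) Inv_mult_simple(1)[OF w r(1,2)] by blast
  qed
  then have "unormal t \<bullet> x \<le> 0" if "t \<in> Inv w" for t using mv that unfolding Iv by blast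
  moreover have "unormal (cj w s) \<bullet> x = 0" if "s \<in> des W S w" for s
    using x[OF that] unfolding shard_at_def hyp_def by blast
  ultimately show "x \<in> shard_cone w" unfolding shard_cone_def by blast
qed

lemma Inter_cov_shards_eq: "w \<in> carrier W \<Longrightarrow> \<Inter>(cov_shards W S \<rho> B w) = shard_cone w"
  using shard_cone_sub sub_shard_cone by blast

section \<open>Inclusion of cones\<close>

lemma shard_cone_fixed:
  assumes w: "w \<in> carrier W" and x: "x \<in> shard_cone w" and d: "d \<in> T \<inter> generate W (des W S w)"
  shows "unormal (cj w d) \<bullet> x = 0"
proof -
  let ?x = "\<rho> (inv w) x"
  have xw: "\<rho> w ?x = x" using w by simp
  \<comment> \<open>Lying on the mirrors of the descents means being fixed by them, hence by the
    subgroup they generate; a point fixed by a reflection lies on its mirror.\<close>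
  have fix_s: "\<rho> s ?x = ?x" if s: "s \<in> des W S w" for s
  proof -
    have sT: "s \<in> T" using s des_sub S_wall(1) by blast
    have "unormal (cj w s) \<bullet> \<rho> w ?x = 0" using x s unfolding shard_cone_def xw by blast
    then have "unormal s \<bullet> ?x = 0" unfolding unormal_cj_zero[OF w sT] .
    then show ?thesis by (simp add: rho_T[OF sT])
  qed
  have "\<rho> (word_prod W ss) ?x = ?x" if "ss \<in> lists (des W S w)" for ss
    using that
  proof (induction ss rule: list.induct)
    case (Cons s ss)
    have "s \<in> des W S w" "ss \<in> lists (des W S w)" using Cons.prems by auto
    then have "s \<in> carrier W" "word_prod W ss \<in> carrier W"
      using des_sub S_carrier word_closed[OF _ des_sub] by blast+
    then show ?case using Cons fix_s by (simp add: rho_mult)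
  qed simp
  then have "\<rho> d ?x = ?x" using gen_word[OF des_sub] d by blast
  moreover have dT: "d \<in> T" using d by blast
  ultimately have "(2 * (unormal d \<bullet> ?x)) *\<^sub>R unormal d = 0" by (simp add: rho_T)
  then have "unormal d \<bullet> ?x = 0" using unormal_nonzero[OF dT] by simp
  then show ?thesis using unormal_cj_zero[OF w dT, of ?x] unfolding xw by blast
qed

lemma face_point:
  assumes w: "w \<in> carrier W"
  shows "\<exists>q. (\<forall>d \<in> T \<inter> generate W (des W S w). unormal (cj w d) \<bullet> q = 0) \<and>
    (\<forall>t\<in>T. cj (inv w) t \<notin> generate W (des W S w) \<longrightarrow> 0 < (unormal t \<bullet> q) * (unormal t \<bullet> \<rho> w b))"
proof (intro exI conjI ballI impI)
  let ?G = "generate W (des W S w)"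
  txt \<open>Averaging over the parabolic subgroup gives a generic point of the face.\<close>
  let ?q = "\<Sum>g\<in>?G. \<rho> (w \<otimes> g) b"
  note J = des_sub[of w]
  have sub: "?G \<subseteq> carrier W" using gen_closed[OF J] by blast
  have fG: "finite ?G" using sub fin finite_subset by blast
  show "unormal (cj w d) \<bullet> ?q = 0" if d: "d \<in> T \<inter> ?G" for d
  proof -
    have dT: "d \<in> T" and dG: "d \<in> ?G" and dc: "d \<in> carrier W" using d T_carrier by auto
    let ?t = "cj w d"
    have tT: "?t \<in> T" using w dT by simp
    have tc: "?t \<in> carrier W" by (rule T_carrier[OF tT])
    have eq: "unormal ?t \<bullet> \<rho> (w \<otimes> (d \<otimes> g)) b = - (unormal ?t \<bullet> \<rho> (w \<otimes> g) b)" if g: "g \<in> ?G" for g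
    proof -
      have gc: "g \<in> carrier W" using g sub by blast
      have "w \<otimes> (d \<otimes> g) = ?t \<otimes> (w \<otimes> g)"
        using cj_mult[OF w dc] w dc gc tc by (metis m_assoc m_closed)
      then have "\<rho> (w \<otimes> (d \<otimes> g)) b = \<rho> ?t (\<rho> (w \<otimes> g) b)" using rho_mult[OF tc, of "w \<otimes> g"] w gc by simp
      then show ?thesis using inner_rho_self[OF tT] by simp
    qed
    \<comment> \<open>Left multiplication by \<open>d\<close> permutes the subgroup and negates each
      summand, so the sum equals its own negative.\<close>
    have "(\<Sum>g\<in>?G. unormal ?t \<bullet> \<rho> (w \<otimes> g) b) = (\<Sum>g\<in>?G. unormal ?t \<bullet> \<rho> (w \<otimes> (d \<otimes> g)) b)"
      by (rule sum.reindex_bij_witness[of _ "\<lambda>g. d \<otimes> g" "\<lambda>g. d \<otimes> g"])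
        (use sub dT dG gen_mult[OF J] in auto)
    also have "\<dots> = - (\<Sum>g\<in>?G. unormal ?t \<bullet> \<rho> (w \<otimes> g) b)"
      unfolding sum_negf[symmetric] by (rule sum.cong) (use eq in auto)
    finally have "(\<Sum>g\<in>?G. unormal ?t \<bullet> \<rho> (w \<otimes> g) b) = 0" by simp
    then show ?thesis by (simp add: inner_sum_right)
  qed
  show "0 < (unormal t \<bullet> ?q) * (unormal t \<bullet> \<rho> w b)" if t: "t \<in> T" "cj (inv w) t \<notin> ?G" for t
  proof -
    have "0 < (unormal t \<bullet> \<rho> (w \<otimes> g) b) * (unormal t \<bullet> \<rho> w b)" if g: "g \<in> ?G" for g
    proof -
      have gc: "g \<in> carrier W" using g sub by blast
      have "t \<in> Inv (w \<otimes> g) \<longleftrightarrow> t \<in> Inv w"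
        using Inv_mult[OF w gc t(1)] t(2) Inv_gen[OF J g] by blast
      then have "unormal t \<bullet> \<rho> (w \<otimes> g) b < 0 \<longleftrightarrow> unormal t \<bullet> \<rho> w b < 0" unfolding Inv_def using t(1) by blast
      moreover have "unormal t \<bullet> \<rho> (w \<otimes> g) b \<noteq> 0" "unormal t \<bullet> \<rho> w b \<noteq> 0" using regular w gc t(1) by auto
      ultimately show ?thesis unfolding zero_less_mult_iff by linarith
    qed
    then have "0 < (\<Sum>g\<in>?G. (unormal t \<bullet> \<rho> (w \<otimes> g) b) * (unormal t \<bullet> \<rho> w b))"
      using fG generate.one by (intro sum_pos) auto
    then show ?thesis by (simp add: inner_sum_right sum_distrib_right)
  qed
qed

text \<open>The converse is tested at one generic point \<open>q\<close>, which lies on the mirrors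
  of the conjugated parabolic subgroup only and has the signs of \<open>\<rho> w b\<close>
  elsewhere. The equations of the cone of \<open>u\<close> then give the parabolic condition and its
  inequalities give \<open>Inv u \<subseteq> Inv w\<close>, with the mirrors through
  \<open>q\<close> covered by \<open>coset_Inv\<close>.\<close>

lemma shard_cone_le_iff:
  assumes u: "u \<in> carrier W" and w: "w \<in> carrier W"
  shows "shard_cone w \<subseteq> shard_cone u \<longleftrightarrow> refl_le u w"
proof
  assume le: "refl_le u w"
  show "shard_cone w \<subseteq> shard_cone u"
  proof
    fix x assume x: "x \<in> shard_cone w"
    have "unormal (cj u s) \<bullet> x = 0" if s: "s \<in> des W S u" for s
    proof -
      let ?d = "cj (inv w) (cj u s)"
      have sT: "s \<in> T" using s des_sub S_wall(1) by blast
      have tT: "cj u s \<in> T" using u sT by simp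
      have "?d \<in> T \<inter> generate W (des W S w)" using le s w tT unfolding refl_le_def by simp
      from shard_cone_fixed[OF w x this] show ?thesis using w T_carrier[OF tT] by simp
    qed
    moreover have "unormal t \<bullet> x \<le> 0" if "t \<in> Inv u" for t
      using le x that unfolding refl_le_def shard_cone_def by blast
    ultimately show "x \<in> shard_cone u" unfolding shard_cone_def by blast
  qed
next
  assume sub: "shard_cone w \<subseteq> shard_cone u"
  let ?G = "generate W (des W S w)"
  obtain q where q0: "\<And>d. d \<in> T \<inter> ?G \<Longrightarrow> unormal (cj w d) \<bullet> q = 0"
    and q1: "\<And>t. \<lbrakk>t \<in> T; cj (inv w) t \<notin> ?G\<rbrakk> \<Longrightarrow> 0 < (unormal t \<bullet> q) * (unormal t \<bullet> \<rho> w b)"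
    using face_point[OF w] by blast
  have zero: "unormal t \<bullet> q = 0" if t: "t \<in> T" "cj (inv w) t \<in> ?G" for t
    using q0[of "cj (inv w) t"] t w T_carrier by simp
  have "unormal (cj w s) \<bullet> q = 0" if "s \<in> des W S w" for s
  proof (rule q0)
    show "s \<in> T \<inter> ?G" using that des_sub S_wall(1) generate.incl[OF that] by blast
  qed
  moreover have "unormal t \<bullet> q \<le> 0" if t: "t \<in> Inv w" for t
  proof (cases "cj (inv w) t \<in> ?G")
    case True
    then show ?thesis using zero t Inv_sub_T by force
  next
    case False
    then show ?thesis using q1[of t] t unfolding Inv_def by (auto simp: zero_less_mult_iff)
  qed
  ultimately have "q \<in> shard_cone w" unfolding shard_cone_def by blast
  then have qu: "q \<in> shard_cone u" using sub by blast
  have "cj (inv w) (cj u s) \<in> ?G" if s: "s \<in> des W S u" for s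
  proof (rule ccontr)
    assume n: "\<not> ?thesis"
    have "s \<in> T" using s des_sub S_wall(1) by blast
    then have "cj u s \<in> T" using u by simp
    from q1[OF this n] show False using qu s unfolding shard_cone_def by auto
  qed
  moreover have "Inv u \<subseteq> Inv w"
  proof
    fix t assume t: "t \<in> Inv u"
    have tT: "t \<in> T" using t Inv_sub_T by blast
    have le: "unormal t \<bullet> q \<le> 0" using qu t unfolding shard_cone_def by blast
    show "t \<in> Inv w"
    proof (cases "cj (inv w) t \<in> ?G")
      case True
      then have "cj w (cj (inv w) t) \<in> Inv w"
        using coset_Inv[OF des_sub w des_Inv[OF w], of w "cj (inv w) t"] tT w by simp
      then show ?thesis using w T_carrier[OF tT] by simp
    next
      case False
      from q1[OF tT this] show ?thesis unfolding Inv_def using tT le by (simp add: zero_less_mult_iff)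
    qed
  qed
  ultimately show "refl_le u w" unfolding refl_le_def by blast
qed

lemma shard_le_iff:
  "\<lbrakk>u \<in> carrier W; w \<in> carrier W\<rbrakk> \<Longrightarrow> shard_le W S \<rho> B u w \<longleftrightarrow> refl_le u w"
  unfolding shard_le_def by (simp add: Inter_cov_shards_eq shard_cone_le_iff)

end

theorem theorem1p6:
  fixes W :: "'w monoid" and S :: "'w set"
    and \<rho> :: "'w \<Rightarrow> real ^ 'n \<Rightarrow> real ^ 'n" and B :: "(real ^ 'n) set"
  assumes "coxeter_system W S"
    and "finite (carrier W)"
    and "irreducible_coxeter W S"
    and "reflection_group_action W S \<rho> B"
  shows "poset_embedding
           (carrier W) (shard_le W S \<rho> B)
           (braid_interval W S \<one>\<^bsub>braid_group W S\<^esub>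
              (Delta W S \<otimes>\<^bsub>braid_group W S\<^esub> Delta W S))
           (braid_le W S)
           (Snap W S)"
proof -
  have "B \<in> components (- \<Union>(reflection_arrangement W \<rho>))"
    using assms(4) unfolding reflection_group_action_def regions_def by blast
  then obtain b where b: "b \<in> B" using in_components_nonempty by blast
  have cox: "group W" "S \<subseteq> carrier W" "generate W S = carrier W"
    using assms(1) unfolding coxeter_system_def by blast+
  interpret coxeter_reflections W S \<rho> B b
    using cox assms(2,4) b by (intro coxeter_reflections.intro coxeter_reflections_axioms.intro)
  show ?thesis
    unfolding poset_embedding_def using Snap_interval Snap_inj shard_le_iff braid_le_iff by blast
qed

end
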